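(* Let $0<\theta<1$ and $a_0,a_1,a\in\mathbb R$. Equalities are between spaces with equivalent quasi-norms. (1) Assume $1\le r\le p<\infty$ and $0<q_0,q_1,q\le\infty$. (i) If $a_0\ne a_1$ and $a=(1-\theta)a_0+\theta a_1$, then $\left(HL^{p,r}_{a_0,q_0},HL^{p,r}_{a_1,q_1}\right)_{\theta,q}=HL^{p,r}_{a,q}$. (ii) If $\frac1q=\frac{1-\theta}{q_0}+\frac{\theta}{q_1}$, then $\left(HL^{p,r}_{a,q_0},HL^{p,r}_{a,q_1}\right)_{\theta,q}=HL^{p,r}_{a,q}$. (2) If $0<q_0,q_1,q<\infty$, $1\le p_0\ne p_1\le\infty$, $1\le r_0,r_1\le\infty$ and $1\le r_i\le p_i<\infty$ for $i=0,1$, then $$\left(HL^{p_0,r_0}_{a_0,q_0},HL^{p_1,r_1}_{a_1,q_1}\right)_{\theta,q}=HL^{p,q}_{a,q}$$ provided that $a=(1-\theta)a_0+\theta a_1$, $\frac1p=\frac{1-\theta}{p_0}+\frac{\theta}{p_1}$ and $\frac1q=\frac{1-\theta}{q_0}+\frac\theta{q_1}$. In addition, if $p=q$, then $\left(HL^{p_0,r_0}_{a_0,q_0},HL^{p_1,r_1}_{a_1,q_1}\right)_{\theta,q}=K^p_{a,p}$. (3) If $0<q_0,q_1<\infty$, $a=(1-\theta)a_0+\theta a_1$ and $\frac1q=\frac{1-\theta}{q_0}+\frac\theta{q_1}$, then $$\left(K^{p_0}_{a_0,q_0},K^{p_1}_{a_1,q_1}\right)_{\theta,q}=HL^{p,q}_{a,q}$$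 provided that $1\le p_0\ne p_1\le\infty$ and $\frac1p=\frac{1-\theta}{p_0}+\frac\theta{p_1}$.
   Context: Let $\Omega\subset\mathbb R^N$ be measurable, $\mu$ Lebesgue measure. For measurable $f$ let $f^*(t)=\inf\{\lambda>0:\mu(\{|f|>\lambda\})\le t\}$, $\|f\|_{p,r}=\left(\int_0^\infty(t^{1/p}f^*(t))^r\frac{dt}t\right)^{1/r}$ for $0<p,r<\infty$ and $\|f\|_{p,\infty}=\sup_{t>0}t^{1/p}f^*(t)$ for $0<p\le\infty$; $L^{p,r}(A)$ is the space of measurable functions on $A$ with finite $\|\cdot\|_{p,r}$. Let $I=\{-1,0,1,2,\dots\}$, $\Omega_{-1}=\{\omega\in\Omega:|\omega|<1/2\}$, $\Omega_k=\{\omega\in\Omega:2^{k-1}\le|\omega|<2^k\}$ for $k\ge0$. $HL^{p,r}_{a,q}$ consists of the measurable $f$ on $\Omega$ with $f\chi_{\Omega_k}\in L^{p,r}(\Omega_k)$ for all $k\in I$ and $\|f\|_{HL^{p,r}_{a,q}}=\left(\sum_{k\in I}2^{kaq}\|f\chi_{\Omega_k}\|_{p,r}^q\right)^{1/q}<\infty$ ($\sup_k2^{ka}\|f\chi_{\Omega_k}\|_{p,r}$ if $q=\infty$). $K^p_{a,q}=HL^{p,p}_{a,q}$ is the non-homogeneous Herz space (norm $\left(\sum_{k\in I}2^{kaq}\|f\chi_{\Omega_k}\|_{L^p}^q\right)^{1/q}$). Real interpolation: for a compatible couple $(Z_0,Z_1)$ of quasi-Banach spaces and $z\in Z_0+Z_1$,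 $t>0$, let $K(t,z;Z_0,Z_1)=\inf\{\|z_0\|_{Z_0}+t\|z_1\|_{Z_1}:z=z_0+z_1,\ z_i\in Z_i\}$. $(Z_0,Z_1)_{\theta,q}$ is the space of $z\in Z_0+Z_1$ with $\left(\int_0^\infty(t^{-\theta}K(t,z;Z_0,Z_1))^q\frac{dt}t\right)^{1/q}<\infty$ ($\sup_{t>0}t^{-\theta}K(t,z;Z_0,Z_1)$ if $q=\infty$), with this quasi-norm. *)

theory Defs
  imports "HOL-Analysis.Analysis" "HOL-Probability.Essential_Supremum"
begin

text \<open>
  All quasi-norms take values in \<^typ>\<open>ennreal\<close>, and exponents in \<open>(0, \<infinity>]\<close> are also of type
  \<^typ>\<open>ennreal\<close>; there \<open>inverse \<infinity> = 0\<close>, so \<open>1 / \<infinity> = 0\<close> in the relations between exponents.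
\<close>

text \<open>Powers \<open>x\<^sup>a\<close> of extended nonnegative reals; only used with \<open>a > 0\<close>, where \<open>0\<^sup>a = 0\<close>.\<close>

definition epowr :: "ennreal \<Rightarrow> real \<Rightarrow> ennreal"  (infixr "epowr" 80) where
  "x epowr a = (if x = top then top else ennreal (enn2real x powr a))"

text \<open>
  A quasi-normed space of functions. Functions are used as representatives of their classes modulo
  equality almost everywhere: every quasi-norm below depends on \<open>f\<close> only through its class in the
  underlying measure space, and decompositions are required to hold almost everywhere.
\<close>

record 'f qn_space =
  elements :: "'f set"
  qnorm :: "'f \<Rightarrow> ennreal"

definition equivalent_spaces :: "'f qn_space \<Rightarrow> 'f qn_space \<Rightarrow> bool"  (infix "\<cong>\<^sub>q" 50) where
  "X \<cong>\<^sub>q Y \<longleftrightarrow> elements X = elements Y \<and>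
     (\<exists>C::real. 0 < C \<and> (\<forall>f\<in>elements X. qnorm X f \<le> ennreal C * qnorm Y f \<and>
                                        qnorm Y f \<le> ennreal C * qnorm X f))"


section \<open>Real interpolation\<close>

definition decompositions ::
  "'a measure \<Rightarrow> ('a \<Rightarrow> 'b::real_normed_vector) qn_space \<Rightarrow> ('a \<Rightarrow> 'b) qn_space \<Rightarrow>
   ('a \<Rightarrow> 'b) \<Rightarrow> (('a \<Rightarrow> 'b) \<times> ('a \<Rightarrow> 'b)) set" where
  "decompositions M Z0 Z1 z =
     {(z0, z1). z0 \<in> elements Z0 \<and> z1 \<in> elements Z1 \<and> (AE x in M. z x = z0 x + z1 x)}"

definition sum_space ::
  "'a measure \<Rightarrow> ('a \<Rightarrow> 'b::real_normed_vector) qn_space \<Rightarrow> ('a \<Rightarrow> 'b) qn_space \<Rightarrow> ('a \<Rightarrow> 'b) set" where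
  "sum_space M Z0 Z1 = {z \<in> borel_measurable M. decompositions M Z0 Z1 z \<noteq> {}}"

definition K_functional ::
  "'a measure \<Rightarrow> ('a \<Rightarrow> 'b::real_normed_vector) qn_space \<Rightarrow> ('a \<Rightarrow> 'b) qn_space \<Rightarrow>
   real \<Rightarrow> ('a \<Rightarrow> 'b) \<Rightarrow> ennreal" where
  "K_functional M Z0 Z1 t z =
     (INF (z0, z1) \<in> decompositions M Z0 Z1 z. qnorm Z0 z0 + ennreal t * qnorm Z1 z1)"

definition interpolation_norm ::
  "'a measure \<Rightarrow> ('a \<Rightarrow> 'b::real_normed_vector) qn_space \<Rightarrow> ('a \<Rightarrow> 'b) qn_space \<Rightarrow>
   real \<Rightarrow> ennreal \<Rightarrow> ('a \<Rightarrow> 'b) \<Rightarrow> ennreal" where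
  "interpolation_norm M Z0 Z1 \<theta> q z =
     (if q = top then SUP t\<in>{0<..}. ennreal (t powr - \<theta>) * K_functional M Z0 Z1 t z
      else (\<integral>\<^sup>+t\<in>{0<..}. (ennreal (t powr - \<theta>) * K_functional M Z0 Z1 t z) epowr enn2real q
                            * ennreal (1 / t) \<partial>lborel) epowr (1 / enn2real q))"

definition real_interpolation ::
  "'a measure \<Rightarrow> ('a \<Rightarrow> 'b::real_normed_vector) qn_space \<Rightarrow> ('a \<Rightarrow> 'b) qn_space \<Rightarrow>
   real \<Rightarrow> ennreal \<Rightarrow> ('a \<Rightarrow> 'b) qn_space" where
  "real_interpolation M Z0 Z1 \<theta> q =
     \<lparr>elements = {z \<in> sum_space M Z0 Z1. interpolation_norm M Z0 Z1 \<theta> q z < top},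
      qnorm = interpolation_norm M Z0 Z1 \<theta> q\<rparr>"


section \<open>Lorentz and Lebesgue spaces\<close>

definition rearrangement :: "'a measure \<Rightarrow> ('a \<Rightarrow> 'b::real_normed_vector) \<Rightarrow> real \<Rightarrow> ennreal" where
  "rearrangement M f t =
     (INF l\<in>{l::real. 0 < l \<and> emeasure M {x \<in> space M. l < norm (f x)} \<le> ennreal t}. ennreal l)"

text \<open>The case \<open>p = \<infinity>\<close>, \<open>r < \<infinity>\<close> of the following definition is never used.\<close>

definition lorentz_norm ::
  "'a measure \<Rightarrow> ennreal \<Rightarrow> ennreal \<Rightarrow> ('a \<Rightarrow> 'b::real_normed_vector) \<Rightarrow> ennreal" where
  "lorentz_norm M p r f =
     (if r = top then SUP t\<in>{0<..}. ennreal (t powr enn2real (inverse p)) * rearrangement M f t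
      else (\<integral>\<^sup>+t\<in>{0<..}. (ennreal (t powr enn2real (inverse p)) * rearrangement M f t) epowr enn2real r
                            * ennreal (1 / t) \<partial>lborel) epowr (1 / enn2real r))"

definition lorentz_space ::
  "'a measure \<Rightarrow> ennreal \<Rightarrow> ennreal \<Rightarrow> ('a \<Rightarrow> 'b::real_normed_vector) set" where
  "lorentz_space M p r = {f \<in> borel_measurable M. lorentz_norm M p r f < top}"

definition Lp_norm :: "'a measure \<Rightarrow> ennreal \<Rightarrow> ('a \<Rightarrow> 'b::real_normed_vector) \<Rightarrow> ennreal" where
  "Lp_norm M p f =
     (if p = top then esssup M (\<lambda>x. ennreal (norm (f x)))
      else (\<integral>\<^sup>+x. ennreal (norm (f x)) epowr enn2real p \<partial>M) epowr (1 / enn2real p))"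

definition Lp_space :: "'a measure \<Rightarrow> ennreal \<Rightarrow> ('a \<Rightarrow> 'b::real_normed_vector) set" where
  "Lp_space M p = {f \<in> borel_measurable M. Lp_norm M p f < top}"


section \<open>Herz-Lorentz and Herz spaces\<close>

definition shell :: "'n::euclidean_space set \<Rightarrow> int \<Rightarrow> 'n set" where
  "shell \<Omega> k = (if k = -1 then {\<omega>\<in>\<Omega>. norm \<omega> < 1 / 2}
                else {\<omega>\<in>\<Omega>. 2 powr (of_int k - 1) \<le> norm \<omega> \<and> norm \<omega> < 2 powr of_int k})"

definition cutoff ::
  "'n::euclidean_space set \<Rightarrow> int \<Rightarrow> ('n \<Rightarrow> 'b::real_normed_vector) \<Rightarrow> 'n \<Rightarrow> 'b" where
  "cutoff \<Omega> k f = (\<lambda>\<omega>. indicator (shell \<Omega> k) \<omega> *\<^sub>R f \<omega>)"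

definition weighted_lq_norm :: "real \<Rightarrow> ennreal \<Rightarrow> (int \<Rightarrow> ennreal) \<Rightarrow> ennreal" where
  "weighted_lq_norm a q s =
     (if q = top then SUP k\<in>{-1..}. ennreal (2 powr (of_int k * a)) * s k
      else (\<Sum>\<^sub>\<infinity>k\<in>{-1..}. ennreal (2 powr (of_int k * a * enn2real q)) * s k epowr enn2real q)
             epowr (1 / enn2real q))"

definition herz_lorentz_norm ::
  "'n::euclidean_space set \<Rightarrow> real \<Rightarrow> ennreal \<Rightarrow> ennreal \<Rightarrow> ennreal \<Rightarrow>
   ('n \<Rightarrow> 'b::real_normed_vector) \<Rightarrow> ennreal" where
  "herz_lorentz_norm \<Omega> a p r q f =
     weighted_lq_norm a q (\<lambda>k. lorentz_norm (lebesgue_on \<Omega>) p r (cutoff \<Omega> k f))"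

text \<open>\<open>herz_lorentz \<Omega> a p r q\<close> is \<open>HL\<close> with upper indices \<open>p, r\<close> and lower indices \<open>a, q\<close>.\<close>

definition herz_lorentz ::
  "'n::euclidean_space set \<Rightarrow> real \<Rightarrow> ennreal \<Rightarrow> ennreal \<Rightarrow> ennreal \<Rightarrow>
   ('n \<Rightarrow> 'b::real_normed_vector) qn_space" where
  "herz_lorentz \<Omega> a p r q =
     \<lparr>elements = {f \<in> borel_measurable (lebesgue_on \<Omega>).
        (\<forall>k\<ge>-1. cutoff \<Omega> k f \<in> lorentz_space (lebesgue_on (shell \<Omega> k)) p r) \<and>
        herz_lorentz_norm \<Omega> a p r q f < top},
      qnorm = herz_lorentz_norm \<Omega> a p r q\<rparr>"

text \<open>
  The non-homogeneous Herz space \<open>K\<close> (upper index \<open>p\<close>, lower indices \<open>a, q\<close>) is defined by its usual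
  norm, in terms of the Lebesgue norms of the pieces. Since the Lorentz norm with \<open>r = p\<close> is the
  \<open>L\<^sup>p\<close> norm, it coincides with \<open>herz_lorentz \<Omega> a p p q\<close>.
\<close>

definition herz_norm ::
  "'n::euclidean_space set \<Rightarrow> real \<Rightarrow> ennreal \<Rightarrow> ennreal \<Rightarrow>
   ('n \<Rightarrow> 'b::real_normed_vector) \<Rightarrow> ennreal" where
  "herz_norm \<Omega> a p q f =
     weighted_lq_norm a q (\<lambda>k. Lp_norm (lebesgue_on \<Omega>) p (cutoff \<Omega> k f))"

definition herz ::
  "'n::euclidean_space set \<Rightarrow> real \<Rightarrow> ennreal \<Rightarrow> ennreal \<Rightarrow>
   ('n \<Rightarrow> 'b::real_normed_vector) qn_space" where
  "herz \<Omega> a p q =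
     \<lparr>elements = {f \<in> borel_measurable (lebesgue_on \<Omega>).
        (\<forall>k\<ge>-1. cutoff \<Omega> k f \<in> Lp_space (lebesgue_on (shell \<Omega> k)) p) \<and>
        herz_norm \<Omega> a p q f < top},
      qnorm = herz_norm \<Omega> a p q\<rparr>"

end

theory Submission
  imports Defs "HOL-Real_Asymp.Real_Asymp"
begin

text \<open>
  A Herz--Lorentz space is a weighted \<open>\<ell>\<^sup>q\<close> sum, over the shells of \<open>\<Omega>\<close>, of Lorentz spaces. A
  decomposition of a function is the same thing as an independent choice of decompositions on all
  shells, so the theorem splits into a statement about sequences and one about a single Lorentz couple.
  The K-functional sees a function only through the set \<open>G\<close> of pairs of norms \<open>(x, y)\<close> of its
  decompositions. Most arguments are therefore about such sets: \<open>Kf\<close> is the K-functional, \<open>inorm\<close> the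
  interpolation quasi-norm, and \<open>lq_couple\<close> the set that belongs to an \<open>\<ell>\<^sup>q\<^sup>0\<close> sum and an \<open>\<ell>\<^sup>q\<^sup>1\<close> sum. With
  \<open>t = exp \<tau>\<close>, the measure \<open>dt/t\<close> becomes Lebesgue measure and all substitutions become affine.

  Suppose first that \<open>1/q = (1-\<theta>)/q\<^sub>0 + \<theta>/q\<^sub>1\<close>. The \<open>q\<close>-th power of the interpolation quasi-norm is, up to
  constants, the integral of \<open>exp ((1-\<theta>) q x + \<theta> q y)\<close> over the points \<open>(x, y)\<close> for which no decomposition
  has norms at most \<open>exp x\<close> and \<open>exp y\<close>: this is the layer-cake formula for \<open>K\<^sup>q\<close>, with \<open>\<tau> = x - y\<close>.
  The same region, with the same density, also computes the integral of
  \<open>exp (-\<eta> s)\<close> against the infimum \<open>L(s)\<close> of \<open>x\<^sup>q\<^sup>0 + exp s \<cdot> y\<^sup>q\<^sup>1\<close>, where \<open>\<eta> = \<theta> q / q\<^sub>1\<close>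
  (\<open>power_comparison\<close>). But \<open>L\<close> is additive over shells, since a sum of independently minimised terms is
  minimised termwise. Hence the \<open>q\<close>-th power of the interpolation quasi-norm of a sequence couple is
  comparable with the sum of those of its entries (\<open>lq_couple_inorm\<close>). If \<open>q\<^sub>1 = \<infinity>\<close>, then \<open>L\<close> is replaced by the
  least \<open>x\<^sup>q\<^sup>0\<close> under the constraint \<open>y \<le> exp s\<close>, which is additive for the same reason.

  It remains to interpolate on one shell. If both spaces there are the same one, nothing changes
  (\<open>inorm_diagonal\<close>). If they are Lorentz spaces with \<open>p\<^sub>0 \<noteq> p\<^sub>1\<close>, the upper bound comes from cutting \<open>f\<close> at
  the height \<open>f\<^sup>*(t)\<close> and the lower bound from \<open>f\<^sup>*(t) \<le> f\<^sub>0\<^sup>*(t/2) + f\<^sub>1\<^sup>*(t/2)\<close>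
  (\<open>lorentz_interpolation_upper\<close>, \<open>lorentz_interpolation_lower\<close>). Constants do not depend on the shell, and
  the Lebesgue spaces are the Lorentz spaces with \<open>r = p\<close>, including \<open>p = \<infinity>\<close>.

  If instead the two Lorentz spaces agree and the weights \<open>a\<^sub>0 \<noteq> a\<^sub>1\<close> differ, then the \<open>k\<close>-th shell is felt
  by \<open>K(exp \<tau>)\<close> only for \<open>\<tau>\<close> near \<open>k (a\<^sub>0 - a\<^sub>1) ln 2\<close>, with exponential decay away from there. This decay
  outweighs all differences between the exponents (\<open>lq_couple_geometric_weights\<close>). Both this case and the Lorentz upper
  bound end with the same Schur test for an exponential
  kernel (\<open>schur_exponential\<close>).
\<close>

section \<open>Powers of extended nonnegative reals\<close>

lemma epowr_top [simp]: "top epowr a = top"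
  by (simp add: epowr_def)

lemma epowr_zero [simp]: "0 epowr a = 0"
  by (simp add: epowr_def)

lemma epowr_ennreal: "0 \<le> x \<Longrightarrow> ennreal x epowr a = ennreal (x powr a)"
  by (simp add: epowr_def)

lemma epowr_exp: "ennreal (exp x) epowr a = ennreal (exp (a * x))"
  by (simp add: epowr_ennreal powr_def)

lemma epowr_by_one [simp]: "x epowr 1 = x"
  by (cases x) (simp_all add: epowr_ennreal)

lemma epowr_mono: "0 < a \<Longrightarrow> x \<le> y \<Longrightarrow> x epowr a \<le> y epowr a"
  by (cases x; cases y) (auto simp: epowr_ennreal top_unique intro!: powr_mono2 ennreal_leI)

lemma epowr_strict_mono: "0 < a \<Longrightarrow> x < y \<Longrightarrow> x epowr a < y epowr a"
  by (cases x; cases y) (auto simp: epowr_ennreal ennreal_less_iff powr_less_mono2)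

lemma epowr_le_iff: "0 < a \<Longrightarrow> x epowr a \<le> y epowr a \<longleftrightarrow> x \<le> y"
  by (meson epowr_mono epowr_strict_mono not_le)

lemma epowr_mult: "0 < a \<Longrightarrow> (x * y) epowr a = x epowr a * y epowr a"
  apply (cases x; cases y)
  subgoal by (simp add: epowr_ennreal powr_mult flip: ennreal_mult)
  subgoal for r by (cases "r = 0") (simp_all add: epowr_ennreal ennreal_mult_top powr_def)
  subgoal for r by (cases "r = 0") (simp_all add: epowr_ennreal ennreal_top_mult powr_def)
  by simp

lemma epowr_epowr: "(x epowr a) epowr b = x epowr (a * b)"
  by (cases x) (simp_all add: epowr_ennreal powr_powr)

lemma epowr_add: "0 < a \<Longrightarrow> 0 < b \<Longrightarrow> x epowr (a + b) = x epowr a * x epowr b"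
  by (cases x) (simp_all add: epowr_ennreal powr_add flip: ennreal_mult)

lemma epowr_inverse_cancel [simp]:
  "a \<noteq> 0 \<Longrightarrow> (x epowr a) epowr (1 / a) = x" "a \<noteq> 0 \<Longrightarrow> (x epowr (1 / a)) epowr a = x"
  by (simp_all add: epowr_epowr)

lemma epowr_less_top_iff [simp]: "x epowr a < top \<longleftrightarrow> x < top"
  by (cases x) (simp_all add: epowr_ennreal)

lemma epowr_eq_0_iff [simp]: "x epowr a = 0 \<longleftrightarrow> x = 0"
  by (cases x) (auto simp: epowr_ennreal)

lemma epowr_max: "0 < a \<Longrightarrow> max x y epowr a = max (x epowr a) (y epowr a)"
  by (auto simp: max_def epowr_le_iff)

lemma epowr_add_le: assumes "0 < a" shows "(x + y) epowr a \<le> ennreal (2 powr a) * (x epowr a + y epowr a)"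
proof -
  have "x + y \<le> ennreal 2 * max x y"
    using add_mono[of x "max x y" y "max x y"] by (simp add: mult_2)
  then have "(x + y) epowr a \<le> (ennreal 2 * max x y) epowr a"
    using assms by (rule epowr_mono[rotated])
  also have "\<dots> = ennreal (2 powr a) * max (x epowr a) (y epowr a)"
    using assms by (simp add: epowr_mult epowr_max) (simp add: epowr_ennreal flip: ennreal_numeral)
  also have "\<dots> \<le> ennreal (2 powr a) * (x epowr a + y epowr a)"
    by (intro mult_left_mono) (simp_all add: add_increasing add_increasing2)
  finally show ?thesis .
qed

lemma epowr_measurable [measurable (raw)]:
  assumes [measurable]: "f \<in> borel_measurable M"
  shows "(\<lambda>x. f x epowr a) \<in> borel_measurable M"
  unfolding epowr_def by measurable

lemma exponent_cases:
  assumes "0 < (q::ennreal)"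
  obtains "q = top" | r where "0 < r" "q = ennreal r"
  using assms by (cases q) auto

lemma mult_ennreal_exp_cancel: "ennreal (exp x) * (ennreal (exp (- x)) * y) = y"
  by (simp add: mult.assoc[symmetric] exp_minus_inverse flip: ennreal_mult)

lemma le_mult_exp_iff: "x \<le> ennreal (exp c) * y \<longleftrightarrow> ennreal (exp (- c)) * x \<le> y"
proof
  assume "x \<le> ennreal (exp c) * y"
  then have "ennreal (exp (- c)) * x \<le> ennreal (exp (- c)) * (ennreal (exp c) * y)"
    by (intro mult_left_mono) auto
  then show "ennreal (exp (- c)) * x \<le> y" using mult_ennreal_exp_cancel[of "- c"] by simp
next
  assume "ennreal (exp (- c)) * x \<le> y"
  then have "ennreal (exp c) * (ennreal (exp (- c)) * x) \<le> ennreal (exp c) * y"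
    by (intro mult_left_mono) auto
  then show "x \<le> ennreal (exp c) * y" by (simp only: mult_ennreal_exp_cancel)
qed

section \<open>Integrals over the line\<close>

lemma is_interval_borel:
  assumes "is_interval (S :: real set)" shows "S \<in> sets borel"
  using real_interval_borel_measurable assms by blast

lemma borel_measurable_antimono_ennreal:
  fixes f :: "real \<Rightarrow> ennreal"
  assumes "\<And>x y. x \<le> y \<Longrightarrow> f y \<le> f x"
  shows "f \<in> borel_measurable borel"
proof (rule borel_measurableI_less)
  fix c
  have "is_interval {x. f x < c}"
    unfolding is_interval_1 using assms by (auto intro: le_less_trans)
  then show "{x \<in> space borel. f x < c} \<in> sets borel"
    by (simp add: is_interval_borel)
qed

lemma borel_measurable_mono_ennreal:
  fixes f :: "real \<Rightarrow> ennreal"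
  assumes "\<And>x y. x \<le> y \<Longrightarrow> f x \<le> f y"
  shows "f \<in> borel_measurable borel"
proof (rule borel_measurableI_less)
  fix c
  have "is_interval {x. f x < c}"
    unfolding is_interval_1 using assms by (auto intro: le_less_trans)
  then show "{x \<in> space borel. f x < c} \<in> sets borel"
    by (simp add: is_interval_borel)
qed

lemma nn_integral_SUP_indicator:
  assumes "incseq A" "\<And>n. A n \<in> sets M" and f: "f \<in> borel_measurable M"
  shows "(\<integral>\<^sup>+x. f x * indicator (\<Union>n. A n) x \<partial>M) = (SUP n. \<integral>\<^sup>+x. f x * indicator (A n) x \<partial>M)"
proof -
  have "(SUP n. emeasure (density M f) (A n)) = emeasure (density M f) (\<Union>n. A n)"
    using assms by (intro SUP_emeasure_incseq) auto
  then show ?thesis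
    using assms by (simp add: emeasure_density sets.countable_UN)
qed

text \<open>Passage to logarithmic coordinates. Both the Lorentz quasi-norms and the interpolation quasi-norms
  are integrals against \<open>dt/t\<close>.\<close>

lemma nn_integral_dt_over_t:
  assumes [measurable]: "F \<in> borel_measurable borel"
  shows "(\<integral>\<^sup>+t\<in>{0<..}. F t * ennreal (1 / t) \<partial>lborel) = (\<integral>\<^sup>+x. F (exp x) \<partial>lborel)"
proof -
  \<comment> \<open>The substitution rule is for compact intervals; both sides are exhausted by such intervals.\<close>
  have U1: "(\<Union>n::nat. {exp (- real (Suc n))..exp (real (Suc n))}) = {0<..}"
  proof safe
    fix t :: real assume "t > 0"
    obtain n :: nat where "\<bar>ln t\<bar> \<le> real n" using real_arch_simple by blast
    then have "- real (Suc n) \<le> ln t" "ln t \<le> real (Suc n)" by linarith+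
    then have "exp (- real (Suc n)) \<le> t" "t \<le> exp (real (Suc n))"
      using \<open>t > 0\<close> by (metis exp_le_cancel_iff exp_ln)+
    then show "t \<in> (\<Union>n::nat. {exp (- real (Suc n))..exp (real (Suc n))})" by auto
  qed (auto intro: less_le_trans[OF exp_gt_zero])
  have U2: "(\<Union>n::nat. {- real (Suc n)..real (Suc n)}) = UNIV"
  proof safe
    fix t :: real
    obtain n :: nat where "\<bar>t\<bar> \<le> real n" using real_arch_simple by blast
    then have "t \<in> {- real (Suc n)..real (Suc n)}" by auto
    then show "t \<in> (\<Union>n::nat. {- real (Suc n)..real (Suc n)})" by blast
  qed auto
  have "(\<integral>\<^sup>+t\<in>{0<..}. F t * ennreal (1 / t) \<partial>lborel) =
    (SUP n::nat. \<integral>\<^sup>+t. (F t * ennreal (1 / t)) * indicator {exp (- real (Suc n))..exp (real (Suc n))} t \<partial>lborel)"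
    by (subst U1[symmetric], rule nn_integral_SUP_indicator)
      (auto simp: incseq_def intro: order_trans)
  also have "\<dots> = (SUP n::nat. \<integral>\<^sup>+x. F (exp x) * indicator {- real (Suc n)..real (Suc n)} x \<partial>lborel)"
  proof (rule SUP_cong[OF refl])
    fix n :: nat
    have "(\<integral>\<^sup>+t. (F t * ennreal (1 / t)) * indicator {exp (- real (Suc n))..exp (real (Suc n))} t \<partial>lborel)
      = (\<integral>\<^sup>+x. (F (exp x) * ennreal (1 / exp x)) * ennreal (exp x) * indicator {- real (Suc n)..real (Suc n)} x \<partial>lborel)"
      by (rule nn_integral_substitution_aux) (auto intro!: derivative_eq_intros continuous_intros)
    also have "\<dots> = (\<integral>\<^sup>+x. F (exp x) * indicator {- real (Suc n)..real (Suc n)} x \<partial>lborel)"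
      by (intro nn_integral_cong) (simp add: mult.assoc flip: ennreal_mult)
    finally show "(\<integral>\<^sup>+t. (F t * ennreal (1 / t)) * indicator {exp (- real (Suc n))..exp (real (Suc n))} t \<partial>lborel)
      = (\<integral>\<^sup>+x. F (exp x) * indicator {- real (Suc n)..real (Suc n)} x \<partial>lborel)" .
  qed
  also have "\<dots> = (\<integral>\<^sup>+x. F (exp x) * indicator UNIV x \<partial>lborel)"
    by (subst U2[symmetric], rule nn_integral_SUP_indicator[symmetric])
      (auto simp: incseq_def)
  finally show ?thesis by simp
qed

lemma nn_integral_exp_atLeast:
  assumes "0 < c"
  shows "(\<integral>\<^sup>+x. ennreal (exp (- c * x)) * indicator {b..} x \<partial>lborel) = ennreal (exp (- c * b) / c)"
proof -
  have lim: "((\<lambda>x. - exp (- c * x) / c) \<longlongrightarrow> 0) at_top"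
    using assms by real_asymp
  show ?thesis
    by (subst nn_integral_FTC_atLeast[where F="\<lambda>x. - exp (- c * x) / c", OF _ _ _ lim])
      (use assms in \<open>auto intro!: derivative_eq_intros\<close>)
qed

lemma nn_integral_exp_atMost:
  assumes "0 < c"
  shows "(\<integral>\<^sup>+x. ennreal (exp (c * x)) * indicator {..b} x \<partial>lborel) = ennreal (exp (c * b) / c)"
proof -
  have "(\<integral>\<^sup>+x. ennreal (exp (c * x)) * indicator {..b} x \<partial>lborel)
    = (\<integral>\<^sup>+x. ennreal (exp (c * (0 + (-1) * x))) * indicator {..b} (0 + (-1) * x) \<partial>lborel)"
    by (subst nn_integral_real_affine[where c="-1" and t=0]) auto
  also have "\<dots> = (\<integral>\<^sup>+x. ennreal (exp (- c * x)) * indicator {- b..} x \<partial>lborel)"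
    by (intro nn_integral_cong) (auto split: split_indicator)
  finally show ?thesis using nn_integral_exp_atLeast[OF assms, of "- b"] by simp
qed

lemma ennreal_unbounded_eq_top:
  assumes "\<And>r. 0 < r \<Longrightarrow> ennreal r \<le> X"
  shows "X = top"
proof (cases X)
  case (real x)
  then show ?thesis using assms[of "x + 1"] by (simp add: ennreal_le_iff)
qed

text \<open>The layer-cake formula for a single number: \<open>X\<^sup>c / c\<close> is the integral of \<open>exp (c x)\<close> over the levels
  \<open>exp x \<le> X\<close>. It turns powers of a K-functional into areas.\<close>

lemma nn_integral_exp_sublevel:
  assumes "0 < c"
  shows "(\<integral>\<^sup>+x. ennreal (exp (c * x)) * indicator {x. ennreal (exp x) \<le> X} x \<partial>lborel) = ennreal (1 / c) * X epowr c"
proof -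
  have *: "(\<integral>\<^sup>+x. ennreal (exp (c * x)) * indicator {x. ennreal (exp x) \<le> ennreal r} x \<partial>lborel) = ennreal (1 / c) * ennreal r epowr c"
    if "r > 0" for r
  proof -
    have "{x. ennreal (exp x) \<le> ennreal r} = {..ln r}"
      using that by (auto simp: ln_ge_iff ennreal_le_iff)
    then have "(\<integral>\<^sup>+x. ennreal (exp (c * x)) * indicator {x. ennreal (exp x) \<le> ennreal r} x \<partial>lborel)
      = ennreal (exp (c * ln r) / c)"
      by (simp only: nn_integral_exp_atMost[OF assms])
    then show ?thesis using that assms
      by (simp add: epowr_ennreal powr_def flip: ennreal_mult)
  qed
  show ?thesis
  proof (cases X)
    case (real r)
    show ?thesis
    proof (cases "r = 0")
      case True
      have "{x. ennreal (exp x) \<le> X} = {}" using real True by auto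
      then show ?thesis using True real by simp
    next
      case False then show ?thesis using * real by simp
    qed
  next
    case top
    have "ennreal r \<le> (\<integral>\<^sup>+x. ennreal (exp (c * x)) * indicator {x. ennreal (exp x) \<le> X} x \<partial>lborel)" if "r > 0" for r
    proof -
      have "(\<integral>\<^sup>+x. ennreal (exp (c * x)) * indicator {x. ennreal (exp x) \<le> ennreal ((c * r) powr (1 / c))} x \<partial>lborel)
        \<le> (\<integral>\<^sup>+x. ennreal (exp (c * x)) * indicator {x. ennreal (exp x) \<le> X} x \<partial>lborel)"
        by (intro nn_integral_mono) (auto simp: top split: split_indicator)
      then show ?thesis using that assms
        by (subst (asm) *) (simp_all add: epowr_ennreal powr_powr flip: ennreal_mult)
    qed
    then have "(\<integral>\<^sup>+x. ennreal (exp (c * x)) * indicator {x. ennreal (exp x) \<le> X} x \<partial>lborel) = top"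
      by (rule ennreal_unbounded_eq_top)
    then show ?thesis using top assms by (simp add: ennreal_mult_top)
  qed
qed

lemma nn_integral_exp_abs_le:
  assumes "0 < c" "d \<noteq> 0"
  shows "(\<integral>\<^sup>+x. ennreal (exp (- c * \<bar>t - d * x\<bar>)) \<partial>lborel) \<le> ennreal (2 / (c * \<bar>d\<bar>))"
proof -
  have 0: "(\<integral>\<^sup>+x. ennreal (exp (- c * \<bar>x\<bar>)) \<partial>lborel) \<le> ennreal (2 / c)"
  proof -
    have "(\<integral>\<^sup>+x. ennreal (exp (- c * \<bar>x\<bar>)) \<partial>lborel) \<le>
      (\<integral>\<^sup>+x. ennreal (exp (- c * x)) * indicator {0..} x + ennreal (exp (c * x)) * indicator {..0} x \<partial>lborel)"
      by (intro nn_integral_mono) (auto split: split_indicator)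
    also have "\<dots> = ennreal (2 / c)" using assms
      by (subst nn_integral_add) (simp_all only: nn_integral_exp_atLeast nn_integral_exp_atMost, simp_all flip: ennreal_plus)
    finally show ?thesis .
  qed
  have "(\<integral>\<^sup>+x. ennreal (exp (- c * \<bar>x\<bar>)) \<partial>lborel) =
     ennreal \<bar>d\<bar> * (\<integral>\<^sup>+x. ennreal (exp (- c * \<bar>t + (-d) * x\<bar>)) \<partial>lborel)"
    by (subst nn_integral_real_affine[where c="-d" and t=t]) (use assms in auto)
  then have "ennreal \<bar>d\<bar> * (\<integral>\<^sup>+x. ennreal (exp (- c * \<bar>t - d * x\<bar>)) \<partial>lborel) \<le> ennreal (2 / c)"
    using 0 by simp
  also have "\<dots> = ennreal \<bar>d\<bar> * ennreal (2 / (c * \<bar>d\<bar>))"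
    using assms by (simp flip: ennreal_mult)
  finally show ?thesis using assms by (subst (asm) ennreal_mult_le_mult_iff) auto
qed

lemma ennreal_exp_mult:
  "ennreal (exp a) * (ennreal (exp b) * x) = ennreal (exp (a + b)) * x"
  "ennreal (exp a) * ennreal (exp b) = ennreal (exp (a + b))"
  by (simp_all add: exp_add ennreal_mult mult.assoc)

lemma ennreal_mult_mult: "0 \<le> a \<Longrightarrow> 0 \<le> b \<Longrightarrow> ennreal a * (ennreal b * x) = ennreal (a * b) * x"
  by (simp add: ennreal_mult mult.assoc)

lemma ennreal_le_divide:
  assumes "0 < a" "ennreal a * x \<le> y"
  shows "x \<le> ennreal (1 / a) * y"
proof -
  have "x = ennreal (1 / a * a) * x" using assms by simp
  also have "\<dots> = ennreal (1 / a) * (ennreal a * x)"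
    using assms by (subst ennreal_mult) (simp_all add: mult.assoc)
  also have "\<dots> \<le> ennreal (1 / a) * y" using assms by (intro mult_left_mono) auto
  finally show ?thesis .
qed

section \<open>Quasi-norms of extended nonnegative functions\<close>

text \<open>One quasi-norm covers the sequence norms (counting measure) and, in logarithmic coordinates, the
  Lorentz and interpolation quasi-norms (Lebesgue measure). For \<open>q = \<infinity>\<close> it is a true supremum rather than an
  essential one, as in the definitions of these spaces.\<close>

definition enorm :: "'a measure \<Rightarrow> ennreal \<Rightarrow> ('a \<Rightarrow> ennreal) \<Rightarrow> ennreal" where
  "enorm M q F = (if q = top then SUP x\<in>space M. F x
     else (\<integral>\<^sup>+x. F x epowr enn2real q \<partial>M) epowr (1 / enn2real q))"

lemma enorm_ennreal: "0 < r \<Longrightarrow> enorm M (ennreal r) F = (\<integral>\<^sup>+x. F x epowr r \<partial>M) epowr (1 / r)"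
  by (simp add: enorm_def)

lemma enorm_powr: "0 < r \<Longrightarrow> enorm M (ennreal r) F epowr r = (\<integral>\<^sup>+x. F x epowr r \<partial>M)"
  by (simp add: enorm_ennreal)

lemma enorm_mono: "0 < q \<Longrightarrow> (\<And>x. x \<in> space M \<Longrightarrow> F x \<le> G x) \<Longrightarrow> enorm M q F \<le> enorm M q G"
  by (erule exponent_cases)
    (auto simp: enorm_def intro!: SUP_mono epowr_mono nn_integral_mono)

lemma enorm_cong: "(\<And>x. x \<in> space M \<Longrightarrow> F x = G x) \<Longrightarrow> enorm M q F = enorm M q G"
  unfolding enorm_def by (auto cong: nn_integral_cong)

lemma enorm_cmult:
  assumes "0 < q" "space M \<noteq> {}" and [measurable]: "F \<in> borel_measurable M"
  shows "enorm M q (\<lambda>x. c * F x) = c * enorm M q F"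
  using assms(1)
proof (cases rule: exponent_cases)
  case 1
  then show ?thesis using assms(2) by (simp add: enorm_def SUP_mult_left_ennreal)
next
  case (2 r)
  then show ?thesis
    by (simp add: enorm_ennreal epowr_mult nn_integral_cmult)
qed

lemma enorm_add_le:
  assumes "0 < q" and [measurable]: "F \<in> borel_measurable M" "G \<in> borel_measurable M"
  shows "enorm M q (\<lambda>x. F x + G x) \<le> ennreal (2 powr (1 + 1 / enn2real q)) * (enorm M q F + enorm M q G)"
  using assms(1)
proof (cases rule: exponent_cases)
  case 1
  have "(SUP x\<in>space M. F x + G x) \<le> (SUP x\<in>space M. F x) + (SUP x\<in>space M. G x)"
    by (intro SUP_least add_mono SUP_upper)
  also have "\<dots> \<le> 2 * \<dots>"
    by (simp add: mult_2 add_increasing)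
  finally show ?thesis using 1 by (simp add: enorm_def)
next
  case (2 r)
  let ?A = "\<integral>\<^sup>+x. F x epowr r \<partial>M" and ?B = "\<integral>\<^sup>+x. G x epowr r \<partial>M"
  have "(\<integral>\<^sup>+x. (F x + G x) epowr r \<partial>M) \<le> (\<integral>\<^sup>+x. ennreal (2 powr r) * (F x epowr r + G x epowr r) \<partial>M)"
    using 2 by (intro nn_integral_mono epowr_add_le)
  also have "\<dots> = ennreal (2 powr r) * (?A + ?B)"
    by (simp add: nn_integral_cmult nn_integral_add)
  finally have "enorm M q (\<lambda>x. F x + G x) \<le> (ennreal (2 powr r) * (?A + ?B)) epowr (1 / r)"
    using 2 by (simp add: enorm_ennreal epowr_mono)
  also have "\<dots> = ennreal 2 * (?A + ?B) epowr (1 / r)"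
    using 2 by (simp add: epowr_mult epowr_ennreal powr_powr)
  also have "\<dots> \<le> ennreal 2 * (ennreal (2 powr (1 / r)) * (?A epowr (1 / r) + ?B epowr (1 / r)))"
    using 2 by (intro mult_left_mono epowr_add_le) auto
  also have "\<dots> = ennreal (2 powr (1 + 1 / r)) * (enorm M q F + enorm M q G)"
    using 2 by (simp add: enorm_ennreal powr_add mult.assoc ennreal_mult)
  finally show ?thesis using 2 by simp
qed

lemma enorm_lborel_affine:
  fixes c :: real
  assumes "0 < q" "c \<noteq> 0" and [measurable]: "F \<in> borel_measurable borel"
  shows "enorm lborel q F = ennreal (\<bar>c\<bar> powr (1 / enn2real q)) * enorm lborel q (\<lambda>x. F (t + c * x))"
  using assms(1)
proof (cases rule: exponent_cases)
  case 1
  have "range F = range (\<lambda>x. F (t + c * x))"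
  proof safe
    fix x have "F x = F (t + c * ((x - t) / c))" using \<open>c \<noteq> 0\<close> by simp
    then show "F x \<in> range (\<lambda>x. F (t + c * x))" by blast
  qed auto
  then show ?thesis using 1 assms(2) by (simp add: enorm_def)
next
  case (2 r)
  then have "(\<integral>\<^sup>+x. F x epowr r \<partial>lborel) = ennreal \<bar>c\<bar> * (\<integral>\<^sup>+x. F (t + c * x) epowr r \<partial>lborel)"
    by (subst nn_integral_real_affine[OF _ assms(2), of _ t]) auto
  then show ?thesis using 2
    by (simp add: enorm_ennreal epowr_mult epowr_ennreal)
qed

lemma enorm_count_space_ge:
  assumes "0 < q" "k \<in> I"
  shows "F k \<le> enorm (count_space I) q F"
  using assms(1)
proof (cases rule: exponent_cases)
  case 1 then show ?thesis using assms(2) by (auto simp: enorm_def intro: SUP_upper)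
next
  case (2 r)
  have "F k epowr r \<le> (\<integral>\<^sup>+k. F k epowr r \<partial>count_space I)"
    by (rule nn_integral_ge_point[OF assms(2)])
  then have "(F k epowr r) epowr (1 / r) \<le> enorm (count_space I) q F"
    using 2 by (simp add: enorm_ennreal epowr_mono del: epowr_inverse_cancel)
  then show ?thesis using 2 by simp
qed

text \<open>Pointwise boundedness by the \<open>L\<^sup>s\<close> quasi-norm \<open>S\<close> upgrades to every exponent \<open>q \<ge> s\<close>, because
  \<open>h\<^sup>q \<le> (A S)\<^sup>q\<^sup>-\<^sup>s h\<^sup>s\<close>. It holds for sequences, and, up to a constant, for decreasing functions with a
  power weight; this gives the inclusions \<open>\<ell>\<^sup>s \<subseteq> \<ell>\<^sup>q\<close> and \<open>L\<^sup>p\<^sup>,\<^sup>s \<subseteq> L\<^sup>p\<^sup>,\<^sup>q\<close>.\<close>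

lemma enorm_le_of_pointwise_bound:
  assumes [measurable]: "h \<in> borel_measurable M" and A: "1 \<le> A" and s: "0 < s" "ennreal s \<le> q"
    and le: "\<And>x. x \<in> space M \<Longrightarrow> h x \<le> ennreal A * enorm M (ennreal s) h"
  shows "enorm M q h \<le> ennreal A * enorm M (ennreal s) h"
proof -
  define S where "S = enorm M (ennreal s) h"
  have S: "S \<le> ennreal A * S"
    using mult_right_mono[of 1 "ennreal A" S] A by simp
  have "0 < q" using s by (auto intro: less_le_trans[of 0 "ennreal s"])
  then show ?thesis
  proof (cases rule: exponent_cases)
    case 1
    then show ?thesis using le by (auto simp: enorm_def[of _ top] intro!: SUP_least)
  next
    case (2 t)
    show ?thesis
    proof (cases "s = t")
      case True
      then show ?thesis using 2 S by (simp add: S_def)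
    next
      case False
      then have st: "s < t" using 2 s by (simp add: ennreal_le_iff)
      have "(\<integral>\<^sup>+x. h x epowr t \<partial>M) \<le> (\<integral>\<^sup>+x. (ennreal A * S) epowr (t - s) * h x epowr s \<partial>M)"
      proof (rule nn_integral_mono)
        fix x assume "x \<in> space M"
        then have "h x epowr (t - s) * h x epowr s \<le> (ennreal A * S) epowr (t - s) * h x epowr s"
          using st le by (intro mult_right_mono epowr_mono) (auto simp: S_def)
        then show "h x epowr t \<le> (ennreal A * S) epowr (t - s) * h x epowr s"
          using epowr_add[of "t - s" s "h x"] s st by simp
      qed
      also have "\<dots> = (ennreal A * S) epowr (t - s) * S epowr s"
        unfolding S_def enorm_powr[OF s(1)] by (rule nn_integral_cmult) measurable
      also have "\<dots> \<le> (ennreal A * S) epowr (t - s) * (ennreal A * S) epowr s"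
        using S s by (intro mult_left_mono epowr_mono) auto
      also have "\<dots> = (ennreal A * S) epowr t"
        using epowr_add[of "t - s" s "ennreal A * S"] s st by simp
      finally have "enorm M q h \<le> ((ennreal A * S) epowr t) epowr (1 / t)"
        unfolding 2(2) enorm_ennreal[OF 2(1)] using 2(1) by (intro epowr_mono) auto
      then show ?thesis unfolding S_def using 2(1) by (subst (asm) epowr_inverse_cancel) simp_all
    qed
  qed
qed

lemma enorm_count_space_antimono:
  assumes "0 < s" "ennreal s \<le> q"
  shows "enorm (count_space I) q F \<le> enorm (count_space I) (ennreal s) F"
  using enorm_le_of_pointwise_bound[of F "count_space I" 1 s q] enorm_count_space_ge[of "ennreal s" _ I F] assms by simp

section \<open>The K-functional of a set of pairs\<close>

text \<open>The K-functional at \<open>t = exp \<tau>\<close> of an element whose decompositions have the pairs of norms in \<open>G\<close>.\<close>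

definition Kf :: "(ennreal \<times> ennreal) set \<Rightarrow> real \<Rightarrow> ennreal" where
  "Kf G \<tau> = (INF (x, y)\<in>G. x + ennreal (exp \<tau>) * y)"

definition inorm :: "(ennreal \<times> ennreal) set \<Rightarrow> real \<Rightarrow> ennreal \<Rightarrow> ennreal" where
  "inorm G \<theta> q = enorm lborel q (\<lambda>\<tau>. ennreal (exp (- \<theta> * \<tau>)) * Kf G \<tau>)"

lemma Kf_le: "(x, y) \<in> G \<Longrightarrow> Kf G \<tau> \<le> x + ennreal (exp \<tau>) * y"
  unfolding Kf_def by (rule INF_lower2) auto

lemma Kf_ge: "(\<And>x y. (x, y) \<in> G \<Longrightarrow> c \<le> x + ennreal (exp \<tau>) * y) \<Longrightarrow> c \<le> Kf G \<tau>"
  unfolding Kf_def by (rule INF_greatest) auto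

lemma Kf_less: "Kf G \<tau> < c \<Longrightarrow> \<exists>x y. (x, y) \<in> G \<and> x + ennreal (exp \<tau>) * y < c"
  unfolding Kf_def INF_less_iff by auto

lemma Kf_mono: "s \<le> t \<Longrightarrow> Kf G s \<le> Kf G t"
  unfolding Kf_def by (intro INF_mono) (auto intro!: add_mono mult_right_mono bexI)

lemma Kf_measurable [measurable]: "Kf G \<in> borel_measurable borel"
  by (rule borel_measurable_mono_ennreal) (rule Kf_mono)

text \<open>Multiplying the two norms by constants only rescales \<open>Kf\<close> and translates its argument; the
  interpolation quasi-norm picks up the geometric mean of the constants. This is how the weights of the
  individual shells enter.\<close>

lemma Kf_scale:
  "Kf ((\<lambda>(x, y). (ennreal (exp \<alpha>) * x, ennreal (exp \<beta>) * y)) ` G) \<tau> = ennreal (exp \<alpha>) * Kf G (\<tau> + \<beta> - \<alpha>)"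
proof (rule antisym)
  have *: "ennreal (exp \<alpha>) * x + ennreal (exp \<tau>) * (ennreal (exp \<beta>) * y) =
     ennreal (exp \<alpha>) * (x + ennreal (exp (\<tau> + \<beta> - \<alpha>)) * y)" for x y
    by (simp add: distrib_left ennreal_exp_mult)
  show "Kf ((\<lambda>(x, y). (ennreal (exp \<alpha>) * x, ennreal (exp \<beta>) * y)) ` G) \<tau> \<le> ennreal (exp \<alpha>) * Kf G (\<tau> + \<beta> - \<alpha>)"
    unfolding le_mult_exp_iff
  proof (rule Kf_ge)
    fix x y assume "(x, y) \<in> G"
    then show "ennreal (exp (- \<alpha>)) * Kf ((\<lambda>(x, y). (ennreal (exp \<alpha>) * x, ennreal (exp \<beta>) * y)) ` G) \<tau>
      \<le> x + ennreal (exp (\<tau> + \<beta> - \<alpha>)) * y"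
      unfolding le_mult_exp_iff[symmetric] *[symmetric] by (intro Kf_le) force
  qed
  show "ennreal (exp \<alpha>) * Kf G (\<tau> + \<beta> - \<alpha>) \<le> Kf ((\<lambda>(x, y). (ennreal (exp \<alpha>) * x, ennreal (exp \<beta>) * y)) ` G) \<tau>"
    by (rule Kf_ge) (auto simp: * intro!: mult_left_mono Kf_le)
qed

lemma inorm_scale:
  assumes "0 < q"
  shows "inorm ((\<lambda>(x, y). (ennreal (exp \<alpha>) * x, ennreal (exp \<beta>) * y)) ` G) \<theta> q
    = ennreal (exp ((1 - \<theta>) * \<alpha> + \<theta> * \<beta>)) * inorm G \<theta> q"
proof -
  have *: "ennreal (exp (- \<theta> * \<tau>)) * (ennreal (exp \<alpha>) * K) =
    ennreal (exp ((1 - \<theta>) * \<alpha> + \<theta> * \<beta>)) * (ennreal (exp (- \<theta> * (\<beta> - \<alpha> + 1 * \<tau>))) * K)" for \<tau> K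
    by (simp add: ennreal_exp_mult algebra_simps)
  have "inorm ((\<lambda>(x, y). (ennreal (exp \<alpha>) * x, ennreal (exp \<beta>) * y)) ` G) \<theta> q =
    enorm lborel q (\<lambda>\<tau>. ennreal (exp ((1 - \<theta>) * \<alpha> + \<theta> * \<beta>)) *
      (ennreal (exp (- \<theta> * (\<beta> - \<alpha> + 1 * \<tau>))) * Kf G (\<beta> - \<alpha> + 1 * \<tau>)))"
    unfolding inorm_def Kf_scale * by (simp add: algebra_simps)
  also have "\<dots> = ennreal (exp ((1 - \<theta>) * \<alpha> + \<theta> * \<beta>)) *
     enorm lborel q (\<lambda>\<tau>. ennreal (exp (- \<theta> * (\<beta> - \<alpha> + 1 * \<tau>))) * Kf G (\<beta> - \<alpha> + 1 * \<tau>))"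
    using assms by (intro enorm_cmult) auto
  also have "enorm lborel q (\<lambda>\<tau>. ennreal (exp (- \<theta> * (\<beta> - \<alpha> + 1 * \<tau>))) * Kf G (\<beta> - \<alpha> + 1 * \<tau>)) = inorm G \<theta> q"
    unfolding inorm_def using assms by (subst (2) enorm_lborel_affine[where c=1 and t="\<beta> - \<alpha>"]) auto
  finally show ?thesis .
qed

lemma Kf_swap: "Kf (prod.swap ` G) \<tau> = ennreal (exp \<tau>) * Kf G (- \<tau>)"
proof (rule antisym)
  have *: "y + ennreal (exp \<tau>) * x = ennreal (exp \<tau>) * (x + ennreal (exp (- \<tau>)) * y)" for x y
    by (simp add: distrib_left mult_ennreal_exp_cancel add.commute)
  show "Kf (prod.swap ` G) \<tau> \<le> ennreal (exp \<tau>) * Kf G (- \<tau>)"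
    unfolding le_mult_exp_iff
  proof (rule Kf_ge)
    fix x y assume "(x, y) \<in> G"
    then show "ennreal (exp (- \<tau>)) * Kf (prod.swap ` G) \<tau> \<le> x + ennreal (exp (- \<tau>)) * y"
      unfolding le_mult_exp_iff[symmetric] *[symmetric] by (intro Kf_le) force
  qed
  show "ennreal (exp \<tau>) * Kf G (- \<tau>) \<le> Kf (prod.swap ` G) \<tau>"
    by (rule Kf_ge) (auto simp: * intro!: mult_left_mono Kf_le)
qed

lemma inorm_swap:
  assumes "0 < q"
  shows "inorm (prod.swap ` G) (1 - \<theta>) q = inorm G \<theta> q"
proof -
  have "inorm (prod.swap ` G) (1 - \<theta>) q =
    enorm lborel q (\<lambda>\<tau>. ennreal (exp (- \<theta> * (0 + (-1) * \<tau>))) * Kf G (0 + (-1) * \<tau>))"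
    unfolding inorm_def Kf_swap ennreal_exp_mult by (simp add: algebra_simps)
  also have "\<dots> = inorm G \<theta> q"
    unfolding inorm_def using assms by (subst (2) enorm_lborel_affine[where c="-1" and t=0]) auto
  finally show ?thesis .
qed

text \<open>An integral of a power of \<open>L\<close> as the weighted area of the region below \<open>L\<close>, in coordinates that
  can be shared by different powers: for fixed \<open>x\<close> the variable \<open>y\<close> is replaced by \<open>s = b0 x - b1 y\<close>, which
  turns the density into \<open>exp (c b0 x - c \<eta> s)\<close>; then the \<open>x\<close>-integral is a layer-cake integral.\<close>

lemma region_integral:
  assumes [measurable]: "L \<in> borel_measurable borel" and pos: "0 < b0" "0 < b1" "0 < c"
    and a: "\<alpha> = c * (1 - \<eta>) * b0" "\<beta> = c * \<eta> * b1"
  shows "(\<integral>\<^sup>+x. \<integral>\<^sup>+y. ennreal (exp (\<alpha> * x + \<beta> * y)) *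
            (if ennreal (exp (b0 * x)) \<le> L (b0 * x - b1 * y) then 1 else 0) \<partial>lborel \<partial>lborel)
    = ennreal (1 / (c * b0 * b1)) * (\<integral>\<^sup>+s. (ennreal (exp (- \<eta> * s)) * L s) epowr c \<partial>lborel)"
proof -
  have "(\<integral>\<^sup>+x. \<integral>\<^sup>+y. ennreal (exp (\<alpha> * x + \<beta> * y)) *
            (if ennreal (exp (b0 * x)) \<le> L (b0 * x - b1 * y) then 1 else 0) \<partial>lborel \<partial>lborel)
    = (\<integral>\<^sup>+x. ennreal (1 / b1) * (\<integral>\<^sup>+s. ennreal (exp (c * b0 * x - c * \<eta> * s)) *
            (if ennreal (exp (b0 * x)) \<le> L s then 1 else 0) \<partial>lborel) \<partial>lborel)"
  proof (rule nn_integral_cong)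
    fix x
    have e: "\<alpha> * x + \<beta> * (b0 * x / b1 + - 1 / b1 * s) = c * b0 * x - c * \<eta> * s" 
      "b0 * x - b1 * (b0 * x / b1 + - 1 / b1 * s) = s" for s
      using pos by (simp_all add: a field_simps)
    show "(\<integral>\<^sup>+y. ennreal (exp (\<alpha> * x + \<beta> * y)) *
            (if ennreal (exp (b0 * x)) \<le> L (b0 * x - b1 * y) then 1 else 0) \<partial>lborel)
     = ennreal (1 / b1) * (\<integral>\<^sup>+s. ennreal (exp (c * b0 * x - c * \<eta> * s)) *
            (if ennreal (exp (b0 * x)) \<le> L s then 1 else 0) \<partial>lborel)"
      by (subst nn_integral_real_affine[where c="- 1 / b1" and t="b0 * x / b1"])
        (use pos in \<open>simp_all only: e, auto\<close>)
  qed
  also have "\<dots> = ennreal (1 / b1) * (\<integral>\<^sup>+x. \<integral>\<^sup>+s. ennreal (exp (c * b0 * x - c * \<eta> * s)) *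
            (if ennreal (exp (b0 * x)) \<le> L s then 1 else 0) \<partial>lborel \<partial>lborel)"
    by (rule nn_integral_cmult) measurable
  also have "(\<integral>\<^sup>+x. \<integral>\<^sup>+s. ennreal (exp (c * b0 * x - c * \<eta> * s)) *
            (if ennreal (exp (b0 * x)) \<le> L s then 1 else 0) \<partial>lborel \<partial>lborel)
    = (\<integral>\<^sup>+s. \<integral>\<^sup>+x. ennreal (exp (c * b0 * x - c * \<eta> * s)) *
            (if ennreal (exp (b0 * x)) \<le> L s then 1 else 0) \<partial>lborel \<partial>lborel)"
    by (rule lborel_pair.Fubini') measurable
  also have "\<dots> = (\<integral>\<^sup>+s. ennreal (1 / (c * b0)) * (ennreal (exp (- \<eta> * s)) * L s) epowr c \<partial>lborel)"
  proof (rule nn_integral_cong)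
    fix s
    have k: "ennreal (1 / (c * b0)) = ennreal (1 / b0) * ennreal (1 / c)"
      using pos by (simp flip: ennreal_mult)
    have k2: "c * (- \<eta> * s) = - c * \<eta> * s" by simp
    have "(\<integral>\<^sup>+x. ennreal (exp (c * b0 * x - c * \<eta> * s)) * (if ennreal (exp (b0 * x)) \<le> L s then 1 else 0) \<partial>lborel)
      = ennreal (1 / b0) * (\<integral>\<^sup>+x. ennreal (exp (c * x - c * \<eta> * s)) * (if ennreal (exp x) \<le> L s then 1 else 0) \<partial>lborel)"
      by (subst nn_integral_real_affine[where c="1 / b0" and t=0]) (use pos in \<open>simp_all\<close>)
    also have "(\<integral>\<^sup>+x. ennreal (exp (c * x - c * \<eta> * s)) * (if ennreal (exp x) \<le> L s then 1 else 0) \<partial>lborel)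
      = (\<integral>\<^sup>+x. ennreal (exp (- c * \<eta> * s)) * (ennreal (exp (c * x)) * indicator {x. ennreal (exp x) \<le> L s} x) \<partial>lborel)"
      by (intro nn_integral_cong) (auto simp: ennreal_exp_mult add.commute split: split_indicator)
    also have "\<dots> = ennreal (exp (- c * \<eta> * s)) * (ennreal (1 / c) * L s epowr c)"
      unfolding nn_integral_exp_sublevel[OF pos(3), symmetric] by (rule nn_integral_cmult) measurable
    also have "ennreal (1 / b0) * (ennreal (exp (- c * \<eta> * s)) * (ennreal (1 / c) * L s epowr c))
      = (ennreal (1 / b0) * ennreal (1 / c)) * (ennreal (exp (- c * \<eta> * s)) * L s epowr c)"
      by (simp only: ac_simps)
    finally show "(\<integral>\<^sup>+x. ennreal (exp (c * b0 * x - c * \<eta> * s)) * (if ennreal (exp (b0 * x)) \<le> L s then 1 else 0) \<partial>lborel)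
      = ennreal (1 / (c * b0)) * (ennreal (exp (- \<eta> * s)) * L s) epowr c"
      using pos by (simp only: epowr_mult epowr_exp k k2)
  qed
  also have "\<dots> = ennreal (1 / (c * b0)) * (\<integral>\<^sup>+s. (ennreal (exp (- \<eta> * s)) * L s) epowr c \<partial>lborel)"
    by (rule nn_integral_cmult) measurable
  finally show ?thesis
    using pos by (subst (asm) mult.assoc[symmetric]) (simp add: mult.commute[of b1] flip: ennreal_mult)
qed

section \<open>The power theorem\<close>

text \<open>Passing from \<open>G\<close> to \<open>pw c0 c1 G\<close> replaces the K-functional by the infimum of
  \<open>x\<^sup>c\<^sup>0 + exp \<tau> \<cdot> y\<^sup>c\<^sup>1\<close>.\<close>

definition pw :: "real \<Rightarrow> real \<Rightarrow> (ennreal \<times> ennreal) set \<Rightarrow> (ennreal \<times> ennreal) set" where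
  "pw c0 c1 G = (\<lambda>(x, y). (x epowr c0, y epowr c1)) ` G"

text \<open>Whatever the powers are, comparing \<open>Kf (pw c0 c1 G)\<close> at \<open>c0 x - c1 y\<close> with \<open>exp (c0 x)\<close> decides, up to
  the factor 2, one and the same question: is there a pair in \<open>G\<close> below \<open>(exp x, exp y)\<close>? This lemma and
  the next one are the two directions.\<close>

lemma Kf_pw_lessD:
  assumes "Kf (pw c0 c1 G) (c0 * x - c1 * y) < ennreal (exp (c0 * x))" "0 < c0" "0 < c1"
  obtains u v where "(u, v) \<in> G" "u \<le> ennreal (exp x)" "v \<le> ennreal (exp y)"
proof -
  obtain u v where uv: "(u, v) \<in> G" 
    and l: "u epowr c0 + ennreal (exp (c0 * x - c1 * y)) * v epowr c1 < ennreal (exp (c0 * x))"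
    using Kf_less[OF assms(1)] by (auto simp: pw_def)
  have "u epowr c0 \<le> ennreal (exp x) epowr c0"
    using l by (simp add: epowr_exp) (meson add_increasing2 leD nle_le zero_le order_trans)
  moreover have "ennreal (exp (c0 * x - c1 * y)) * v epowr c1 \<le> ennreal (exp (c0 * x))"
    using l by (meson add_increasing leD nle_le zero_le order_trans)
  then have "v epowr c1 \<le> ennreal (exp y) epowr c1"
    using le_mult_exp_iff[of "v epowr c1" "- (c0 * x - c1 * y)" "ennreal (exp (c0 * x))"]
    by (simp add: epowr_exp ennreal_exp_mult)
  ultimately show ?thesis using that uv assms by (simp add: epowr_le_iff)
qed

lemma Kf_pw_le_twice:
  assumes "(u, v) \<in> G" "u \<le> ennreal (exp x)" "v \<le> ennreal (exp y)" "0 < c0" "0 < c1"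
  shows "Kf (pw c0 c1 G) (c0 * x - c1 * y) \<le> ennreal (2 * exp (c0 * x))"
proof -
  have "Kf (pw c0 c1 G) (c0 * x - c1 * y) \<le> u epowr c0 + ennreal (exp (c0 * x - c1 * y)) * v epowr c1"
    by (rule Kf_le) (use assms in \<open>force simp: pw_def\<close>)
  also have "\<dots> \<le> ennreal (exp x) epowr c0 + ennreal (exp (c0 * x - c1 * y)) * ennreal (exp y) epowr c1"
    using assms by (intro add_mono mult_left_mono epowr_mono) auto
  also have "\<dots> = ennreal (2 * exp (c0 * x))"
    by (simp add: epowr_exp ennreal_exp_mult flip: ennreal_plus)
  finally show ?thesis .
qed

text \<open>The factor 3 leaves room for the factor 2 lost in the preceding lemma and turns the weak
  inequality that describes the region into the strict one that excludes a pair.\<close>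

lemma third_le_imp_twice_less:
  "ennreal (exp x) \<le> ennreal (1 / 3) * K \<Longrightarrow> ennreal (2 * exp x) < K"
  using exp_gt_zero[of x]
  by (cases K) (auto simp: ennreal_less_iff simp flip: ennreal_mult simp del: exp_gt_zero)

text \<open>The power theorem. By \<open>Kf_pw_lessD\<close> and \<open>Kf_pw_le_twice\<close> the region where \<open>exp (c0 x)\<close> is below a third of one
  functional lies in the region where \<open>exp (d0 x)\<close> is below the other, and the conditions on the exponents
  say that both integrals use the same density \<open>exp (\<alpha> x + \<beta> y)\<close>.\<close>

lemma power_comparison:
  assumes pos: "0 < c0" "0 < c1" "0 < d0" "0 < d1" "0 < r" "0 < s"
    and e0: "r * (1 - \<eta>) * c0 = s * (1 - \<zeta>) * d0" and e1: "r * \<eta> * c1 = s * \<zeta> * d1"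
  shows "(\<integral>\<^sup>+t. (ennreal (exp (- \<eta> * t)) * Kf (pw c0 c1 G) t) epowr r \<partial>lborel)
    \<le> ennreal (3 powr r * (r * c0 * c1) / (s * d0 * d1)) *
       (\<integral>\<^sup>+t. (ennreal (exp (- \<zeta> * t)) * Kf (pw d0 d1 G) t) epowr s \<partial>lborel)"
    (is "?I \<le> _ * ?J")
proof -
  define \<alpha> \<beta> where "\<alpha> = r * (1 - \<eta>) * c0" "\<beta> = r * \<eta> * c1"
  have "(\<integral>\<^sup>+x. \<integral>\<^sup>+y. ennreal (exp (\<alpha> * x + \<beta> * y)) *
      (if ennreal (exp (c0 * x)) \<le> ennreal (1 / 3) * Kf (pw c0 c1 G) (c0 * x - c1 * y) then 1 else 0) \<partial>lborel \<partial>lborel)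
    \<le> (\<integral>\<^sup>+x. \<integral>\<^sup>+y. ennreal (exp (\<alpha> * x + \<beta> * y)) *
      (if ennreal (exp (d0 * x)) \<le> Kf (pw d0 d1 G) (d0 * x - d1 * y) then 1 else 0) \<partial>lborel \<partial>lborel)"
  proof (intro nn_integral_mono mult_left_mono)
    fix x y
    have "ennreal (exp (d0 * x)) \<le> Kf (pw d0 d1 G) (d0 * x - d1 * y)"
      if "ennreal (exp (c0 * x)) \<le> ennreal (1 / 3) * Kf (pw c0 c1 G) (c0 * x - c1 * y)"
    proof (rule ccontr)
      assume "\<not> ?thesis"
      then obtain u v where "(u, v) \<in> G" "u \<le> ennreal (exp x)" "v \<le> ennreal (exp y)"
        using Kf_pw_lessD[of d0 d1 G x y] pos by (auto simp: not_le)
      then have "Kf (pw c0 c1 G) (c0 * x - c1 * y) \<le> ennreal (2 * exp (c0 * x))"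
        using pos by (intro Kf_pw_le_twice)
      with third_le_imp_twice_less[OF that] show False by simp
    qed
    then show "(if ennreal (exp (c0 * x)) \<le> ennreal (1 / 3) * Kf (pw c0 c1 G) (c0 * x - c1 * y) then 1 else 0)
      \<le> (if ennreal (exp (d0 * x)) \<le> Kf (pw d0 d1 G) (d0 * x - d1 * y) then 1 else (0::ennreal))"
      by auto
  qed simp
  also have "\<dots> = ennreal (1 / (s * d0 * d1)) * ?J"
    by (rule region_integral) (use pos e0 e1 in \<open>simp_all add: \<alpha>_\<beta>_def\<close>)
  also have "(\<integral>\<^sup>+x. \<integral>\<^sup>+y. ennreal (exp (\<alpha> * x + \<beta> * y)) *
      (if ennreal (exp (c0 * x)) \<le> ennreal (1 / 3) * Kf (pw c0 c1 G) (c0 * x - c1 * y) then 1 else 0) \<partial>lborel \<partial>lborel)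
    = ennreal (1 / (r * c0 * c1)) * (\<integral>\<^sup>+t. (ennreal (exp (- \<eta> * t)) * (ennreal (1 / 3) * Kf (pw c0 c1 G) t)) epowr r \<partial>lborel)"
    by (rule region_integral) (use pos in \<open>simp_all add: \<alpha>_\<beta>_def\<close>)
  also have "(\<integral>\<^sup>+t. (ennreal (exp (- \<eta> * t)) * (ennreal (1 / 3) * Kf (pw c0 c1 G) t)) epowr r \<partial>lborel)
    = (\<integral>\<^sup>+t. ennreal (1 / 3) epowr r * (ennreal (exp (- \<eta> * t)) * Kf (pw c0 c1 G) t) epowr r \<partial>lborel)"
    using pos by (simp only: epowr_mult ac_simps)
  also have "\<dots> = ennreal (1 / 3) epowr r * ?I"
    by (rule nn_integral_cmult) measurable
  also have "\<dots> = ennreal ((1 / 3) powr r) * ?I" by (simp add: epowr_ennreal)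
  finally have *: "ennreal (1 / (r * c0 * c1)) * (ennreal ((1 / 3) powr r) * ?I) \<le> ennreal (1 / (s * d0 * d1)) * ?J" .
  have "?I \<le> ennreal (1 / (1 / 3) powr r) * (ennreal (1 / (1 / (r * c0 * c1))) * (ennreal (1 / (s * d0 * d1)) * ?J))"
    by (rule ennreal_le_divide[OF _ ennreal_le_divide[OF _ *]]) (use pos in auto)
  also have "\<dots> = ennreal (1 / (1 / 3) powr r * (1 / (1 / (r * c0 * c1)) * (1 / (s * d0 * d1)))) * ?J"
    using pos by (simp add: ennreal_mult_mult del: divide_divide_eq_right times_divide_eq_right)
  also have "1 / (1 / 3) powr r * (1 / (1 / (r * c0 * c1)) * (1 / (s * d0 * d1))) = 3 powr r * (r * c0 * c1) / (s * d0 * d1)"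
    by (simp add: powr_divide)
  finally show ?thesis .
qed

lemma pw_one [simp]: "pw 1 1 G = G"
  by (simp add: pw_def)

text \<open>The substitute for \<open>pw\<close> when the second exponent is infinite: the least power of the first
  norm under a bound on the second.\<close>

definition Ef :: "real \<Rightarrow> (ennreal \<times> ennreal) set \<Rightarrow> real \<Rightarrow> ennreal" where
  "Ef c G y = (INF p\<in>{p\<in>G. snd p \<le> ennreal (exp y)}. fst p epowr c)"

lemma Ef_antimono: "s \<le> t \<Longrightarrow> Ef c G t \<le> Ef c G s"
  unfolding Ef_def
  by (intro INF_superset_mono) (auto intro: order_trans[OF _ ennreal_leI])

lemma Ef_measurable [measurable]: "Ef c G \<in> borel_measurable borel"
  by (rule borel_measurable_antimono_ennreal) (rule Ef_antimono)

text \<open>The analogue of \<open>region_integral\<close> for a region bounded by a function of \<open>y\<close> alone, where no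
  substitution in \<open>y\<close> is needed.\<close>

lemma region_integral_horizontal:
  assumes [measurable]: "E \<in> borel_measurable borel" and b: "0 < b"
  shows "(\<integral>\<^sup>+x. \<integral>\<^sup>+y. ennreal (exp (b * x + \<beta> * y)) *
            (if ennreal (exp (b * x)) \<le> E y then 1 else 0) \<partial>lborel \<partial>lborel)
    = ennreal (1 / b) * (\<integral>\<^sup>+y. ennreal (exp (\<beta> * y)) * E y \<partial>lborel)"
proof -
  have "(\<integral>\<^sup>+x. \<integral>\<^sup>+y. ennreal (exp (b * x + \<beta> * y)) *
            (if ennreal (exp (b * x)) \<le> E y then 1 else 0) \<partial>lborel \<partial>lborel)
    = (\<integral>\<^sup>+y. \<integral>\<^sup>+x. ennreal (exp (b * x + \<beta> * y)) *
            (if ennreal (exp (b * x)) \<le> E y then 1 else 0) \<partial>lborel \<partial>lborel)"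
    by (rule lborel_pair.Fubini') measurable
  also have "\<dots> = (\<integral>\<^sup>+y. ennreal (1 / b) * (ennreal (exp (\<beta> * y)) * E y) \<partial>lborel)"
  proof (rule nn_integral_cong)
    fix y
    have "(\<integral>\<^sup>+x. ennreal (exp (b * x + \<beta> * y)) * (if ennreal (exp (b * x)) \<le> E y then 1 else 0) \<partial>lborel)
      = ennreal (1 / b) * (\<integral>\<^sup>+x. ennreal (exp (x + \<beta> * y)) * (if ennreal (exp x) \<le> E y then 1 else 0) \<partial>lborel)"
      by (subst nn_integral_real_affine[where c="1 / b" and t=0]) (use b in \<open>simp_all\<close>)
    also have "(\<integral>\<^sup>+x. ennreal (exp (x + \<beta> * y)) * (if ennreal (exp x) \<le> E y then 1 else 0) \<partial>lborel)
      = (\<integral>\<^sup>+x. ennreal (exp (\<beta> * y)) * (ennreal (exp (1 * x)) * indicator {x. ennreal (exp x) \<le> E y} x) \<partial>lborel)"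
      by (intro nn_integral_cong) (auto simp: ennreal_exp_mult add.commute split: split_indicator)
    also have "\<dots> = ennreal (exp (\<beta> * y)) * (ennreal (1 / 1) * E y epowr 1)"
      by (subst nn_integral_exp_sublevel[symmetric], simp, rule nn_integral_cmult) measurable
    finally show "(\<integral>\<^sup>+x. ennreal (exp (b * x + \<beta> * y)) * (if ennreal (exp (b * x)) \<le> E y then 1 else 0) \<partial>lborel)
      = ennreal (1 / b) * (ennreal (exp (\<beta> * y)) * E y)"
      by simp
  qed
  also have "\<dots> = ennreal (1 / b) * (\<integral>\<^sup>+y. ennreal (exp (\<beta> * y)) * E y \<partial>lborel)"
    by (rule nn_integral_cmult) measurable
  finally show ?thesis .
qed

lemma Ef_lessD:
  assumes "Ef c G y < ennreal (exp (c * x))" "0 < c"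
  obtains u v where "(u, v) \<in> G" "u \<le> ennreal (exp x)" "v \<le> ennreal (exp y)"
proof -
  obtain u v where uv: "(u, v) \<in> G" "v \<le> ennreal (exp y)" "u epowr c < ennreal (exp x) epowr c"
    using assms(1) by (auto simp: Ef_def INF_less_iff epowr_exp)
  then show ?thesis using that assms by (auto simp: epowr_le_iff dest: less_imp_le)
qed

lemma Ef_le:
  assumes "(u, v) \<in> G" "u \<le> ennreal (exp x)" "v \<le> ennreal (exp y)" "0 < c"
  shows "Ef c G y \<le> ennreal (exp (c * x))"
proof -
  have "Ef c G y \<le> u epowr c"
    unfolding Ef_def by (rule INF_lower2[of "(u, v)"]) (use assms in auto)
  also have "\<dots> \<le> ennreal (exp x) epowr c" using assms by (intro epowr_mono)
  finally show ?thesis by (simp add: epowr_exp)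
qed

text \<open>The power theorem for \<open>q\<^sub>1 = \<infinity>\<close>. The relation \<open>1/r = (1-\<theta>)/c\<close> makes the density \<open>exp (c x + \<theta> r y)\<close> of
  the K-functional equal to the one that computes \<open>Ef\<close>.\<close>

lemma power_comparison_sup:
  fixes \<theta> r :: real
  assumes "0 < \<theta>" "\<theta> < 1" "0 < r"
  defines "c \<equiv> (1 - \<theta>) * r"
  shows "(\<integral>\<^sup>+t. (ennreal (exp (- \<theta> * t)) * Kf G t) epowr r \<partial>lborel)
      \<le> ennreal (3 powr r * r / c) * (\<integral>\<^sup>+y. ennreal (exp (\<theta> * r * y)) * Ef c G y \<partial>lborel)" (is "?I \<le> _ * ?J")
    and "(\<integral>\<^sup>+y. ennreal (exp (\<theta> * r * y)) * Ef c G y \<partial>lborel)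
      \<le> ennreal (3 * c / r) * (\<integral>\<^sup>+t. (ennreal (exp (- \<theta> * t)) * Kf G t) epowr r \<partial>lborel)"
proof -
  have c: "0 < c" using assms by (simp add: c_def)
  have E: "(\<integral>\<^sup>+x. \<integral>\<^sup>+y. ennreal (exp (c * x + \<theta> * r * y)) *
            (if ennreal (exp (c * x)) \<le> ennreal k * Ef c G y then 1 else 0) \<partial>lborel \<partial>lborel)
      = ennreal (1 / c) * (ennreal k * ?J)" for k
  proof -
    have "(\<integral>\<^sup>+x. \<integral>\<^sup>+y. ennreal (exp (c * x + \<theta> * r * y)) *
            (if ennreal (exp (c * x)) \<le> ennreal k * Ef c G y then 1 else 0) \<partial>lborel \<partial>lborel)
        = ennreal (1 / c) * (\<integral>\<^sup>+y. ennreal (exp (\<theta> * r * y)) * (ennreal k * Ef c G y) \<partial>lborel)"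
      by (rule region_integral_horizontal) (use c in auto)
    also have "(\<integral>\<^sup>+y. ennreal (exp (\<theta> * r * y)) * (ennreal k * Ef c G y) \<partial>lborel)
        = (\<integral>\<^sup>+y. ennreal k * (ennreal (exp (\<theta> * r * y)) * Ef c G y) \<partial>lborel)"
      by (simp only: ac_simps)
    also have "\<dots> = ennreal k * ?J" by (rule nn_integral_cmult) measurable
    finally show ?thesis .
  qed
  have K: "(\<integral>\<^sup>+x. \<integral>\<^sup>+y. ennreal (exp (c * x + \<theta> * r * y)) *
            (if ennreal (exp x) \<le> ennreal k * Kf G (x - y) then 1 else 0) \<partial>lborel \<partial>lborel)
      = ennreal (1 / r) * (ennreal (k powr r) * ?I)" if "0 \<le> k" for k
  proof -
    have "(\<integral>\<^sup>+x. \<integral>\<^sup>+y. ennreal (exp (c * x + \<theta> * r * y)) *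
            (if ennreal (exp (1 * x)) \<le> ennreal k * Kf G (1 * x - 1 * y) then 1 else 0) \<partial>lborel \<partial>lborel)
        = ennreal (1 / (r * 1 * 1)) * (\<integral>\<^sup>+t. (ennreal (exp (- \<theta> * t)) * (ennreal k * Kf G t)) epowr r \<partial>lborel)"
      by (rule region_integral) (use assms in auto)
    also have "(\<integral>\<^sup>+t. (ennreal (exp (- \<theta> * t)) * (ennreal k * Kf G t)) epowr r \<partial>lborel)
        = (\<integral>\<^sup>+t. ennreal k epowr r * (ennreal (exp (- \<theta> * t)) * Kf G t) epowr r \<partial>lborel)"
      using assms by (simp only: epowr_mult ac_simps)
    also have "\<dots> = ennreal k epowr r * ?I" by (rule nn_integral_cmult) measurable
    finally show ?thesis using that by (simp add: epowr_ennreal)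
  qed
  have k3: "0 \<le> (1 / 3 :: real)" and k1: "0 \<le> (1 :: real)" by simp_all
  have "ennreal (exp (c * x)) \<le> ennreal 1 * Ef c G y" if "ennreal (exp x) \<le> ennreal (1 / 3) * Kf G (x - y)" for x y
  proof (rule ccontr)
    assume "\<not> ?thesis"
    then obtain u v where "(u, v) \<in> G" "u \<le> ennreal (exp x)" "v \<le> ennreal (exp y)"
      using Ef_lessD[of c G y x] c by (auto simp: not_le)
    then have "Kf (pw 1 1 G) (1 * x - 1 * y) \<le> ennreal (2 * exp (1 * x))"
      by (rule Kf_pw_le_twice) auto
    with third_le_imp_twice_less[OF that] show False by simp
  qed
  then have *: "ennreal (1 / r) * (ennreal ((1 / 3) powr r) * ?I) \<le> ennreal (1 / c) * (ennreal 1 * ?J)"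
    unfolding K[OF k3, symmetric] E[symmetric]
    by (intro nn_integral_mono mult_left_mono) auto
  have "?I \<le> ennreal (1 / (1 / 3) powr r) * (ennreal (1 / (1 / r)) * (ennreal (1 / c) * (ennreal 1 * ?J)))"
    by (rule ennreal_le_divide[OF _ ennreal_le_divide[OF _ *]]) (use assms in auto)
  then show "?I \<le> ennreal (3 powr r * r / c) * ?J"
    using c assms by (simp add: ennreal_mult_mult powr_divide)
  have "ennreal (exp x) \<le> ennreal 1 * Kf G (x - y)" if "ennreal (exp (c * x)) \<le> ennreal (1 / 3) * Ef c G y" for x y
  proof (rule ccontr)
    assume "\<not> ?thesis"
    then obtain u v where "(u, v) \<in> G" "u \<le> ennreal (exp x)" "v \<le> ennreal (exp y)"
      using Kf_pw_lessD[of 1 1 G x y] by (auto simp: not_le)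
    then have "Ef c G y \<le> ennreal (exp (c * x))"
      using c by (rule Ef_le)
    also have "\<dots> \<le> ennreal (2 * exp (c * x))" by (simp add: ennreal_leI)
    finally show False using third_le_imp_twice_less[OF that] by simp
  qed
  then have *: "ennreal (1 / c) * (ennreal (1 / 3) * ?J) \<le> ennreal (1 / r) * (ennreal (1 powr r) * ?I)"
    unfolding K[OF k1, symmetric] E[symmetric]
    by (intro nn_integral_mono mult_left_mono) auto
  have "?J \<le> ennreal (1 / (1 / 3)) * (ennreal (1 / (1 / c)) * (ennreal (1 / r) * (ennreal (1 powr r) * ?I)))"
    by (rule ennreal_le_divide[OF _ ennreal_le_divide[OF _ *]]) (use c in auto)
  then show "?J \<le> ennreal (3 * c / r) * ?I"
    using c assms by (simp add: ennreal_mult_mult right_diff_distrib del: ennreal_numeral)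
qed

section \<open>Sums of couples\<close>

lemma nn_integral_count_space_le_UNIV: "(\<integral>\<^sup>+k. f k \<partial>count_space I) \<le> (\<integral>\<^sup>+k. f k \<partial>count_space UNIV)"
  by (auto simp: nn_integral_count_space_indicator intro!: nn_integral_mono split: split_indicator)

text \<open>A sum of independent terms is minimised termwise: near-minimisers with errors \<open>e \<cdot> 2\<^sup>-\<^sup>n\<close> add up
  to a total error of at most \<open>e\<close>.\<close>

lemma INF_nn_integral_count_space:
  fixes F :: "'i \<Rightarrow> 'b \<Rightarrow> ennreal"
  assumes I: "countable I"
  shows "(INF g\<in>{g. \<forall>k\<in>I. g k \<in> A k}. \<integral>\<^sup>+k. F k (g k) \<partial>count_space I)
    = (\<integral>\<^sup>+k. (INF a\<in>A k. F k a) \<partial>count_space I)" (is "?L = ?R")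
proof (rule antisym)
  show "?R \<le> ?L"
    by (intro INF_greatest nn_integral_mono) (auto intro!: INF_lower)
  show "?L \<le> ?R"
  proof (rule ennreal_le_epsilon)
    fix e :: real assume "?R < top" "0 < e"
    define w where "w k = e * (1 / 2) ^ Suc (to_nat_on I k)" for k
    have w: "0 < w k" for k using \<open>0 < e\<close> by (simp add: w_def)
    have "\<exists>a\<in>A k. F k a < (INF a\<in>A k. F k a) + ennreal (w k)" if k: "k \<in> I" for k
    proof -
      have "(INF a\<in>A k. F k a) \<le> ?R" using k by (rule nn_integral_ge_point)
      then have "(INF a\<in>A k. F k a) < top" using \<open>?R < top\<close> by (rule le_less_trans)
      then have "(INF a\<in>A k. F k a) \<noteq> \<infinity>" unfolding infinity_ennreal_def by (rule less_imp_neq)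
      from INF_approx_ennreal[OF w refl this] show ?thesis .
    qed
    then obtain g where g: "\<forall>k\<in>I. g k \<in> A k \<and> F k (g k) < (INF a\<in>A k. F k a) + ennreal (w k)"
      by metis
    have "(\<integral>\<^sup>+k. ennreal (w k) \<partial>count_space I) =
      ennreal e * (\<integral>\<^sup>+k. (\<lambda>n. ennreal ((1 / 2) ^ Suc n)) (to_nat_on I k) \<partial>count_space I)"
      using \<open>0 < e\<close> by (subst nn_integral_cmult[symmetric]) (auto simp: w_def ennreal_mult simp del: power_Suc)
    also have "(\<integral>\<^sup>+k. (\<lambda>n. ennreal ((1 / 2) ^ Suc n)) (to_nat_on I k) \<partial>count_space I)
      = (\<integral>\<^sup>+n. ennreal ((1 / 2) ^ Suc n) \<partial>count_space (to_nat_on I ` I))"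
      using nn_integral_count_compose_inj[OF inj_on_to_nat_on[OF I], of "\<lambda>n. ennreal ((1 / 2) ^ Suc n)"]
      by (simp add: nn_integral_count_space_indicator del: power_Suc)
    also have "\<dots> \<le> (\<integral>\<^sup>+n. ennreal ((1 / 2) ^ Suc n) \<partial>count_space UNIV)"
      by (rule nn_integral_count_space_le_UNIV)
    also have "\<dots> = ennreal 1"
      by (subst nn_integral_count_space_nat, rule suminf_ennreal_eq) (use power_half_series in auto)
    finally have W: "(\<integral>\<^sup>+k. ennreal (w k) \<partial>count_space I) \<le> ennreal e"
      by (simp add: mult_left_mono)
    have "?L \<le> (\<integral>\<^sup>+k. F k (g k) \<partial>count_space I)"
      by (rule INF_lower) (use g in auto)
    also have "\<dots> \<le> (\<integral>\<^sup>+k. (INF a\<in>A k. F k a) + ennreal (w k) \<partial>count_space I)"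
      by (intro nn_integral_mono) (use g in \<open>auto intro: less_imp_le\<close>)
    also have "\<dots> = ?R + (\<integral>\<^sup>+k. ennreal (w k) \<partial>count_space I)"
      by (rule nn_integral_add) auto
    also have "\<dots> \<le> ?R + ennreal e" using W by (intro add_left_mono)
    finally show "?L \<le> ?R + ennreal e" .
  qed
qed

text \<open>The pairs of norms in an \<open>\<ell>\<^sup>q\<^sup>0\<close> sum and an \<open>\<ell>\<^sup>q\<^sup>1\<close> sum of spaces: the entries are decomposed
  independently of each other.\<close>

definition lq_couple ::
  "'i set \<Rightarrow> ennreal \<Rightarrow> ennreal \<Rightarrow> ('i \<Rightarrow> (ennreal \<times> ennreal) set) \<Rightarrow> (ennreal \<times> ennreal) set" where
  "lq_couple I q0 q1 G =
     (\<lambda>g. (enorm (count_space I) q0 (\<lambda>k. fst (g k)), enorm (count_space I) q1 (\<lambda>k. snd (g k))))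
       ` {g. \<forall>k\<in>I. g k \<in> G k}"

lemma Kf_pw_lq_couple:
  assumes "countable I" "0 < c0" "0 < c1"
  shows "Kf (pw c0 c1 (lq_couple I (ennreal c0) (ennreal c1) G)) s = (\<integral>\<^sup>+k. Kf (pw c0 c1 (G k)) s \<partial>count_space I)"
proof -
  have "Kf (pw c0 c1 (lq_couple I (ennreal c0) (ennreal c1) G)) s =
    (INF g\<in>{g. \<forall>k\<in>I. g k \<in> G k}. (\<integral>\<^sup>+k. fst (g k) epowr c0 \<partial>count_space I) +
      ennreal (exp s) * (\<integral>\<^sup>+k. snd (g k) epowr c1 \<partial>count_space I))"
    unfolding Kf_def pw_def lq_couple_def image_image using assms by (simp add: enorm_powr)
  also have "\<dots> = (INF g\<in>{g. \<forall>k\<in>I. g k \<in> G k}.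
     \<integral>\<^sup>+k. fst (g k) epowr c0 + ennreal (exp s) * snd (g k) epowr c1 \<partial>count_space I)"
    by (simp add: nn_integral_add nn_integral_cmult)
  also have "\<dots> = (\<integral>\<^sup>+k. (INF p\<in>G k. fst p epowr c0 + ennreal (exp s) * snd p epowr c1) \<partial>count_space I)"
    by (rule INF_nn_integral_count_space[OF assms(1), where A=G and F="\<lambda>k p. fst p epowr c0 + ennreal (exp s) * snd p epowr c1"])
  also have "\<dots> = (\<integral>\<^sup>+k. Kf (pw c0 c1 (G k)) s \<partial>count_space I)"
    unfolding Kf_def pw_def image_image by (simp add: case_prod_beta)
  finally show ?thesis .
qed

lemma Ef_lq_couple:
  assumes "countable I" "0 < c"
  shows "Ef c (lq_couple I (ennreal c) top G) y = (\<integral>\<^sup>+k. Ef c (G k) y \<partial>count_space I)"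
proof -
  define P where "P = {g. \<forall>k\<in>I. g k \<in> {p\<in>G k. snd p \<le> ennreal (exp y)}}"
  have "{p \<in> lq_couple I (ennreal c) top G. snd p \<le> ennreal (exp y)} =
    (\<lambda>g. (enorm (count_space I) (ennreal c) (\<lambda>k. fst (g k)), enorm (count_space I) top (\<lambda>k. snd (g k)))) ` P"
    unfolding lq_couple_def P_def by (auto simp: enorm_def SUP_le_iff)
  then have "Ef c (lq_couple I (ennreal c) top G) y = (INF g\<in>P. \<integral>\<^sup>+k. fst (g k) epowr c \<partial>count_space I)"
    unfolding Ef_def using assms by (simp add: image_image enorm_powr)
  also have "\<dots> = (\<integral>\<^sup>+k. Ef c (G k) y \<partial>count_space I)"
    unfolding P_def Ef_def by (rule INF_nn_integral_count_space[OF assms(1)])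
  finally show ?thesis .
qed

lemma lq_couple_swap: "lq_couple I q1 q0 (\<lambda>k. prod.swap ` G k) = prod.swap ` lq_couple I q0 q1 G"
proof -
  have "{g. \<forall>k\<in>I. g k \<in> prod.swap ` G k} = (\<lambda>g k. prod.swap (g k)) ` {g. \<forall>k\<in>I. g k \<in> G k}"
  proof safe
    fix g assume g: "\<forall>k\<in>I. g k \<in> prod.swap ` G k"
    show "g \<in> (\<lambda>g k. prod.swap (g k)) ` {g. \<forall>k\<in>I. g k \<in> G k}"
      by (rule image_eqI[of _ _ "\<lambda>k. prod.swap (g k)"]) (use g in auto)
  qed auto
  then show ?thesis unfolding lq_couple_def by (simp add: image_image)
qed

text \<open>Interpolation commutes with \<open>\<ell>\<^sup>q\<close> sums when \<open>1/r = (1-\<theta>)/q\<^sub>0 + \<theta>/q\<^sub>1\<close>. The power theorem replaces the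
  interpolation quasi-norm by a functional \<open>X\<close> that is exactly additive over the entries. It is used for
  the whole couple and for each entry.\<close>

theorem lq_couple_inorm:
  fixes I :: "'i set" and q0 q1 :: ennreal and \<theta> r :: real
  assumes I: "countable I" and \<theta>: "0 < \<theta>" "\<theta> < 1" and q: "0 < q0" "0 < q1" "0 < r"
    and e: "inverse (ennreal r) = ennreal (1 - \<theta>) * inverse q0 + ennreal \<theta> * inverse q1"
  shows "\<exists>C>0. \<forall>G. inorm (lq_couple I q0 q1 G) \<theta> (ennreal r)
        \<le> ennreal C * enorm (count_space I) (ennreal r) (\<lambda>k. inorm (G k) \<theta> (ennreal r)) \<and>
      enorm (count_space I) (ennreal r) (\<lambda>k. inorm (G k) \<theta> (ennreal r))
        \<le> ennreal C * inorm (lq_couple I q0 q1 G) \<theta> (ennreal r)"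
proof -
  define J where "J G = (\<integral>\<^sup>+t. (ennreal (exp (- \<theta> * t)) * Kf G t) epowr r \<partial>lborel)" for G
  have main: ?thesis
    if "0 < A" "0 < B" and JX: "\<And>G. J G \<le> ennreal A * X G" "\<And>G. X G \<le> ennreal B * J G"
      and X: "\<And>G. X (lq_couple I q0 q1 G) = (\<integral>\<^sup>+k. X (G k) \<partial>count_space I)" for A B X
  proof -
    define C where "C = (A * B) powr (1 / r)"
    have C: "0 < C" using that(1,2) by (simp add: C_def)
    have "inorm G \<theta> (ennreal r) = J G epowr (1 / r)" for G
      unfolding inorm_def J_def using q by (simp add: enorm_ennreal)
    then have N: "inorm (lq_couple I q0 q1 G) \<theta> (ennreal r) = J (lq_couple I q0 q1 G) epowr (1 / r)"
      "enorm (count_space I) (ennreal r) (\<lambda>k. inorm (G k) \<theta> (ennreal r))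
        = (\<integral>\<^sup>+k. J (G k) \<partial>count_space I) epowr (1 / r)" for G
      using q by (simp_all add: enorm_ennreal)
    have root: "x epowr (1 / r) \<le> ennreal C * y epowr (1 / r)" if "x \<le> ennreal A * (ennreal B * y)" for x y
    proof -
      have "x epowr (1 / r) \<le> (ennreal (A * B) * y) epowr (1 / r)"
        using that \<open>0 < A\<close> \<open>0 < B\<close> q by (intro epowr_mono) (simp_all add: ennreal_mult_mult)
      then show ?thesis using q \<open>0 < A\<close> \<open>0 < B\<close> by (simp add: epowr_mult C_def epowr_ennreal)
    qed
    have "J (lq_couple I q0 q1 G) \<le> ennreal A * (ennreal B * (\<integral>\<^sup>+k. J (G k) \<partial>count_space I))" for G
    proof -
      have "J (lq_couple I q0 q1 G) \<le> ennreal A * (\<integral>\<^sup>+k. X (G k) \<partial>count_space I)"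
        using JX(1)[of "lq_couple I q0 q1 G"] by (simp only: X)
      also have "\<dots> \<le> ennreal A * (\<integral>\<^sup>+k. ennreal B * J (G k) \<partial>count_space I)"
        by (intro mult_left_mono nn_integral_mono JX) auto
      finally show ?thesis by (simp add: nn_integral_cmult)
    qed
    moreover have "(\<integral>\<^sup>+k. J (G k) \<partial>count_space I) \<le> ennreal A * (ennreal B * J (lq_couple I q0 q1 G))" for G
    proof -
      have "(\<integral>\<^sup>+k. J (G k) \<partial>count_space I) \<le> (\<integral>\<^sup>+k. ennreal A * X (G k) \<partial>count_space I)"
        by (intro nn_integral_mono JX)
      also have "\<dots> = ennreal A * X (lq_couple I q0 q1 G)"
        by (simp add: nn_integral_cmult X)
      also have "\<dots> \<le> ennreal A * (ennreal B * J (lq_couple I q0 q1 G))"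
        by (intro mult_left_mono JX) auto
      finally show ?thesis .
    qed
    ultimately show ?thesis
      using C unfolding N by (intro exI[of _ C] conjI allI root)
  qed
  have count: "(\<integral>\<^sup>+t. f t * (\<integral>\<^sup>+k. g k t \<partial>count_space I) \<partial>lborel)
      = (\<integral>\<^sup>+k. \<integral>\<^sup>+t. f t * g k t \<partial>lborel \<partial>count_space I)"
    if [measurable]: "f \<in> borel_measurable lborel" "\<And>k. g k \<in> borel_measurable lborel"
    for f :: "real \<Rightarrow> ennreal" and g :: "'i \<Rightarrow> real \<Rightarrow> ennreal"
  proof -
    have "(\<integral>\<^sup>+t. f t * (\<integral>\<^sup>+k. g k t \<partial>count_space I) \<partial>lborel) = (\<integral>\<^sup>+t. \<integral>\<^sup>+k. f t * g k t \<partial>count_space I \<partial>lborel)"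
      by (simp add: nn_integral_cmult)
    also have "\<dots> = (\<integral>\<^sup>+k. \<integral>\<^sup>+t. f t * g k t \<partial>lborel \<partial>count_space I)"
      by (rule nn_integral_count_space_nn_integral[OF I]) measurable
    finally show ?thesis .
  qed
  show ?thesis
  proof (cases q0)
    case q0: (real c0)
    then have c0: "0 < c0" using q by auto
    show ?thesis
    proof (cases q1)
      case q1: (real c1)
      then have c1: "0 < c1" using q by auto
      have "ennreal (1 / r) = ennreal ((1 - \<theta>) / c0 + \<theta> / c1)"
        using e q0 q1 c0 c1 q \<theta> by (simp add: inverse_ennreal inverse_eq_divide flip: ennreal_mult ennreal_plus)
      then have e': "1 / r = (1 - \<theta>) / c0 + \<theta> / c1"
        using c0 c1 q \<theta> by (subst (asm) ennreal_inj) (auto intro!: add_nonneg_nonneg divide_nonneg_nonneg)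
      \<comment> \<open>The parameter for which the region of \<open>x\<^sup>c\<^sup>0 + exp s \<cdot> y\<^sup>c\<^sup>1\<close> has the density of \<open>K\<^sup>r\<close>.\<close>
      define \<eta> where "\<eta> = \<theta> * r / c1"
      define X where "X G = (\<integral>\<^sup>+t. ennreal (exp (- \<eta> * t)) * Kf (pw c0 c1 G) t \<partial>lborel)" for G
      have e1: "r * \<theta> * 1 = 1 * \<eta> * c1" using c1 by (simp add: \<eta>_def)
      have "1 - \<eta> = r * (1 / r - \<theta> / c1)" using q c1 by (simp add: \<eta>_def field_simps)
      then have e0: "r * (1 - \<theta>) * 1 = 1 * (1 - \<eta>) * c0" using c0 by (simp add: e')
      show ?thesis
      proof (rule main)
        show "J G \<le> ennreal (3 powr r * (r * 1 * 1) / (1 * c0 * c1)) * X G" for G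
          using power_comparison[of 1 1 c0 c1 r 1 \<theta> \<eta> G] e0 e1 c0 c1 q by (simp add: J_def X_def)
        show "X G \<le> ennreal (3 powr 1 * (1 * c0 * c1) / (r * 1 * 1)) * J G" for G
          using power_comparison[of c0 c1 1 1 1 r \<eta> \<theta> G] e0 e1 c0 c1 q by (simp add: J_def X_def)
        show "X (lq_couple I q0 q1 G) = (\<integral>\<^sup>+k. X (G k) \<partial>count_space I)" for G
          unfolding X_def q0 q1 Kf_pw_lq_couple[OF I c0 c1] by (rule count) measurable
      qed (use c0 c1 q in auto)
    next
      case q1: top
      have "ennreal (1 / r) = ennreal ((1 - \<theta>) / c0)"
        using e q0 q1 c0 q \<theta> by (simp add: inverse_ennreal inverse_eq_divide flip: ennreal_mult)
      then have "1 / r = (1 - \<theta>) / c0"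
        using c0 q \<theta> by (subst (asm) ennreal_inj) auto
      then have e': "c0 = (1 - \<theta>) * r" using c0 q by (simp add: field_simps)
      define X where "X G = (\<integral>\<^sup>+y. ennreal (exp (\<theta> * r * y)) * Ef c0 G y \<partial>lborel)" for G
      show ?thesis
      proof (rule main)
        show "J G \<le> ennreal (3 powr r * r / c0) * X G" for G
          using power_comparison_sup(1)[OF \<theta> q(3), of G] by (simp add: J_def X_def e')
        show "X G \<le> ennreal (3 * c0 / r) * J G" for G
          using power_comparison_sup(2)[OF \<theta> q(3), of G] by (simp add: J_def X_def e')
        show "X (lq_couple I q0 q1 G) = (\<integral>\<^sup>+k. X (G k) \<partial>count_space I)" for G
          unfolding X_def q0 q1 Ef_lq_couple[OF I c0] by (rule count) measurable
      qed (use c0 q in auto)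
    qed
  next
    case q0: top
    show ?thesis
    proof (cases q1)
      case q1: (real c1)
      then have c1: "0 < c1" using q by auto
      have "ennreal (1 / r) = ennreal (\<theta> / c1)"
        using e q0 q1 c1 q \<theta> by (simp add: inverse_ennreal inverse_eq_divide flip: ennreal_mult)
      then have "1 / r = \<theta> / c1"
        using c1 q \<theta> by (subst (asm) ennreal_inj) auto
      then have e': "c1 = (1 - (1 - \<theta>)) * r" using c1 q by (simp add: field_simps)
      have J: "J G = (\<integral>\<^sup>+t. (ennreal (exp (- (1 - \<theta>) * t)) * Kf (prod.swap ` G) t) epowr r \<partial>lborel)" for G
      proof -
        have "inorm (prod.swap ` G) (1 - \<theta>) (ennreal r) epowr r = inorm G \<theta> (ennreal r) epowr r"
          using q by (simp add: inorm_swap)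
        then show ?thesis
          unfolding inorm_def J_def enorm_powr[OF q(3)] by simp
      qed
      define X where "X G = (\<integral>\<^sup>+y. ennreal (exp ((1 - \<theta>) * r * y)) * Ef c1 (prod.swap ` G) y \<partial>lborel)" for G
      have \<theta>': "0 < 1 - \<theta>" "1 - \<theta> < 1" using \<theta> by auto
      show ?thesis
      proof (rule main)
        show "J G \<le> ennreal (3 powr r * r / c1) * X G" for G
          using power_comparison_sup(1)[OF \<theta>' q(3), of "prod.swap ` G"] by (simp add: J X_def e')
        show "X G \<le> ennreal (3 * c1 / r) * J G" for G
          using power_comparison_sup(2)[OF \<theta>' q(3), of "prod.swap ` G"] by (simp add: J X_def e')
        show "X (lq_couple I q0 q1 G) = (\<integral>\<^sup>+k. X (G k) \<partial>count_space I)" for G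
          unfolding X_def q0 q1 lq_couple_swap[symmetric] Ef_lq_couple[OF I c1] by (rule count) measurable
      qed (use c1 q in auto)
    next
      case top
      then show ?thesis using e q0 q by (simp add: inverse_ennreal)
    qed
  qed
qed

lemma common_exponent:
  assumes "0 < q0" "0 < q1" "0 < (q :: ennreal)"
  obtains s where "0 < s" "ennreal s \<le> q0" "ennreal s \<le> q1" "ennreal s \<le> q"
proof -
  have ex: "\<exists>s>0. ennreal s \<le> p" if "0 < p" for p
    using that by (rule exponent_cases) (auto intro: exI[of _ 1])
  obtain s0 s1 s2 where "0 < s0" "ennreal s0 \<le> q0" "0 < s1" "ennreal s1 \<le> q1" "0 < s2" "ennreal s2 \<le> q"
    using ex assms by meson
  then show ?thesis
    by (intro that[of "min s0 (min s1 s2)"])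
      (auto intro: order_trans[OF ennreal_leI, of _ s0] order_trans[OF ennreal_leI, of _ s1] order_trans[OF ennreal_leI, of _ s2])
qed

section \<open>Exponentially decaying kernels\<close>

text \<open>Jensen's inequality up to the factor \<open>2\<^sup>m\<close>. Pointwise \<open>h \<le> l + l\<^sup>1\<^sup>-\<^sup>m h\<^sup>m\<close> for each \<open>l > 0\<close>; integrating
  and choosing \<open>l\<close> so that both terms are equal gives the bound.\<close>

lemma weighted_power_mean:
  fixes w h :: "'s \<Rightarrow> ennreal" and m W :: real
  assumes [measurable]: "w \<in> borel_measurable M" "h \<in> borel_measurable M"
    and m: "1 \<le> m" and W: "0 < W" "(\<integral>\<^sup>+x. w x \<partial>M) \<le> ennreal W"
  shows "(\<integral>\<^sup>+x. w x * h x \<partial>M) epowr m \<le> ennreal (2 powr m * W powr (m - 1)) * (\<integral>\<^sup>+x. w x * h x epowr m \<partial>M)"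
proof (cases "\<integral>\<^sup>+x. w x * h x epowr m \<partial>M")
  case (real A)
  show ?thesis
  proof (cases "A = 0")
    case True
    then have "(\<integral>\<^sup>+x. w x * h x epowr m \<partial>M) = 0" using real by simp
    then have "AE x in M. w x * h x epowr m = 0" by (subst (asm) nn_integral_0_iff_AE) auto
    then have "AE x in M. w x * h x = 0" by eventually_elim auto
    then have "(\<integral>\<^sup>+x. w x * h x \<partial>M) = 0" by (subst nn_integral_0_iff_AE) auto
    then show ?thesis by simp
  next
    case False
    then have A: "0 < A" using real by simp
    define l where "l = (A / W) powr (1 / m)"
    have l: "0 < l" using A W by (simp add: l_def)
    have *: "h x \<le> ennreal l + ennreal (l powr (1 - m)) * h x epowr m" for x
    proof (cases "h x")
      case (real y)
      have "y \<le> l + l powr (1 - m) * y powr m"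
      proof (cases "y \<le> l")
        case False
        then have "1 \<le> (y / l) powr (m - 1)" using l m by (intro ge_one_powr_ge_zero) auto
        then have "y * 1 \<le> y * (y / l) powr (m - 1)" using False l by (intro mult_left_mono) auto
        also have "\<dots> = l powr (1 - m) * y powr m"
          using False l real by (simp add: powr_divide powr_diff)
        finally show ?thesis using l by simp
      qed (use l in \<open>simp add: add_increasing2\<close>)
      then show ?thesis using real l
        by (simp add: epowr_ennreal ennreal_leI flip: ennreal_mult ennreal_plus)
    qed (use l in \<open>simp add: ennreal_mult_top\<close>)
    have "(\<integral>\<^sup>+x. w x * h x \<partial>M) \<le> (\<integral>\<^sup>+x. ennreal l * w x + ennreal (l powr (1 - m)) * (w x * h x epowr m) \<partial>M)"
    proof (rule nn_integral_mono)
      fix x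
      have "w x * h x \<le> w x * (ennreal l + ennreal (l powr (1 - m)) * h x epowr m)"
        by (intro mult_left_mono *) simp
      then show "w x * h x \<le> ennreal l * w x + ennreal (l powr (1 - m)) * (w x * h x epowr m)"
        by (simp add: distrib_left ac_simps)
    qed
    also have "\<dots> = ennreal l * (\<integral>\<^sup>+x. w x \<partial>M) + ennreal (l powr (1 - m)) * ennreal A"
      unfolding real(2)[symmetric] by (simp add: nn_integral_add nn_integral_cmult)
    also have "\<dots> \<le> ennreal l * ennreal W + ennreal (l powr (1 - m)) * ennreal A"
      using W by (intro add_right_mono mult_left_mono) auto
    also have "\<dots> = ennreal (l * W + l powr (1 - m) * A)"
      using l W A by (simp add: ennreal_mult)
    also have "l powr (1 - m) * A = l * W"
    proof -
      have "l powr (1 - m) = l * inverse (l powr m)" using l by (simp add: powr_diff divide_inverse)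
      also have "l powr m = A / W" using A W m by (simp add: l_def powr_powr)
      finally show ?thesis using A W by simp
    qed
    also have "l * W + l * W = 2 * l * W" by simp
    finally have "(\<integral>\<^sup>+x. w x * h x \<partial>M) epowr m \<le> ennreal (2 * l * W) epowr m"
      using m by (intro epowr_mono) auto
    also have "\<dots> = ennreal (2 powr m * l powr m * W powr m)"
      using l W by (simp add: epowr_ennreal powr_mult)
    also have "2 powr m * l powr m * W powr m = 2 powr m * W powr (m - 1) * A"
      using A W m by (simp add: l_def powr_powr powr_diff)
    finally show ?thesis using A by (simp add: real ennreal_mult)
  qed
next
  case top
  then show ?thesis using W by (simp add: ennreal_mult_top)
qed

text \<open>A Schur test. The exponential kernel has bounded mass in \<open>x\<close>, uniformly in \<open>t\<close>, by assumption, and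
  in \<open>t\<close>, uniformly in \<open>x\<close>, by computation. Convexity of the power \<open>q/s \<ge> 1\<close> and Tonelli's theorem do the
  rest.\<close>

lemma schur_exponential:
  fixes N :: "'s measure" and \<phi> :: "'s \<Rightarrow> real" and \<epsilon> s W :: real
  assumes N: "sigma_finite_measure N" and \<phi>[measurable]: "\<phi> \<in> borel_measurable N"
    and pos: "0 < \<epsilon>" "0 < s" "ennreal s \<le> q" "0 < W"
    and W: "\<And>t. (\<integral>\<^sup>+x. ennreal (exp (- \<epsilon> * \<bar>t - \<phi> x\<bar>)) \<partial>N) \<le> ennreal W"
  shows "\<exists>C>0. \<forall>g\<in>borel_measurable N.
    enorm lborel q (\<lambda>t. (\<integral>\<^sup>+x. ennreal (exp (- \<epsilon> * \<bar>t - \<phi> x\<bar>)) * g x epowr s \<partial>N) epowr (1 / s))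
      \<le> ennreal C * enorm N q g"
proof -
  interpret N: sigma_finite_measure N by fact
  interpret P: pair_sigma_finite lborel N ..
  have "0 < q" using pos by (auto intro: less_le_trans[of 0 "ennreal s"])
  then show ?thesis
  proof (cases rule: exponent_cases)
    case 1
    show ?thesis
    proof (intro exI[of _ "W powr (1 / s)"] conjI ballI)
      fix g :: "'s \<Rightarrow> ennreal" assume [measurable]: "g \<in> borel_measurable N"
      have "(\<integral>\<^sup>+x. ennreal (exp (- \<epsilon> * \<bar>t - \<phi> x\<bar>)) * g x epowr s \<partial>N) epowr (1 / s)
        \<le> ennreal (W powr (1 / s)) * enorm N q g" for t
      proof -
        have "(\<integral>\<^sup>+x. ennreal (exp (- \<epsilon> * \<bar>t - \<phi> x\<bar>)) * g x epowr s \<partial>N)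
          \<le> (\<integral>\<^sup>+x. enorm N q g epowr s * ennreal (exp (- \<epsilon> * \<bar>t - \<phi> x\<bar>)) \<partial>N)"
          unfolding mult.commute[of "enorm N q g epowr s"] using pos
          by (intro nn_integral_mono mult_left_mono epowr_mono) (auto simp: enorm_def 1 intro: SUP_upper)
        also have "\<dots> = enorm N q g epowr s * (\<integral>\<^sup>+x. ennreal (exp (- \<epsilon> * \<bar>t - \<phi> x\<bar>)) \<partial>N)"
          by (rule nn_integral_cmult) measurable
        also have "\<dots> \<le> enorm N q g epowr s * ennreal W"
          by (intro mult_left_mono W) simp
        finally have "(\<integral>\<^sup>+x. ennreal (exp (- \<epsilon> * \<bar>t - \<phi> x\<bar>)) * g x epowr s \<partial>N) epowr (1 / s)
          \<le> (enorm N q g epowr s * ennreal W) epowr (1 / s)"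
          using pos by (intro epowr_mono) auto
        then show ?thesis using pos by (simp add: epowr_mult epowr_ennreal mult.commute)
      qed
      then show "enorm lborel q (\<lambda>t. (\<integral>\<^sup>+x. ennreal (exp (- \<epsilon> * \<bar>t - \<phi> x\<bar>)) * g x epowr s \<partial>N) epowr (1 / s))
        \<le> ennreal (W powr (1 / s)) * enorm N q g"
        by (subst enorm_def) (auto simp: 1 intro: SUP_least)
    qed (use pos in simp)
  next
    case (2 r)
    define m where "m = r / s"
    have m: "1 \<le> m" using 2 pos by (simp add: m_def ennreal_le_iff)
    define D where "D = 2 powr m * W powr (m - 1) * (2 / \<epsilon>)"
    have D: "0 < D" using pos by (simp add: D_def)
    show ?thesis
    proof (intro exI[of _ "D powr (1 / r)"] conjI ballI)
      fix g :: "'s \<Rightarrow> ennreal" assume [measurable]: "g \<in> borel_measurable N"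
      let ?w = "\<lambda>t x. ennreal (exp (- \<epsilon> * \<bar>t - \<phi> x\<bar>))"
      have "(\<integral>\<^sup>+t. ((\<integral>\<^sup>+x. ?w t x * g x epowr s \<partial>N) epowr (1 / s)) epowr r \<partial>lborel)
        = (\<integral>\<^sup>+t. (\<integral>\<^sup>+x. ?w t x * g x epowr s \<partial>N) epowr m \<partial>lborel)"
        by (simp add: epowr_epowr m_def)
      also have "\<dots> \<le> (\<integral>\<^sup>+t. ennreal (2 powr m * W powr (m - 1)) * (\<integral>\<^sup>+x. ?w t x * (g x epowr s) epowr m \<partial>N) \<partial>lborel)"
        using m pos W by (intro nn_integral_mono weighted_power_mean) auto
      also have "\<dots> = ennreal (2 powr m * W powr (m - 1)) * (\<integral>\<^sup>+t. (\<integral>\<^sup>+x. ?w t x * (g x epowr s) epowr m \<partial>N) \<partial>lborel)"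
        by (rule nn_integral_cmult) measurable
      also have "(\<integral>\<^sup>+t. (\<integral>\<^sup>+x. ?w t x * (g x epowr s) epowr m \<partial>N) \<partial>lborel)
        = (\<integral>\<^sup>+x. (\<integral>\<^sup>+t. ?w t x * (g x epowr s) epowr m \<partial>lborel) \<partial>N)"
        by (rule P.Fubini'[symmetric]) measurable
      also have "\<dots> = (\<integral>\<^sup>+x. (g x epowr s) epowr m * (\<integral>\<^sup>+t. ?w t x \<partial>lborel) \<partial>N)"
        by (subst nn_integral_cmult[symmetric]) (simp_all add: mult.commute)
      also have "\<dots> \<le> (\<integral>\<^sup>+x. ennreal (2 / \<epsilon>) * g x epowr r \<partial>N)"
      proof (rule nn_integral_mono)
        fix x
        have "(\<integral>\<^sup>+t. ?w t x \<partial>lborel) \<le> ennreal (2 / \<epsilon>)"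
          using nn_integral_exp_abs_le[OF pos(1), of 1 "\<phi> x"] by (simp add: abs_minus_commute)
        then show "(g x epowr s) epowr m * (\<integral>\<^sup>+t. ?w t x \<partial>lborel) \<le> ennreal (2 / \<epsilon>) * g x epowr r"
          using pos by (subst mult.commute) (auto simp: epowr_epowr m_def intro!: mult_right_mono)
      qed
      also have "\<dots> = ennreal (2 / \<epsilon>) * (\<integral>\<^sup>+x. g x epowr r \<partial>N)"
        by (rule nn_integral_cmult) measurable
      finally have "(\<integral>\<^sup>+t. ((\<integral>\<^sup>+x. ?w t x * g x epowr s \<partial>N) epowr (1 / s)) epowr r \<partial>lborel)
          \<le> ennreal (2 powr m * W powr (m - 1)) * (ennreal (2 / \<epsilon>) * (\<integral>\<^sup>+x. g x epowr r \<partial>N))"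
        by (simp add: mult_left_mono)
      also have "\<dots> = ennreal D * (\<integral>\<^sup>+x. g x epowr r \<partial>N)"
        unfolding D_def using pos by (subst ennreal_mult_mult) auto
      finally have "enorm lborel q (\<lambda>t. (\<integral>\<^sup>+x. ?w t x * g x epowr s \<partial>N) epowr (1 / s))
          \<le> (ennreal D * (\<integral>\<^sup>+x. g x epowr r \<partial>N)) epowr (1 / r)"
        using 2 by (simp add: enorm_ennreal epowr_mono del: epowr_inverse_cancel)
      then show "enorm lborel q (\<lambda>t. (\<integral>\<^sup>+x. ?w t x * g x epowr s \<partial>N) epowr (1 / s))
        \<le> ennreal (D powr (1 / r)) * enorm N q g"
        using 2 D by (simp add: enorm_ennreal epowr_mult epowr_ennreal)
    qed (use D in simp)
  qed
qed

lemma borel_measurable_nn_integral_count_space: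
  assumes "countable I" "\<And>k. k \<in> I \<Longrightarrow> (\<lambda>t. f t k) \<in> borel_measurable N"
  shows "(\<lambda>t. \<integral>\<^sup>+k. f t k \<partial>count_space I) \<in> borel_measurable N"
proof -
  interpret sigma_finite_measure "count_space I"
    by (rule sigma_finite_measure_count_space_countable) fact
  have "(\<lambda>(k, t). f t k) \<in> borel_measurable (count_space I \<Otimes>\<^sub>M N)"
    by (rule measurable_pair_measure_countable1) (use assms in auto)
  from measurable_pair_swap[OF this] have "case_prod f \<in> borel_measurable (N \<Otimes>\<^sub>M count_space I)"
    by (simp add: case_prod_beta')
  then show ?thesis by (rule borel_measurable_nn_integral)
qed

text \<open>The intervals \<open>[k, k+1)\<close> are disjoint; this passes between sums over integers and integrals in both
  \<open>sum_exp_abs_le\<close> and \<open>enorm_ge_sum_of_bumps\<close>.\<close>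

lemma sum_unit_intervals_le:
  fixes f :: "real \<Rightarrow> ennreal" and I :: "int set"
  assumes [measurable]: "f \<in> borel_measurable borel"
  shows "(\<integral>\<^sup>+k. (\<integral>\<^sup>+x. f x * indicator {real_of_int k..<real_of_int k + 1} x \<partial>lborel) \<partial>count_space I) \<le> (\<integral>\<^sup>+x. f x \<partial>lborel)"
proof -
  have "(\<integral>\<^sup>+k. (\<integral>\<^sup>+x. f x * indicator {real_of_int k..<real_of_int k + 1} x \<partial>lborel) \<partial>count_space I)
    = (\<integral>\<^sup>+x. (\<integral>\<^sup>+k. f x * indicator {real_of_int k..<real_of_int k + 1} x \<partial>count_space I) \<partial>lborel)"
    by (rule nn_integral_count_space_nn_integral[symmetric]) auto
  also have "\<dots> \<le> (\<integral>\<^sup>+x. f x \<partial>lborel)"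
  proof (rule nn_integral_mono)
    fix x
    have "(\<integral>\<^sup>+k. f x * indicator {real_of_int k..<real_of_int k + 1} x \<partial>count_space I)
      \<le> (\<integral>\<^sup>+k. f x * indicator {\<lfloor>x\<rfloor>} k \<partial>count_space I)"
    proof (intro nn_integral_mono mult_left_mono)
      fix k :: int
      have "x \<in> {real_of_int k..<real_of_int k + 1} \<Longrightarrow> k = \<lfloor>x\<rfloor>" using floor_unique[of k x] by auto
      then show "indicator {real_of_int k..<real_of_int k + 1} x \<le> (indicator {\<lfloor>x\<rfloor>} k :: ennreal)"
        by (cases "x \<in> {real_of_int k..<real_of_int k + 1}") (simp_all del: atLeastLessThan_iff)
    qed simp
    also have "\<dots> \<le> (\<integral>\<^sup>+k. f x * indicator {\<lfloor>x\<rfloor>} k \<partial>count_space UNIV)"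
      by (rule nn_integral_count_space_le_UNIV)
    also have "\<dots> = f x"
      by (subst nn_integral_cmult) auto
    finally show "(\<integral>\<^sup>+k. f x * indicator {real_of_int k..<real_of_int k + 1} x \<partial>count_space I) \<le> f x" .
  qed
  finally show ?thesis .
qed

lemma nn_integral_unit_interval_const:
  "(\<integral>\<^sup>+x. c * indicator {real_of_int k..<real_of_int k + 1} x \<partial>lborel) = c"
  by (subst nn_integral_cmult) auto

text \<open>On \<open>[k, k+1)\<close> the function \<open>exp (-c |t - d x|)\<close> varies by a factor of at most \<open>exp (c |d|)\<close>, so the sum is
  controlled by the integral.\<close>

lemma sum_exp_abs_le:
  fixes I :: "int set"
  assumes "0 < c" "d \<noteq> 0"
  shows "(\<integral>\<^sup>+k. ennreal (exp (- c * \<bar>t - real_of_int k * d\<bar>)) \<partial>count_space I) \<le> ennreal (exp (c * \<bar>d\<bar>) * (2 / (c * \<bar>d\<bar>)))"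
proof -
  let ?f = "\<lambda>x. ennreal (exp (c * \<bar>d\<bar>)) * ennreal (exp (- c * \<bar>t - d * x\<bar>))"
  have "(\<integral>\<^sup>+k. ennreal (exp (- c * \<bar>t - real_of_int k * d\<bar>)) \<partial>count_space I) \<le>
    (\<integral>\<^sup>+k. (\<integral>\<^sup>+x. ?f x * indicator {real_of_int k..<real_of_int k + 1} x \<partial>lborel) \<partial>count_space I)"
  proof (rule nn_integral_mono)
    fix k :: int
    have "(\<integral>\<^sup>+x. ennreal (exp (- c * \<bar>t - real_of_int k * d\<bar>)) * indicator {real_of_int k..<real_of_int k + 1} x \<partial>lborel) \<le>
      (\<integral>\<^sup>+x. ?f x * indicator {real_of_int k..<real_of_int k + 1} x \<partial>lborel)"
    proof (intro nn_integral_mono)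
      fix x :: real
      have "exp (- c * \<bar>t - real_of_int k * d\<bar>) \<le> exp (c * \<bar>d\<bar> + - c * \<bar>t - d * x\<bar>)"
        if x: "real_of_int k \<le> x" "x < real_of_int k + 1"
      proof -
        have "\<bar>d * (real_of_int k - x)\<bar> \<le> \<bar>d\<bar> * 1"
          unfolding abs_mult using x by (intro mult_left_mono) auto
        moreover have "t - d * x = (t - real_of_int k * d) + d * (real_of_int k - x)"
          by (simp add: algebra_simps)
        ultimately have "\<bar>t - d * x\<bar> \<le> \<bar>t - real_of_int k * d\<bar> + \<bar>d\<bar>"
          using abs_triangle_ineq[of "t - real_of_int k * d" "d * (real_of_int k - x)"] by linarith
        then have "c * \<bar>t - d * x\<bar> \<le> c * (\<bar>t - real_of_int k * d\<bar> + \<bar>d\<bar>)"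
          using assms by (intro mult_left_mono) auto
        then show ?thesis by (simp add: algebra_simps)
      qed
      then show "ennreal (exp (- c * \<bar>t - real_of_int k * d\<bar>)) * indicator {real_of_int k..<real_of_int k + 1} x
        \<le> ?f x * indicator {real_of_int k..<real_of_int k + 1} x"
        unfolding ennreal_exp_mult by (auto split: split_indicator intro: ennreal_leI)
    qed
    then show "ennreal (exp (- c * \<bar>t - real_of_int k * d\<bar>)) \<le>
      (\<integral>\<^sup>+x. ?f x * indicator {real_of_int k..<real_of_int k + 1} x \<partial>lborel)"
      unfolding nn_integral_unit_interval_const .
  qed
  also have "\<dots> \<le> (\<integral>\<^sup>+x. ?f x \<partial>lborel)" by (rule sum_unit_intervals_le) measurable
  also have "\<dots> = ennreal (exp (c * \<bar>d\<bar>)) * (\<integral>\<^sup>+x. ennreal (exp (- c * \<bar>t - d * x\<bar>)) \<partial>lborel)"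
    by (rule nn_integral_cmult) measurable
  also have "\<dots> \<le> ennreal (exp (c * \<bar>d\<bar>)) * ennreal (2 / (c * \<bar>d\<bar>))"
    by (intro mult_left_mono nn_integral_exp_abs_le assms) simp
  also have "\<dots> = ennreal (exp (c * \<bar>d\<bar>) * (2 / (c * \<bar>d\<bar>)))"
    using assms by (intro ennreal_mult[symmetric]) auto
  finally show ?thesis .
qed

section \<open>Couples with a common underlying norm\<close>

lemma enorm_exp_abs:
  assumes "0 < q" "0 < c"
  shows "enorm lborel q (\<lambda>t. ennreal (exp (- c * \<bar>t\<bar>))) < top" "0 < enorm lborel q (\<lambda>t. ennreal (exp (- c * \<bar>t\<bar>)))"
proof -
  have "enorm lborel q (\<lambda>t. ennreal (exp (- c * \<bar>t\<bar>))) < top \<and> 0 < enorm lborel q (\<lambda>t. ennreal (exp (- c * \<bar>t\<bar>)))"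
    using assms(1)
  proof (cases rule: exponent_cases)
    case 1
    have "(SUP t. ennreal (exp (- c * \<bar>t\<bar>))) \<le> 1"
      using assms by (intro SUP_least) (simp add: ennreal_le_1)
    moreover have "ennreal (exp (- c * \<bar>0\<bar>)) \<le> (SUP t. ennreal (exp (- c * \<bar>t\<bar>)))"
      by (rule SUP_upper) simp
    ultimately show ?thesis using 1
      by (auto simp: enorm_def intro: le_less_trans less_le_trans[of 0 1])
  next
    case (2 r)
    let ?I = "\<integral>\<^sup>+t. ennreal (exp (- (r * c) * \<bar>t\<bar>)) \<partial>lborel"
    have "?I \<le> ennreal (2 / (r * c * \<bar>-1\<bar>))"
      using nn_integral_exp_abs_le[of "r * c" "-1" 0] assms 2 by simp
    then have "?I < top" by (rule le_less_trans) simp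
    moreover have "?I \<noteq> 0"
    proof
      assume "?I = 0"
      then have "AE t in lborel. ennreal (exp (- (r * c) * \<bar>t\<bar>)) = 0"
        by (subst (asm) nn_integral_0_iff_AE) auto
      then have "AE t in (lborel::real measure). False"
        by eventually_elim simp
      then have "emeasure (lborel :: real measure) (space lborel) = 0"
        by (subst (asm) AE_iff_measurable[OF _ refl]) auto
      then show False by simp
    qed
    moreover have "enorm lborel q (\<lambda>t. ennreal (exp (- c * \<bar>t\<bar>))) = ?I epowr (1 / r)"
      using 2 by (simp add: enorm_ennreal epowr_exp mult_ac)
    ultimately show ?thesis by (auto simp: zero_less_iff_neq_zero)
  qed
  then show "enorm lborel q (\<lambda>t. ennreal (exp (- c * \<bar>t\<bar>))) < top" "0 < enorm lborel q (\<lambda>t. ennreal (exp (- c * \<bar>t\<bar>)))"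
    by auto
qed

text \<open>The couple of a space with itself, where \<open>b\<close> is the norm of the element: its K-functional is
  comparable with \<open>min 1 (exp \<tau>) b\<close>. The hypotheses on \<open>G\<close> are the two trivial decompositions and the quasi-triangle
  inequality.\<close>

lemma inorm_diagonal:
  assumes \<theta>: "0 < \<theta>" "\<theta> < 1" and q: "0 < q" and c: "0 < (c::real)"
  shows "\<exists>C>0. \<forall>G b. (b, 0) \<in> G \<longrightarrow> (0, b) \<in> G \<longrightarrow> (\<forall>(x, y)\<in>G. b \<le> ennreal c * (x + y)) \<longrightarrow>
     inorm G \<theta> q \<le> ennreal C * b \<and> b \<le> ennreal C * inorm G \<theta> q"
proof -
  define \<epsilon> where "\<epsilon> = min \<theta> (1 - \<theta>)"
  have \<epsilon>: "0 < \<epsilon>" using \<theta> by (simp add: \<epsilon>_def)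
  obtain A where A: "0 < A" "enorm lborel q (\<lambda>t. ennreal (exp (- \<epsilon> * \<bar>t\<bar>))) = ennreal A"
    using enorm_exp_abs[OF q \<epsilon>] by (cases "enorm lborel q (\<lambda>t. ennreal (exp (- \<epsilon> * \<bar>t\<bar>)))") auto
  obtain B where B: "0 < B" "enorm lborel q (\<lambda>t. ennreal (exp (- 1 * \<bar>t\<bar>))) = ennreal B"
    using enorm_exp_abs[OF q zero_less_one] by (cases "enorm lborel q (\<lambda>t. ennreal (exp (- 1 * \<bar>t\<bar>)))") auto
  show ?thesis
  proof (intro exI[of _ "max A (1 / B * c)"] conjI allI impI)
    fix G :: "(ennreal \<times> ennreal) set" and b
    assume G: "(b, 0) \<in> G" "(0, b) \<in> G" "\<forall>(x, y)\<in>G. b \<le> ennreal c * (x + y)"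
    have "ennreal (exp (- \<theta> * t)) * Kf G t \<le> b * ennreal (exp (- \<epsilon> * \<bar>t\<bar>))" for t
    proof (cases "0 \<le> t")
      case True
      have "exp (- \<theta> * t) \<le> exp (- \<epsilon> * \<bar>t\<bar>)" using True by (simp add: \<epsilon>_def mult_right_mono)
      moreover have "Kf G t \<le> b" using Kf_le[OF G(1), of t] by simp
      ultimately show ?thesis by (subst mult.commute[of b]) (auto intro!: mult_mono ennreal_leI)
    next
      case False
      have "exp (- \<theta> * t + t) \<le> exp (- \<epsilon> * \<bar>t\<bar>)"
        using mult_right_mono_neg[of \<epsilon> "1 - \<theta>" t] False by (simp add: \<epsilon>_def algebra_simps)
      moreover have "ennreal (exp (- \<theta> * t)) * Kf G t \<le> ennreal (exp (- \<theta> * t)) * (ennreal (exp t) * b)"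
        using Kf_le[OF G(2), of t] by (intro mult_left_mono) auto
      ultimately show ?thesis
        unfolding ennreal_exp_mult by (subst mult.commute[of b]) (auto intro!: mult_right_mono ennreal_leI elim!: order_trans)
    qed
    then have "inorm G \<theta> q \<le> enorm lborel q (\<lambda>t. b * ennreal (exp (- \<epsilon> * \<bar>t\<bar>)))"
      unfolding inorm_def using q by (intro enorm_mono)
    also have "\<dots> = b * ennreal A" unfolding A(2)[symmetric] using q by (intro enorm_cmult) auto
    also have "\<dots> \<le> ennreal (max A (1 / B * c)) * b"
      by (subst mult.commute) (intro mult_right_mono ennreal_leI, auto)
    finally show "inorm G \<theta> q \<le> ennreal (max A (1 / B * c)) * b" .
    have "b * ennreal (exp (- 1 * \<bar>t\<bar>)) \<le> ennreal c * (ennreal (exp (- \<theta> * t)) * Kf G t)" for t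
    proof -
      have "ennreal (exp (\<theta> * t - \<bar>t\<bar>) / c) * b \<le> Kf G t"
      proof (rule Kf_ge)
        fix x y assume "(x, y) \<in> G"
        then have "ennreal (exp (\<theta> * t - \<bar>t\<bar>) / c) * b \<le> ennreal (exp (\<theta> * t - \<bar>t\<bar>) / c) * (ennreal c * (x + y))"
          using G(3) by (intro mult_left_mono) auto
        also have "\<dots> = ennreal (exp (\<theta> * t - \<bar>t\<bar>)) * x + ennreal (exp (\<theta> * t - \<bar>t\<bar>)) * y"
          using c by (simp add: ennreal_mult_mult distrib_left)
        also have "\<dots> \<le> ennreal 1 * x + ennreal (exp t) * y"
        proof (intro add_mono mult_right_mono ennreal_leI)
          show "exp (\<theta> * t - \<bar>t\<bar>) \<le> 1"
            using \<theta> mult_right_mono[of \<theta> 1 t] mult_nonneg_nonpos[of \<theta> t] by (cases "0 \<le> t") auto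
          show "exp (\<theta> * t - \<bar>t\<bar>) \<le> exp t"
          proof (cases "0 \<le> t")
            case True then show ?thesis using \<theta> mult_right_mono[of \<theta> 1 t] by (auto intro: order_trans[of _ t])
          next
            case False then show ?thesis using \<theta> by (simp add: mult_nonneg_nonpos)
          qed
        qed auto
        finally show "ennreal (exp (\<theta> * t - \<bar>t\<bar>) / c) * b \<le> x + ennreal (exp t) * y" by simp
      qed
      then have "ennreal (c * exp (- \<theta> * t)) * (ennreal (exp (\<theta> * t - \<bar>t\<bar>) / c) * b) \<le> ennreal (c * exp (- \<theta> * t)) * Kf G t"
        by (rule mult_left_mono) simp
      moreover have "c * exp (- \<theta> * t) * (exp (\<theta> * t - \<bar>t\<bar>) / c) = exp (- \<bar>t\<bar>)"
        using c by (simp flip: exp_add)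
      ultimately show ?thesis using c
        by (simp add: ennreal_mult_mult mult.commute[of b])
    qed
    then have "enorm lborel q (\<lambda>t. b * ennreal (exp (- 1 * \<bar>t\<bar>))) \<le> enorm lborel q (\<lambda>t. ennreal c * (ennreal (exp (- \<theta> * t)) * Kf G t))"
      using q by (intro enorm_mono)
    also have "enorm lborel q (\<lambda>t. b * ennreal (exp (- 1 * \<bar>t\<bar>))) = b * ennreal B"
      unfolding B(2)[symmetric] using q by (intro enorm_cmult) auto
    also have "enorm lborel q (\<lambda>t. ennreal c * (ennreal (exp (- \<theta> * t)) * Kf G t)) = ennreal c * inorm G \<theta> q"
      unfolding inorm_def using q by (intro enorm_cmult) auto
    finally have "b \<le> ennreal (1 / B) * (ennreal c * inorm G \<theta> q)"
      using B by (intro ennreal_le_divide) (simp_all add: mult.commute)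
    also have "\<dots> = ennreal (1 / B * c) * inorm G \<theta> q" using B c by (intro ennreal_mult_mult) auto
    also have "\<dots> \<le> ennreal (max A (1 / B * c)) * inorm G \<theta> q"
      by (intro mult_right_mono ennreal_leI) auto
    finally show "b \<le> ennreal (max A (1 / B * c)) * inorm G \<theta> q" .
  qed (use A in simp)
qed

text \<open>If \<open>K\<close> dominates a bump of height \<open>\<beta> k\<close> at each \<open>k \<delta>\<close>, then near \<open>k \<delta>\<close>, on an interval of length
  \<open>|\<delta>|\<close>, it is at least a multiple of \<open>\<beta> k\<close>, and these intervals are disjoint.\<close>

lemma enorm_ge_sum_of_bumps:
  fixes I :: "int set" and \<delta> :: real
  assumes q: "0 < q" and \<delta>: "\<delta> \<noteq> 0"
  shows "\<exists>B>0. \<forall>K\<in>borel_measurable borel. \<forall>\<beta>.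
      (\<forall>k\<in>I. \<forall>t. ennreal (exp (- \<bar>t - real_of_int k * \<delta>\<bar>)) * \<beta> k \<le> K t) \<longrightarrow>
      enorm (count_space I) q \<beta> \<le> ennreal B * enorm lborel q K"
  using q
proof (cases rule: exponent_cases)
  case 1
  show ?thesis
  proof (intro exI[of _ 1] conjI ballI allI impI)
    fix K \<beta> assume *: "\<forall>k\<in>I. \<forall>t. ennreal (exp (- \<bar>t - real_of_int k * \<delta>\<bar>)) * \<beta> k \<le> K t"
    have "\<beta> k \<le> (SUP t. K t)" if "k \<in> I" for k
    proof -
      have "\<beta> k \<le> K (real_of_int k * \<delta>)" using *[rule_format, OF that, of "real_of_int k * \<delta>"] by simp
      also have "\<dots> \<le> (SUP t. K t)" by (rule SUP_upper) simp
      finally show ?thesis .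
    qed
    then show "enorm (count_space I) q \<beta> \<le> ennreal 1 * enorm lborel q K"
      by (auto simp: enorm_def 1 intro: SUP_least)
  qed simp
next
  case (2 r)
  define D where "D = exp (\<bar>\<delta>\<bar> * r) / \<bar>\<delta>\<bar>"
  have D: "0 < D" using \<delta> by (simp add: D_def)
  show ?thesis
  proof (intro exI[of _ "D powr (1 / r)"] conjI ballI allI impI)
    fix K :: "real \<Rightarrow> ennreal" and \<beta> assume [measurable]: "K \<in> borel_measurable borel"
      and *: "\<forall>k\<in>I. \<forall>t. ennreal (exp (- \<bar>t - real_of_int k * \<delta>\<bar>)) * \<beta> k \<le> K t"
    let ?h = "\<lambda>x. ennreal (exp (\<bar>\<delta>\<bar> * r)) * K (\<delta> * x) epowr r"
    have "(\<integral>\<^sup>+k. \<beta> k epowr r \<partial>count_space I) \<le>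
      (\<integral>\<^sup>+k. (\<integral>\<^sup>+x. ?h x * indicator {real_of_int k..<real_of_int k + 1} x \<partial>lborel) \<partial>count_space I)"
    proof (rule nn_integral_mono)
      fix k assume k: "k \<in> space (count_space I)"
      have "(\<integral>\<^sup>+x. \<beta> k epowr r * indicator {real_of_int k..<real_of_int k + 1} x \<partial>lborel) \<le>
        (\<integral>\<^sup>+x. ?h x * indicator {real_of_int k..<real_of_int k + 1} x \<partial>lborel)"
      proof (intro nn_integral_mono)
        fix x :: real
        have "\<beta> k epowr r \<le> ?h x" if x: "x \<in> {real_of_int k..<real_of_int k + 1}"
        proof -
          have "\<bar>\<delta> * (x - real_of_int k)\<bar> \<le> \<bar>\<delta>\<bar> * 1"
            unfolding abs_mult using x by (intro mult_left_mono) auto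
          then have "exp (- \<bar>\<delta>\<bar>) \<le> exp (- \<bar>\<delta> * x - real_of_int k * \<delta>\<bar>)"
            by (simp add: algebra_simps)
          then have "ennreal (exp (- \<bar>\<delta>\<bar>)) * \<beta> k \<le> ennreal (exp (- \<bar>\<delta> * x - real_of_int k * \<delta>\<bar>)) * \<beta> k"
            by (intro mult_right_mono ennreal_leI) auto
          also have "\<dots> \<le> K (\<delta> * x)" using * k by simp
          finally have "\<beta> k \<le> ennreal (exp \<bar>\<delta>\<bar>) * K (\<delta> * x)" by (simp add: le_mult_exp_iff)
          then have "\<beta> k epowr r \<le> (ennreal (exp \<bar>\<delta>\<bar>) * K (\<delta> * x)) epowr r"
            using 2 by (intro epowr_mono)
          then show ?thesis using 2 by (simp add: epowr_mult epowr_exp mult.commute[of r])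
        qed
        then show "\<beta> k epowr r * indicator {real_of_int k..<real_of_int k + 1} x
          \<le> ?h x * indicator {real_of_int k..<real_of_int k + 1} x"
          by (cases "x \<in> {real_of_int k..<real_of_int k + 1}") (simp_all del: atLeastLessThan_iff)
      qed
      then show "\<beta> k epowr r \<le> (\<integral>\<^sup>+x. ?h x * indicator {real_of_int k..<real_of_int k + 1} x \<partial>lborel)"
        unfolding nn_integral_unit_interval_const .
    qed
    also have "\<dots> \<le> (\<integral>\<^sup>+x. ?h x \<partial>lborel)" by (rule sum_unit_intervals_le) measurable
    also have "\<dots> = ennreal (exp (\<bar>\<delta>\<bar> * r)) * (\<integral>\<^sup>+x. K (0 + \<delta> * x) epowr r \<partial>lborel)"
      by (subst nn_integral_cmult) auto
    also have "\<dots> = ennreal D * (\<integral>\<^sup>+x. K x epowr r \<partial>lborel)"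
      unfolding D_def by (subst (2) nn_integral_real_affine[where c=\<delta> and t=0]) (use \<delta> in \<open>simp_all add: ennreal_mult_mult\<close>)
    finally have "(\<integral>\<^sup>+k. \<beta> k epowr r \<partial>count_space I) epowr (1 / r) \<le> (ennreal D * (\<integral>\<^sup>+x. K x epowr r \<partial>lborel)) epowr (1 / r)"
      using 2 by (intro epowr_mono) auto
    then show "enorm (count_space I) q \<beta> \<le> ennreal (D powr (1 / r)) * enorm lborel q K"
      using 2 D by (simp add: enorm_ennreal epowr_mult epowr_ennreal)
  qed (use D in simp)
qed

text \<open>Sequence spaces with different geometric weights over one space; \<open>b k\<close> is the norm of the \<open>k\<close>-th
  entry and the hypotheses on \<open>G\<close> are the trivial decompositions and the quasi-triangle inequality. With
  \<open>u = \<tau> - k \<delta>\<close>, the cheaper of the two trivial decompositions of the \<open>k\<close>-th entry costs, after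
  multiplication by \<open>exp (-\<theta> \<tau>)\<close>, \<open>exp (min (-\<theta> u) ((1-\<theta>) u))\<close> times \<open>exp (k \<alpha>) b k\<close>. This decays
  exponentially in \<open>|u|\<close>, fast enough to replace all three exponents by a smaller common one \<open>s\<close>.\<close>

theorem lq_couple_geometric_weights:
  fixes \<theta> \<alpha>0 \<alpha>1 \<alpha> c :: real and I :: "int set"
  assumes \<theta>: "0 < \<theta>" "\<theta> < 1" and q: "0 < q0" "0 < q1" "0 < q" and c: "0 < c" and I: "I \<noteq> {}"
    and ne: "\<alpha>0 \<noteq> \<alpha>1" and a: "\<alpha> = (1 - \<theta>) * \<alpha>0 + \<theta> * \<alpha>1"
  shows "\<exists>C>0. \<forall>(G :: int \<Rightarrow> (ennreal \<times> ennreal) set) (b :: int \<Rightarrow> ennreal).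
    (\<forall>k\<in>I. (ennreal (exp (k * \<alpha>0)) * b k, 0) \<in> G k \<and> (0, ennreal (exp (k * \<alpha>1)) * b k) \<in> G k \<and>
       (\<forall>(x, y)\<in>G k. b k \<le> ennreal c * (ennreal (exp (- (k * \<alpha>0))) * x + ennreal (exp (- (k * \<alpha>1))) * y))) \<longrightarrow>
     inorm (lq_couple I q0 q1 G) \<theta> q \<le> ennreal C * enorm (count_space I) q (\<lambda>k. ennreal (exp (k * \<alpha>)) * b k) \<and>
     enorm (count_space I) q (\<lambda>k. ennreal (exp (k * \<alpha>)) * b k) \<le> ennreal C * inorm (lq_couple I q0 q1 G) \<theta> q"
proof -
  define \<delta> where "\<delta> = \<alpha>0 - \<alpha>1"
  have \<delta>: "\<delta> \<noteq> 0" using ne by (simp add: \<delta>_def)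
  have a0: "\<alpha>0 = \<alpha> + \<theta> * \<delta>" and a1: "\<alpha>1 = \<alpha> - (1 - \<theta>) * \<delta>"
    by (simp_all add: a \<delta>_def algebra_simps)
  define \<epsilon> where "\<epsilon> = min \<theta> (1 - \<theta>)"
  have \<epsilon>: "0 < \<epsilon>" using \<theta> by (simp add: \<epsilon>_def)
  obtain s where s: "0 < s" "ennreal s \<le> q0" "ennreal s \<le> q1" "ennreal s \<le> q"
    using common_exponent[OF q] by blast
  interpret count: sigma_finite_measure "count_space I"
    by (rule sigma_finite_measure_count_space_countable) simp
  have "sigma_finite_measure (count_space I)" ..
  then obtain A where A: "0 < A" and schur: "\<And>g. enorm lborel q (\<lambda>t. (\<integral>\<^sup>+k. ennreal (exp (- (\<epsilon> * s) * \<bar>t - real_of_int k * \<delta>\<bar>)) * g k epowr s \<partial>count_space I) epowr (1 / s))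
      \<le> ennreal A * enorm (count_space I) q g"
    using schur_exponential[of "count_space I" "\<lambda>k. real_of_int k * \<delta>" "\<epsilon> * s" s q "exp (\<epsilon> * s * \<bar>\<delta>\<bar>) * (2 / (\<epsilon> * s * \<bar>\<delta>\<bar>))"]
      sum_exp_abs_le[of "\<epsilon> * s" \<delta>, where I=I] s \<epsilon> \<delta> by auto
  obtain B where B: "0 < B" and lower: "\<And>K \<beta>. K \<in> borel_measurable borel \<Longrightarrow>
      (\<And>k t. k \<in> I \<Longrightarrow> ennreal (exp (- \<bar>t - real_of_int k * \<delta>\<bar>)) * \<beta> k \<le> K t) \<Longrightarrow>
      enorm (count_space I) q \<beta> \<le> ennreal B * enorm lborel q K"
    using enorm_ge_sum_of_bumps[OF q(3) \<delta>, where I=I] by blast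
  show ?thesis
  proof (intro exI[of _ "max (2 * A) (B * c)"] conjI allI impI)
    fix G :: "int \<Rightarrow> (ennreal \<times> ennreal) set" and b :: "int \<Rightarrow> ennreal"
    assume G: "\<forall>k\<in>I. (ennreal (exp (k * \<alpha>0)) * b k, 0) \<in> G k \<and> (0, ennreal (exp (k * \<alpha>1)) * b k) \<in> G k \<and>
       (\<forall>(x, y)\<in>G k. b k \<le> ennreal c * (ennreal (exp (- (k * \<alpha>0))) * x + ennreal (exp (- (k * \<alpha>1))) * y))"
    define \<beta> where "\<beta> k = ennreal (exp (k * \<alpha>)) * b k" for k :: int
    have "ennreal (exp (- \<theta> * t)) * Kf (lq_couple I q0 q1 G) t \<le> ennreal 2 *
      (\<integral>\<^sup>+k. ennreal (exp (- (\<epsilon> * s) * \<bar>t - real_of_int k * \<delta>\<bar>)) * \<beta> k epowr s \<partial>count_space I) epowr (1 / s)" for t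
    proof -
      \<comment> \<open>An entry goes to the first space exactly if that is the cheaper choice at \<open>exp t\<close>.\<close>
      define X where "X k = (if k * \<delta> \<le> t then ennreal (exp (k * \<alpha>0)) * b k else 0)" for k :: int
      define Y where "Y k = (if k * \<delta> \<le> t then 0 else ennreal (exp (k * \<alpha>1)) * b k)" for k :: int
      define m where "m k = ennreal (exp (- \<epsilon> * \<bar>t - real_of_int k * \<delta>\<bar>)) * \<beta> k" for k :: int
      have "(enorm (count_space I) q0 X, enorm (count_space I) q1 Y) \<in> lq_couple I q0 q1 G"
        unfolding lq_couple_def
      proof (rule image_eqI[of _ _ "\<lambda>k. (X k, Y k)"])
        show "(\<lambda>k. (X k, Y k)) \<in> {g. \<forall>k\<in>I. g k \<in> G k}"
          using G by (auto simp: X_def Y_def)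
      qed simp
      then have "Kf (lq_couple I q0 q1 G) t \<le> enorm (count_space I) q0 X + ennreal (exp t) * enorm (count_space I) q1 Y"
        by (rule Kf_le)
      also have "\<dots> \<le> enorm (count_space I) (ennreal s) X + ennreal (exp t) * enorm (count_space I) (ennreal s) Y"
        using s by (intro add_mono mult_left_mono enorm_count_space_antimono) auto
      finally have "ennreal (exp (- \<theta> * t)) * Kf (lq_couple I q0 q1 G) t \<le>
          ennreal (exp (- \<theta> * t)) * (enorm (count_space I) (ennreal s) X + ennreal (exp t) * enorm (count_space I) (ennreal s) Y)"
        by (rule mult_left_mono) simp
      also have "\<dots> = enorm (count_space I) (ennreal s) (\<lambda>k. ennreal (exp (- \<theta> * t)) * X k)
          + enorm (count_space I) (ennreal s) (\<lambda>k. ennreal (exp (- \<theta> * t + t)) * Y k)"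
        using s I by (simp only: distrib_left ennreal_exp_mult) (subst (1 2) enorm_cmult, auto)
      also have "\<dots> \<le> enorm (count_space I) (ennreal s) m + enorm (count_space I) (ennreal s) m"
      proof (intro add_mono enorm_mono)
        fix k :: int
        have 1: "- \<theta> * t + k * \<alpha>0 = - \<theta> * (t - k * \<delta>) + k * \<alpha>" and
          2: "- \<theta> * t + t + k * \<alpha>1 = (1 - \<theta>) * (t - k * \<delta>) + k * \<alpha>"
          by (simp_all add: a0 a1 algebra_simps)
        show "ennreal (exp (- \<theta> * t)) * X k \<le> m k"
        proof (cases "k * \<delta> \<le> t")
          case True
          then have "- \<theta> * (t - k * \<delta>) \<le> - \<epsilon> * \<bar>t - real_of_int k * \<delta>\<bar>"
            by (simp add: \<epsilon>_def mult_right_mono)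
          then show ?thesis using True
            unfolding X_def m_def \<beta>_def by (simp only: ennreal_exp_mult 1 if_True) (intro mult_right_mono ennreal_leI, auto)
        qed (simp add: X_def)
        show "ennreal (exp (- \<theta> * t + t)) * Y k \<le> m k"
        proof (cases "k * \<delta> \<le> t")
          case False
          then have "(1 - \<theta>) * (t - k * \<delta>) \<le> \<epsilon> * (t - k * \<delta>)"
            by (intro mult_right_mono_neg) (auto simp: \<epsilon>_def)
          then have "(1 - \<theta>) * (t - k * \<delta>) \<le> - \<epsilon> * \<bar>t - real_of_int k * \<delta>\<bar>"
            using False by (simp add: algebra_simps)
          then show ?thesis using False
            unfolding Y_def m_def \<beta>_def by (simp only: ennreal_exp_mult 2 if_False) (intro mult_right_mono ennreal_leI, auto)
        qed (simp add: Y_def)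
      qed (use s in auto)
      also have "\<dots> = ennreal 2 * enorm (count_space I) (ennreal s) m"
        by (simp add: mult_2)
      also have "enorm (count_space I) (ennreal s) m =
        (\<integral>\<^sup>+k. ennreal (exp (- (\<epsilon> * s) * \<bar>t - real_of_int k * \<delta>\<bar>)) * \<beta> k epowr s \<partial>count_space I) epowr (1 / s)"
        unfolding enorm_ennreal[OF s(1)] m_def using s by (simp add: epowr_mult epowr_exp mult_ac)
      finally show ?thesis .
    qed
    then have "inorm (lq_couple I q0 q1 G) \<theta> q \<le> enorm lborel q (\<lambda>t. ennreal 2 *
      (\<integral>\<^sup>+k. ennreal (exp (- (\<epsilon> * s) * \<bar>t - real_of_int k * \<delta>\<bar>)) * \<beta> k epowr s \<partial>count_space I) epowr (1 / s))"
      unfolding inorm_def using q by (intro enorm_mono)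
    also have "\<dots> = ennreal 2 * enorm lborel q (\<lambda>t.
      (\<integral>\<^sup>+k. ennreal (exp (- (\<epsilon> * s) * \<bar>t - real_of_int k * \<delta>\<bar>)) * \<beta> k epowr s \<partial>count_space I) epowr (1 / s))"
    proof (rule enorm_cmult)
      have "(\<lambda>t. \<integral>\<^sup>+k. ennreal (exp (- (\<epsilon> * s) * \<bar>t - real_of_int k * \<delta>\<bar>)) * \<beta> k epowr s \<partial>count_space I) \<in> borel_measurable lborel"
        by (rule borel_measurable_nn_integral_count_space) auto
      then show "(\<lambda>t. (\<integral>\<^sup>+k. ennreal (exp (- (\<epsilon> * s) * \<bar>t - real_of_int k * \<delta>\<bar>)) * \<beta> k epowr s \<partial>count_space I) epowr (1 / s)) \<in> borel_measurable lborel"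
        by measurable
    qed (use q in auto)
    also have "\<dots> \<le> ennreal 2 * (ennreal A * enorm (count_space I) q \<beta>)"
      by (intro mult_left_mono schur) simp
    also have "\<dots> = ennreal (2 * A) * enorm (count_space I) q \<beta>"
      using A by (intro ennreal_mult_mult) auto
    also have "\<dots> \<le> ennreal (max (2 * A) (B * c)) * enorm (count_space I) q \<beta>"
      by (intro mult_right_mono ennreal_leI) auto
    finally show "inorm (lq_couple I q0 q1 G) \<theta> q \<le> ennreal (max (2 * A) (B * c)) *
       enorm (count_space I) q (\<lambda>k. ennreal (exp (k * \<alpha>)) * b k)"
      unfolding \<beta>_def .
    \<comment> \<open>Lower bound: a single entry already forces the full cost of its own decomposition.\<close>
    have "enorm (count_space I) q \<beta> \<le> ennreal B * enorm lborel q (\<lambda>t. ennreal c * (ennreal (exp (- \<theta> * t)) * Kf (lq_couple I q0 q1 G) t))"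
    proof (rule lower)
      fix k t assume k: "k \<in> I"
      define u where "u = t - real_of_int k * \<delta>"
      have t: "t = u + real_of_int k * \<delta>" by (simp add: u_def)
      have "ennreal (exp (\<theta> * t - \<bar>u\<bar>) / c) * \<beta> k \<le> Kf (lq_couple I q0 q1 G) t"
      proof (rule Kf_ge)
        fix x y assume "(x, y) \<in> lq_couple I q0 q1 G"
        then obtain g where g: "\<And>k. k \<in> I \<Longrightarrow> g k \<in> G k"
          and xy: "x = enorm (count_space I) q0 (\<lambda>k. fst (g k))" "y = enorm (count_space I) q1 (\<lambda>k. snd (g k))"
          by (auto simp: lq_couple_def)
        define x' y' where "x' = fst (g k)" "y' = snd (g k)"
        have le: "x' \<le> x" "y' \<le> y"
          unfolding xy x'_y'_def using enorm_count_space_ge[OF q(1) k, of "\<lambda>k. fst (g k)"]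
            enorm_count_space_ge[OF q(2) k, of "\<lambda>k. snd (g k)"] by auto
        have "b k \<le> ennreal c * (ennreal (exp (- (k * \<alpha>0))) * x' + ennreal (exp (- (k * \<alpha>1))) * y')"
          using G g[OF k] k unfolding x'_y'_def by (auto simp: case_prod_beta)
        then have "ennreal (exp (\<theta> * t - \<bar>u\<bar>) / c) * \<beta> k \<le> ennreal (exp (\<theta> * t - \<bar>u\<bar>) / c) *
            (ennreal (exp (k * \<alpha>)) * (ennreal c * (ennreal (exp (- (k * \<alpha>0))) * x' + ennreal (exp (- (k * \<alpha>1))) * y')))"
          unfolding \<beta>_def by (intro mult_left_mono) auto
        also have "\<dots> = ennreal (exp (\<theta> * t - \<bar>u\<bar> + k * \<alpha> - k * \<alpha>0)) * x' + ennreal (exp (\<theta> * t - \<bar>u\<bar> + k * \<alpha> - k * \<alpha>1)) * y'"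
        proof -
          have k: "exp (\<theta> * t - \<bar>u\<bar>) / c * (exp (k * \<alpha>) * (c * exp (- (k * a)))) = exp (\<theta> * t - \<bar>u\<bar> + k * \<alpha> - k * a)" for a :: real
            using c by (simp add: exp_add exp_diff exp_minus field_simps)
          have m4: "ennreal p1 * (ennreal p2 * (ennreal p3 * (ennreal p4 * z))) = ennreal (p1 * (p2 * (p3 * p4))) * z"
            if "0 \<le> p1" "0 \<le> p2" "0 \<le> p3" "0 \<le> p4" for p1 p2 p3 p4 z
            using that by (simp add: ennreal_mult_mult mult.assoc)
          show ?thesis
            using c by (simp only: distrib_left m4 k exp_ge_zero less_imp_le divide_nonneg_pos)
        qed
        also have "\<dots> \<le> ennreal 1 * x' + ennreal (exp t) * y'"
        proof (intro add_mono mult_right_mono ennreal_leI)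
          have "\<theta> * u \<le> \<bar>u\<bar>" "- (1 - \<theta>) * u \<le> \<bar>u\<bar>"
            using \<theta> mult_right_mono[of \<theta> 1 u] mult_nonneg_nonpos[of \<theta> u] mult_right_mono_neg[of \<theta> 1 u]
               mult_nonneg_nonneg[of \<theta> u] by (cases "0 \<le> u"; simp add: algebra_simps; linarith)+
          moreover have "\<theta> * t - \<bar>u\<bar> + k * \<alpha> - k * \<alpha>0 = \<theta> * u - \<bar>u\<bar>"
            "\<theta> * t - \<bar>u\<bar> + k * \<alpha> - k * \<alpha>1 = t + (- (1 - \<theta>) * u - \<bar>u\<bar>)"
            by (simp_all add: a0 a1 t algebra_simps)
          ultimately show "exp (\<theta> * t - \<bar>u\<bar> + k * \<alpha> - k * \<alpha>0) \<le> 1"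
            "exp (\<theta> * t - \<bar>u\<bar> + k * \<alpha> - k * \<alpha>1) \<le> exp t" by simp_all
        qed auto
        also have "\<dots> \<le> x + ennreal (exp t) * y"
          using le by (intro add_mono mult_left_mono) auto
        finally show "ennreal (exp (\<theta> * t - \<bar>u\<bar>) / c) * \<beta> k \<le> x + ennreal (exp t) * y" .
      qed
      then have "ennreal (c * exp (- \<theta> * t)) * (ennreal (exp (\<theta> * t - \<bar>u\<bar>) / c) * \<beta> k) \<le> ennreal (c * exp (- \<theta> * t)) * Kf (lq_couple I q0 q1 G) t"
        by (rule mult_left_mono) simp
      moreover have "c * exp (- \<theta> * t) * (exp (\<theta> * t - \<bar>u\<bar>) / c) = exp (- \<bar>u\<bar>)"
        using c by (simp flip: exp_add)
      ultimately show "ennreal (exp (- \<bar>t - real_of_int k * \<delta>\<bar>)) * \<beta> k \<le> ennreal c * (ennreal (exp (- \<theta> * t)) * Kf (lq_couple I q0 q1 G) t)"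
        using c by (simp add: ennreal_mult_mult flip: u_def)
    qed measurable
    also have "enorm lborel q (\<lambda>t. ennreal c * (ennreal (exp (- \<theta> * t)) * Kf (lq_couple I q0 q1 G) t)) = ennreal c * inorm (lq_couple I q0 q1 G) \<theta> q"
      unfolding inorm_def using q by (intro enorm_cmult) auto
    also have "ennreal B * (ennreal c * inorm (lq_couple I q0 q1 G) \<theta> q) = ennreal (B * c) * inorm (lq_couple I q0 q1 G) \<theta> q"
      using B c by (intro ennreal_mult_mult) auto
    also have "\<dots> \<le> ennreal (max (2 * A) (B * c)) * inorm (lq_couple I q0 q1 G) \<theta> q"
      by (intro mult_right_mono ennreal_leI) auto
    finally show "enorm (count_space I) q (\<lambda>k. ennreal (exp (k * \<alpha>)) * b k) \<le>
       ennreal (max (2 * A) (B * c)) * inorm (lq_couple I q0 q1 G) \<theta> q"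
      unfolding \<beta>_def .
  qed (use A in simp)
qed

section \<open>Decreasing rearrangements\<close>

lemma rearrangement_le:
  "0 < l \<Longrightarrow> emeasure M {x \<in> space M. l < norm (f x)} \<le> ennreal t \<Longrightarrow> rearrangement M f t \<le> ennreal l"
  unfolding rearrangement_def by (rule INF_lower) auto

lemma rearrangement_lessD:
  assumes "rearrangement M f t < c"
  obtains l where "0 < l" "emeasure M {x \<in> space M. l < norm (f x)} \<le> ennreal t" "ennreal l < c"
  using assms unfolding rearrangement_def INF_less_iff by auto

lemma rearrangement_antimono: "s \<le> t \<Longrightarrow> rearrangement M f t \<le> rearrangement M f s"
  unfolding rearrangement_def by (rule INF_superset_mono) (auto intro: order_trans ennreal_leI)

lemma rearrangement_measurable [measurable]: "rearrangement M f \<in> borel_measurable borel"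
  by (rule borel_measurable_antimono_ennreal) (rule rearrangement_antimono)

lemma rearrangement_mono:
  assumes "\<And>l. 0 < l \<Longrightarrow> emeasure M {x \<in> space M. l < norm (f x)} \<le> emeasure N {x \<in> space N. l < norm (g x)}"
  shows "rearrangement M f t \<le> rearrangement N g t"
  unfolding rearrangement_def using assms by (intro INF_superset_mono) (auto intro: order_trans)

lemma rearrangement_cong:
  assumes "\<And>l. 0 < l \<Longrightarrow> emeasure M {x \<in> space M. l < norm (f x)} = emeasure N {x \<in> space N. l < norm (g x)}"
  shows "rearrangement M f t = rearrangement N g t"
  by (intro antisym rearrangement_mono) (simp_all add: assms)

lemma norm_superlevel_measurable [measurable]:
  fixes f :: "'a \<Rightarrow> 'b::real_normed_vector"
  assumes [measurable]: "f \<in> borel_measurable M"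
  shows "{x \<in> space M. l < norm (f x)} \<in> sets M"
proof -
  have "(\<lambda>x. norm (f x)) \<in> borel_measurable M"
    by measurable
  then show ?thesis by measurable
qed

text \<open>If \<open>f\<close> exceeds \<open>l\<close> only on measure \<open>s\<close>, and \<open>g\<close> exceeds \<open>m\<close> only on measure \<open>t\<close>, then \<open>f + g\<close> exceeds
  \<open>l + m\<close> only on measure \<open>s + t\<close>.\<close>

lemma rearrangement_add_le:
  fixes f g h :: "'a \<Rightarrow> 'b::real_normed_vector"
  assumes [measurable]: "f \<in> borel_measurable M" "g \<in> borel_measurable M"
    and h: "AE x in M. h x = f x + g x" and st: "0 \<le> s" "0 \<le> t"
  shows "rearrangement M h (s + t) \<le> rearrangement M f s + rearrangement M g t"
proof (rule ennreal_le_epsilon)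
  fix e :: real assume fin: "rearrangement M f s + rearrangement M g t < top" and e: "0 < e"
  have "rearrangement M f s < rearrangement M f s + ennreal (e / 2)"
    "rearrangement M g t < rearrangement M g t + ennreal (e / 2)"
    using fin e by (auto simp: less_top intro!: ennreal_lessI)
  obtain l where l: "0 < l" "emeasure M {x \<in> space M. l < norm (f x)} \<le> ennreal s" "ennreal l < rearrangement M f s + ennreal (e / 2)"
    by (rule rearrangement_lessD[OF \<open>rearrangement M f s < rearrangement M f s + ennreal (e / 2)\<close>])
  obtain m where m: "0 < m" "emeasure M {x \<in> space M. m < norm (g x)} \<le> ennreal t" "ennreal m < rearrangement M g t + ennreal (e / 2)"
    by (rule rearrangement_lessD[OF \<open>rearrangement M g t < rearrangement M g t + ennreal (e / 2)\<close>])
  let ?A = "{x \<in> space M. l < norm (f x)}" and ?B = "{x \<in> space M. m < norm (g x)}"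
  have "AE x in M. x \<in> {x \<in> space M. l + m < norm (h x)} \<longrightarrow> x \<in> ?A \<union> ?B"
    using h
  proof eventually_elim
    case (elim x)
    then show ?case using norm_triangle_ineq[of "f x" "g x"] by auto
  qed
  then have "emeasure M {x \<in> space M. l + m < norm (h x)} \<le> emeasure M (?A \<union> ?B)"
    by (rule emeasure_mono_AE) simp
  also have "\<dots> \<le> emeasure M ?A + emeasure M ?B"
    by (rule emeasure_subadditive) auto
  also have "\<dots> \<le> ennreal s + ennreal t" using l m by (intro add_mono)
  also have "\<dots> = ennreal (s + t)" using st by simp
  finally have "rearrangement M h (s + t) \<le> ennreal (l + m)"
    using l m by (intro rearrangement_le) auto
  also have "\<dots> = ennreal l + ennreal m" using l m by simp
  also have "\<dots> \<le> (rearrangement M f s + ennreal (e / 2)) + (rearrangement M g t + ennreal (e / 2))"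
    using l m by (intro add_mono) (auto intro: less_imp_le)
  also have "\<dots> = rearrangement M f s + rearrangement M g t + (ennreal (e / 2) + ennreal (e / 2))"
    by (simp only: ac_simps)
  also have "ennreal (e / 2) + ennreal (e / 2) = ennreal e"
    using e by (simp flip: ennreal_plus)
  finally show "rearrangement M h (s + t) \<le> rearrangement M f s + rearrangement M g t + ennreal e" .
qed

text \<open>Right-continuity of the distribution function: the strict superlevel set at \<open>f\<^sup>*(t)\<close> is the
  increasing union of the superlevel sets at \<open>f\<^sup>*(t) + 1/n\<close>.\<close>

lemma emeasure_above_rearrangement:
  fixes f :: "'a \<Rightarrow> 'b::real_normed_vector"
  assumes [measurable]: "f \<in> borel_measurable M"
  shows "emeasure M {x \<in> space M. rearrangement M f t < ennreal (norm (f x))} \<le> ennreal t"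
proof (cases "rearrangement M f t")
  case (real c)
  let ?A = "\<lambda>n::nat. {x \<in> space M. c + 1 / real (Suc n) < norm (f x)}"
  have "emeasure M (?A n) \<le> ennreal t" for n
  proof -
    have "rearrangement M f t < ennreal (c + 1 / real (Suc n))"
      using real by (simp add: ennreal_less_iff)
    then obtain l where l: "0 < l" "emeasure M {x \<in> space M. l < norm (f x)} \<le> ennreal t" "ennreal l < ennreal (c + 1 / real (Suc n))"
      by (rule rearrangement_lessD)
    then have "l < c + 1 / real (Suc n)" by (simp add: ennreal_less_iff)
    then have "?A n \<subseteq> {x \<in> space M. l < norm (f x)}" by auto
    then have "emeasure M (?A n) \<le> emeasure M {x \<in> space M. l < norm (f x)}"
      by (rule emeasure_mono) simp
    then show ?thesis using l(2) by simp
  qed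
  moreover have "{x \<in> space M. rearrangement M f t < ennreal (norm (f x))} = (\<Union>n. ?A n)"
  proof (intro equalityI subsetI)
    fix x assume x: "x \<in> {x \<in> space M. rearrangement M f t < ennreal (norm (f x))}"
    then have "0 < norm (f x) - c" using real by (simp add: ennreal_less_iff)
    then obtain n :: nat where "1 / real (Suc n) < norm (f x) - c"
      using nat_approx_posE by blast
    then have "c + 1 / real (Suc n) < norm (f x)" by linarith
    then show "x \<in> (\<Union>n. ?A n)" using x by blast
  next
    fix x assume "x \<in> (\<Union>n. ?A n)"
    then obtain n where n: "x \<in> space M" "c + 1 / real (Suc n) < norm (f x)" by auto
    have "0 < 1 / real (Suc n)" by simp
    then have "c < norm (f x)" using n(2) by linarith
    then show "x \<in> {x \<in> space M. rearrangement M f t < ennreal (norm (f x))}"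
      using n real by (simp add: ennreal_less_iff)
  qed
  moreover have "incseq ?A"
    by (rule incseq_SucI) (auto elim!: le_less_trans[rotated] intro!: divide_left_mono)
  then have "(SUP n. emeasure M (?A n)) = emeasure M (\<Union>n. ?A n)"
    by (intro SUP_emeasure_incseq) auto
  ultimately show ?thesis by (metis (no_types, lifting) SUP_least)
qed simp

lemma rearrangement_le_iff:
  fixes f :: "'a \<Rightarrow> 'b::real_normed_vector"
  assumes [measurable]: "f \<in> borel_measurable M" and "0 < l"
  shows "rearrangement M f t \<le> ennreal l \<longleftrightarrow> emeasure M {x \<in> space M. l < norm (f x)} \<le> ennreal t"
proof
  assume le: "rearrangement M f t \<le> ennreal l"
  have "emeasure M {x \<in> space M. l < norm (f x)} \<le> emeasure M {x \<in> space M. rearrangement M f t < ennreal (norm (f x))}"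
    using le assms(2) by (intro emeasure_mono) (auto intro!: le_less_trans[OF le] ennreal_lessI)
  also have "\<dots> \<le> ennreal t" by (rule emeasure_above_rearrangement) simp
  finally show "emeasure M {x \<in> space M. l < norm (f x)} \<le> ennreal t" .
qed (use assms in \<open>auto intro: rearrangement_le\<close>)

text \<open>Truncation at an extended height, since \<open>f\<^sup>*(t)\<close> may be infinite. The inequality is strict because only
  the strict superlevel set at \<open>f\<^sup>*(t)\<close> is known to have measure at most \<open>t\<close>.\<close>

definition upper_part :: "ennreal \<Rightarrow> ('a \<Rightarrow> 'b::real_normed_vector) \<Rightarrow> 'a \<Rightarrow> 'b" where
  "upper_part l f x = (if l < ennreal (norm (f x)) then f x else 0)"

definition lower_part :: "ennreal \<Rightarrow> ('a \<Rightarrow> 'b::real_normed_vector) \<Rightarrow> 'a \<Rightarrow> 'b" where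
  "lower_part l f x = (if l < ennreal (norm (f x)) then 0 else f x)"

lemma rearrangement_upper_part_le:
  fixes f :: "'a \<Rightarrow> 'b::real_normed_vector"
  assumes [measurable]: "f \<in> borel_measurable M"
  shows "rearrangement M (upper_part (rearrangement M f s) f) t \<le> (if t \<le> s then rearrangement M f t else 0)"
proof (cases "t \<le> s")
  case True
  have "rearrangement M (upper_part (rearrangement M f s) f) t \<le> rearrangement M f t"
    by (rule rearrangement_mono, rule emeasure_mono) (auto simp: upper_part_def split: if_splits)
  then show ?thesis using True by simp
next
  case False
  have "rearrangement M (upper_part (rearrangement M f s) f) t \<le> 0 + ennreal e" if "0 < e" for e
  proof -
    have "emeasure M {x \<in> space M. e < norm (upper_part (rearrangement M f s) f x)}
      \<le> emeasure M {x \<in> space M. rearrangement M f s < ennreal (norm (f x))}"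
      using that by (intro emeasure_mono) (auto simp: upper_part_def split: if_splits)
    also have "\<dots> \<le> ennreal s" by (rule emeasure_above_rearrangement) simp
    also have "\<dots> \<le> ennreal t" using False by (intro ennreal_leI) auto
    finally show ?thesis using that by (auto intro: rearrangement_le)
  qed
  then have "rearrangement M (upper_part (rearrangement M f s) f) t \<le> 0"
    by (rule ennreal_le_epsilon)
  then show ?thesis using False by simp
qed

lemma rearrangement_lower_part_le:
  fixes f :: "'a \<Rightarrow> 'b::real_normed_vector"
  assumes [measurable]: "f \<in> borel_measurable M"
  shows "rearrangement M (lower_part l f) t \<le> min (rearrangement M f t) l"
proof (rule min.boundedI)
  show "rearrangement M (lower_part l f) t \<le> rearrangement M f t"
    by (rule rearrangement_mono, rule emeasure_mono) (auto simp: lower_part_def split: if_splits)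
  show "rearrangement M (lower_part l f) t \<le> l"
  proof (rule ennreal_le_epsilon)
    fix e :: real assume "l < top" "0 < e"
    then obtain c where c: "l = ennreal c" "0 \<le> c" by (cases l) auto
    have "{x \<in> space M. c + e < norm (lower_part l f x)} = {}"
      using \<open>0 < e\<close> c by (auto simp: lower_part_def ennreal_less_iff split: if_splits)
    then have "emeasure M {x \<in> space M. c + e < norm (lower_part l f x)} = 0" by (simp only: emeasure_empty)
    then have "rearrangement M (lower_part l f) t \<le> ennreal (c + e)"
      using \<open>0 < e\<close> c by (intro rearrangement_le) simp_all
    then show "rearrangement M (lower_part l f) t \<le> l + ennreal e" using c \<open>0 < e\<close> by simp
  qed
qed

section \<open>Lorentz quasi-norms\<close>

text \<open>The Lorentz quasi-norm in logarithmic coordinates, with \<open>\<alpha>\<close> in place of \<open>1/p\<close>, so that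
  \<open>\<alpha> = 0\<close> stands for \<open>p = \<infinity>\<close>.\<close>

definition lnorm :: "'a measure \<Rightarrow> real \<Rightarrow> ennreal \<Rightarrow> ('a \<Rightarrow> 'b::real_normed_vector) \<Rightarrow> ennreal" where
  "lnorm M \<alpha> r f = enorm lborel r (\<lambda>x. ennreal (exp (\<alpha> * x)) * rearrangement M f (exp x))"

lemma lorentz_norm_eq_lnorm:
  assumes "0 < r"
  shows "lorentz_norm M p r f = lnorm M (enn2real (inverse p)) r f"
proof -
  define \<alpha> where "\<alpha> = enn2real (inverse p)"
  have e: "exp x powr \<alpha> = exp (\<alpha> * x)" for x :: real by (simp add: powr_def)
  show ?thesis
    using assms
  proof (cases rule: exponent_cases)
    case 1
    have "{0<..} = range (exp :: real \<Rightarrow> real)"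
      by (auto simp: image_iff) (metis exp_ln)
    then show ?thesis
      unfolding lorentz_norm_def lnorm_def enorm_def \<alpha>_def[symmetric] using 1
      by (simp add: image_image e)
  next
    case (2 s)
    have "(\<integral>\<^sup>+t\<in>{0<..}. (ennreal (t powr \<alpha>) * rearrangement M f t) epowr s * ennreal (1 / t) \<partial>lborel)
      = (\<integral>\<^sup>+x. (ennreal (exp x powr \<alpha>) * rearrangement M f (exp x)) epowr s \<partial>lborel)"
      by (rule nn_integral_dt_over_t) measurable
    then show ?thesis
      unfolding lorentz_norm_def lnorm_def enorm_def \<alpha>_def[symmetric] using 2
      by (simp add: e)
  qed
qed

lemma antimono_rearrangement_exp: "x \<le> y \<Longrightarrow> rearrangement M f (exp y) \<le> rearrangement M f (exp x)"
  by (rule rearrangement_antimono) simp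

text \<open>For a decreasing function, the value at \<open>x\<close> is controlled by an average over the half-line to the left of \<open>x\<close>;
  this gives the inclusion of the Lorentz spaces into the weak ones.\<close>

lemma weak_type_bound:
  fixes H :: "real \<Rightarrow> ennreal"
  assumes H: "\<And>x y. x \<le> y \<Longrightarrow> H y \<le> H x" and "0 < \<alpha>" "0 < s"
  shows "ennreal (exp (\<alpha> * x)) * H x
    \<le> ennreal ((s * \<alpha>) powr (1 / s)) * (\<integral>\<^sup>+u. (ennreal (exp (\<alpha> * u)) * H u) epowr s * indicator {..x} u \<partial>lborel) epowr (1 / s)"
proof -
  have "ennreal (1 / (s * \<alpha>)) * (ennreal (exp (\<alpha> * x)) * H x) epowr s
    = (\<integral>\<^sup>+u. H x epowr s * (ennreal (exp (s * \<alpha> * u)) * indicator {..x} u) \<partial>lborel)"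
    using assms(2,3)
    by (subst nn_integral_cmult, simp, subst nn_integral_exp_atMost)
      (simp_all add: epowr_mult epowr_exp ennreal_mult_mult mult_ac divide_inverse flip: ennreal_mult)
  also have "\<dots> \<le> (\<integral>\<^sup>+u. (ennreal (exp (\<alpha> * u)) * H u) epowr s * indicator {..x} u \<partial>lborel)" (is "_ \<le> ?I")
  proof (rule nn_integral_mono)
    fix u
    have "H x epowr s * ennreal (exp (s * \<alpha> * u)) \<le> (ennreal (exp (\<alpha> * u)) * H u) epowr s" if "u \<le> x"
      using H[OF that] assms(2,3)
      by (subst mult.commute) (auto simp: epowr_mult epowr_exp mult.assoc intro!: mult_left_mono epowr_mono)
    then show "H x epowr s * (ennreal (exp (s * \<alpha> * u)) * indicator {..x} u)
      \<le> (ennreal (exp (\<alpha> * u)) * H u) epowr s * indicator {..x} u"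
      by (auto split: split_indicator)
  qed
  finally have "(ennreal (exp (\<alpha> * x)) * H x) epowr s \<le> ennreal (1 / (1 / (s * \<alpha>))) * ?I"
    using assms by (intro ennreal_le_divide) auto
  then have "((ennreal (exp (\<alpha> * x)) * H x) epowr s) epowr (1 / s) \<le> (ennreal (s * \<alpha>) * ?I) epowr (1 / s)"
    using assms by (intro epowr_mono) auto
  also have "\<dots> = ennreal ((s * \<alpha>) powr (1 / s)) * ?I epowr (1 / s)"
    using assms(2,3) by (subst epowr_mult) (simp_all add: epowr_ennreal)
  finally show ?thesis using assms(3) by (subst (asm) epowr_inverse_cancel) simp_all
qed

lemma weak_type_enorm:
  fixes H :: "real \<Rightarrow> ennreal"
  assumes "0 < r" "0 \<le> \<alpha>" "\<alpha> = 0 \<longrightarrow> r = top"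
  shows "\<exists>C>0. \<forall>H x. (\<forall>x y. x \<le> y \<longrightarrow> H y \<le> H x) \<longrightarrow>
     ennreal (exp (\<alpha> * x)) * H x \<le> ennreal C * enorm lborel r (\<lambda>u. ennreal (exp (\<alpha> * u)) * H u)"
  using assms(1)
proof (cases rule: exponent_cases)
  case 1
  then show ?thesis by (intro exI[of _ 1]) (auto simp: enorm_def intro!: SUP_upper)
next
  case (2 s)
  then have \<alpha>: "0 < \<alpha>" using assms by auto
  show ?thesis
  proof (intro exI[of _ "(s * \<alpha>) powr (1 / s)"] conjI allI impI)
    fix H :: "real \<Rightarrow> ennreal" and x assume H: "\<forall>x y. x \<le> y \<longrightarrow> H y \<le> H x"
    have "ennreal (exp (\<alpha> * x)) * H x
      \<le> ennreal ((s * \<alpha>) powr (1 / s)) * (\<integral>\<^sup>+u. (ennreal (exp (\<alpha> * u)) * H u) epowr s * indicator {..x} u \<partial>lborel) epowr (1 / s)"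
      using H \<alpha> 2 by (intro weak_type_bound) auto
    also have "\<dots> \<le> ennreal ((s * \<alpha>) powr (1 / s)) * (\<integral>\<^sup>+u. (ennreal (exp (\<alpha> * u)) * H u) epowr s \<partial>lborel) epowr (1 / s)"
      using 2 by (intro mult_left_mono epowr_mono nn_integral_mono) (auto split: split_indicator)
    finally show "ennreal (exp (\<alpha> * x)) * H x \<le> ennreal ((s * \<alpha>) powr (1 / s)) * enorm lborel r (\<lambda>u. ennreal (exp (\<alpha> * u)) * H u)"
      using 2 by (simp add: enorm_ennreal)
  qed (use 2 \<alpha> in simp)
qed

lemma lorentz_embedding:
  assumes "0 < \<alpha>" "0 < s" "ennreal s \<le> r"
  shows "\<exists>C>0. \<forall>H. (\<forall>x y. x \<le> y \<longrightarrow> H y \<le> H x) \<longrightarrow>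
     enorm lborel r (\<lambda>u. ennreal (exp (\<alpha> * u)) * H u) \<le> ennreal C * enorm lborel (ennreal s) (\<lambda>u. ennreal (exp (\<alpha> * u)) * H u)"
proof -
  have p: "0 < ennreal s" "0 \<le> \<alpha>" "\<alpha> = 0 \<longrightarrow> ennreal s = top" using assms by auto
  obtain A where weak: "\<And>H x. (\<And>x y. x \<le> y \<Longrightarrow> H y \<le> H x) \<Longrightarrow>
     ennreal (exp (\<alpha> * x)) * H x \<le> ennreal A * enorm lborel (ennreal s) (\<lambda>u. ennreal (exp (\<alpha> * u)) * H u)"
    using weak_type_enorm[OF p] by blast
  show ?thesis
  proof (intro exI[of _ "max 1 A"] conjI allI impI)
    fix H :: "real \<Rightarrow> ennreal" assume H: "\<forall>x y. x \<le> y \<longrightarrow> H y \<le> H x"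
    have [measurable]: "H \<in> borel_measurable borel"
      by (rule borel_measurable_antimono_ennreal) (use H in auto)
    show "enorm lborel r (\<lambda>u. ennreal (exp (\<alpha> * u)) * H u)
      \<le> ennreal (max 1 A) * enorm lborel (ennreal s) (\<lambda>u. ennreal (exp (\<alpha> * u)) * H u)"
    proof (rule enorm_le_of_pointwise_bound[OF _ _ assms(2,3)])
      fix x
      have "ennreal (exp (\<alpha> * x)) * H x \<le> ennreal A * enorm lborel (ennreal s) (\<lambda>u. ennreal (exp (\<alpha> * u)) * H u)"
        using H by (intro weak) auto
      also have "\<dots> \<le> ennreal (max 1 A) * enorm lborel (ennreal s) (\<lambda>u. ennreal (exp (\<alpha> * u)) * H u)"
        by (intro mult_right_mono ennreal_leI) auto
      finally show "ennreal (exp (\<alpha> * x)) * H x \<le> \<dots>" .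
    qed auto
  qed simp
qed

section \<open>Interpolation of Lorentz spaces\<close>

text \<open>At every point, \<open>f\<^sup>*(t) \<le> f\<^sub>0\<^sup>*(t/2) + f\<^sub>1\<^sup>*(t/2)\<close> and the weak-type bounds of \<open>f\<^sub>0\<close> and \<open>f\<^sub>1\<close> give
  \<open>t\<^sup>\<alpha>\<^sup>0 f\<^sup>*(t) \<le> B K(t\<^sup>\<delta>)\<close> with \<open>\<delta> = \<alpha>0 - \<alpha>1\<close>; in logarithmic coordinates the change of variable is
  linear.\<close>

theorem lorentz_interpolation_lower:
  assumes \<delta>: "\<alpha>0 \<noteq> \<alpha>1" and \<alpha>: "\<alpha> = (1 - \<theta>) * \<alpha>0 + \<theta> * \<alpha>1" and q: "0 < q"
    and r0: "0 < r0" "0 \<le> \<alpha>0" "\<alpha>0 = 0 \<longrightarrow> r0 = top" and r1: "0 < r1" "0 \<le> \<alpha>1" "\<alpha>1 = 0 \<longrightarrow> r1 = top"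
  shows "\<exists>C>0. \<forall>(f :: 'a \<Rightarrow> 'b::real_normed_vector) G. (\<forall>(u, v)\<in>G. \<exists>f0\<in>borel_measurable M. \<exists>f1\<in>borel_measurable M.
      (AE x in M. f x = f0 x + f1 x) \<and> u = lnorm M \<alpha>0 r0 f0 \<and> v = lnorm M \<alpha>1 r1 f1) \<longrightarrow>
    lnorm M \<alpha> q f \<le> ennreal C * inorm G \<theta> q"
proof -
  define \<delta> where "\<delta> = \<alpha>0 - \<alpha>1"
  have \<delta>: "\<delta> \<noteq> 0" using assms(1) by (simp add: \<delta>_def)
  have \<alpha>': "\<alpha> = \<alpha>0 - \<theta> * \<delta>" by (simp add: \<alpha> \<delta>_def algebra_simps)
  obtain A0 where A0: "0 < A0" "\<And>H x. (\<And>x y. x \<le> y \<Longrightarrow> H y \<le> H x) \<Longrightarrow>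
     ennreal (exp (\<alpha>0 * x)) * H x \<le> ennreal A0 * enorm lborel r0 (\<lambda>u. ennreal (exp (\<alpha>0 * u)) * H u)"
    using weak_type_enorm[OF r0] by blast
  obtain A1 where A1: "0 < A1" "\<And>H x. (\<And>x y. x \<le> y \<Longrightarrow> H y \<le> H x) \<Longrightarrow>
     ennreal (exp (\<alpha>1 * x)) * H x \<le> ennreal A1 * enorm lborel r1 (\<lambda>u. ennreal (exp (\<alpha>1 * u)) * H u)"
    using weak_type_enorm[OF r1] by blast
  define B where "B = max (exp (\<alpha>0 * ln 2) * A0) (exp (\<alpha>1 * ln 2) * A1)"
  have B: "0 < B" using A0 by (simp add: B_def less_max_iff_disj)
  define D where "D = \<bar>\<delta>\<bar> powr (1 / enn2real q)"
  have D: "0 < D" using \<delta> by (simp add: D_def)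
  show ?thesis
  proof (intro exI[of _ "B * (1 / D)"] conjI allI impI)
    fix f :: "'a \<Rightarrow> 'b" and G
    assume G: "\<forall>(u, v)\<in>G. \<exists>f0\<in>borel_measurable M. \<exists>f1\<in>borel_measurable M.
      (AE x in M. f x = f0 x + f1 x) \<and> u = lnorm M \<alpha>0 r0 f0 \<and> v = lnorm M \<alpha>1 r1 f1"
    have *: "ennreal (exp (\<alpha>0 * x)) * rearrangement M f (exp x) \<le> ennreal B * Kf G (\<delta> * x)" for x
    proof -
      have "ennreal (1 / B) * (ennreal (exp (\<alpha>0 * x)) * rearrangement M f (exp x)) \<le> Kf G (\<delta> * x)"
      proof (rule Kf_ge)
        fix u v assume "(u, v) \<in> G"
        then obtain f0 f1 where f: "f0 \<in> borel_measurable M" "f1 \<in> borel_measurable M" "AE x in M. f x = f0 x + f1 x"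
          and u: "u = lnorm M \<alpha>0 r0 f0" and v: "v = lnorm M \<alpha>1 r1 f1"
          using G by blast
        \<comment> \<open>\<open>exp ?y\<close> is half of \<open>exp x\<close>.\<close>
        let ?y = "x - ln 2"
        have y: "exp ?y + exp ?y = exp x" by (simp add: exp_diff)
        have 0: "rearrangement M f0 (exp ?y) \<le> ennreal (exp (- (\<alpha>0 * ?y))) * (ennreal A0 * u)"
          using A0(2)[of "\<lambda>x. rearrangement M f0 (exp x)" ?y]
          by (simp add: le_mult_exp_iff u lnorm_def antimono_rearrangement_exp)
        have 1: "rearrangement M f1 (exp ?y) \<le> ennreal (exp (- (\<alpha>1 * ?y))) * (ennreal A1 * v)"
          using A1(2)[of "\<lambda>x. rearrangement M f1 (exp x)" ?y]
          by (simp add: le_mult_exp_iff v lnorm_def antimono_rearrangement_exp)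
        have "rearrangement M f (exp x) \<le> rearrangement M f0 (exp ?y) + rearrangement M f1 (exp ?y)"
          using rearrangement_add_le[OF f, of "exp ?y" "exp ?y"] y by simp
        also have "\<dots> \<le> ennreal (exp (- (\<alpha>0 * ?y))) * (ennreal A0 * u) + ennreal (exp (- (\<alpha>1 * ?y))) * (ennreal A1 * v)"
          by (rule add_mono[OF 0 1])
        finally have "ennreal (exp (\<alpha>0 * x)) * rearrangement M f (exp x) \<le>
            ennreal (exp (\<alpha>0 * x)) * (ennreal (exp (- (\<alpha>0 * ?y))) * (ennreal A0 * u) + ennreal (exp (- (\<alpha>1 * ?y))) * (ennreal A1 * v))"
          by (rule mult_left_mono) simp
        also have "\<dots> = ennreal (exp (\<alpha>0 * ln 2)) * (ennreal A0 * u) + ennreal (exp (\<delta> * x + \<alpha>1 * ln 2)) * (ennreal A1 * v)"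
          unfolding distrib_left ennreal_exp_mult by (simp add: \<delta>_def algebra_simps)
        also have "\<dots> = ennreal (exp (\<alpha>0 * ln 2)) * (ennreal A0 * u) + ennreal (exp (\<alpha>1 * ln 2)) * (ennreal A1 * (ennreal (exp (\<delta> * x)) * v))"
          by (simp add: exp_add ennreal_mult ac_simps)
        also have "\<dots> = ennreal (exp (\<alpha>0 * ln 2) * A0) * u + ennreal (exp (\<alpha>1 * ln 2) * A1) * (ennreal (exp (\<delta> * x)) * v)"
          using A0(1) A1(1) by (simp add: ennreal_mult mult.assoc)
        also have "\<dots> \<le> ennreal B * u + ennreal B * (ennreal (exp (\<delta> * x)) * v)"
          by (intro add_mono mult_right_mono ennreal_leI) (auto simp: B_def)
        also have "\<dots> = ennreal (1 / (1 / B)) * (u + ennreal (exp (\<delta> * x)) * v)"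
          by (simp add: distrib_left)
        finally have "ennreal (1 / B) * (ennreal (exp (\<alpha>0 * x)) * rearrangement M f (exp x))
          \<le> ennreal (1 / B) * (ennreal (1 / (1 / B)) * (u + ennreal (exp (\<delta> * x)) * v))"
          by (rule mult_left_mono) simp
        also have "\<dots> = u + ennreal (exp (\<delta> * x)) * v"
          using B by (simp add: ennreal_mult_mult)
        finally show "ennreal (1 / B) * (ennreal (exp (\<alpha>0 * x)) * rearrangement M f (exp x)) \<le> u + ennreal (exp (\<delta> * x)) * v" .
      qed
      from ennreal_le_divide[OF _ this] B show ?thesis by simp
    qed
    have "lnorm M \<alpha> q f \<le> enorm lborel q (\<lambda>x. ennreal B * (ennreal (exp (- \<theta> * (0 + \<delta> * x))) * Kf G (0 + \<delta> * x)))"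
      unfolding lnorm_def
    proof (rule enorm_mono[OF q])
      fix x
      have "ennreal (exp (\<alpha> * x)) * rearrangement M f (exp x)
          = ennreal (exp (- \<theta> * (\<delta> * x))) * (ennreal (exp (\<alpha>0 * x)) * rearrangement M f (exp x))"
        unfolding ennreal_exp_mult by (simp add: \<alpha>' algebra_simps)
      also have "\<dots> \<le> ennreal (exp (- \<theta> * (\<delta> * x))) * (ennreal B * Kf G (\<delta> * x))"
        by (rule mult_left_mono[OF *]) simp
      finally show "ennreal (exp (\<alpha> * x)) * rearrangement M f (exp x)
        \<le> ennreal B * (ennreal (exp (- \<theta> * (0 + \<delta> * x))) * Kf G (0 + \<delta> * x))"
        by (simp add: ac_simps)
    qed
    also have "\<dots> = ennreal B * enorm lborel q (\<lambda>x. ennreal (exp (- \<theta> * (0 + \<delta> * x))) * Kf G (0 + \<delta> * x))"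
      using q by (intro enorm_cmult) auto
    also have "enorm lborel q (\<lambda>x. ennreal (exp (- \<theta> * (0 + \<delta> * x))) * Kf G (0 + \<delta> * x)) \<le> ennreal (1 / D) * inorm G \<theta> q"
      unfolding inorm_def D_def
      by (rule ennreal_le_divide, use \<delta> in simp, subst (2) enorm_lborel_affine[where c=\<delta> and t=0]) (use \<delta> q in auto)
    finally have "lnorm M \<alpha> q f \<le> ennreal B * (ennreal (1 / D) * inorm G \<theta> q)"
      by (simp add: mult_left_mono)
    then show "lnorm M \<alpha> q f \<le> ennreal (B * (1 / D)) * inorm G \<theta> q"
      using B D by (subst (asm) ennreal_mult_mult) auto
  qed (use B D in simp)
qed

text \<open>The norm of the lower part of \<open>f\<close> cut at \<open>f\<^sup>*(exp x)\<close>: the constant piece to the left of \<open>x\<close> and the tail to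
  the right of \<open>x\<close>. For \<open>\<alpha>1 = 0\<close> the norm is a supremum, attained on the constant piece.\<close>

lemma truncated_power_weight_bound:
  assumes s: "0 < s" "ennreal s \<le> r1" and r1: "0 \<le> \<alpha>1" "\<alpha>1 = 0 \<longrightarrow> r1 = top"
  shows "\<exists>A1>0. \<forall>F x. (\<forall>x y. x \<le> y \<longrightarrow> F y \<le> F x) \<longrightarrow>
     enorm lborel r1 (\<lambda>u. ennreal (exp (\<alpha>1 * u)) * min (F u) (F x)) epowr s
      \<le> ennreal A1 * (ennreal (exp (s * \<alpha>1 * x)) * F x epowr s +
           (\<integral>\<^sup>+u. ennreal (exp (s * \<alpha>1 * u)) * F u epowr s * indicator {x..} u \<partial>lborel))"
proof (cases "\<alpha>1 = 0")
  case True
  then have "r1 = top" using r1 by simp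
  show ?thesis
  proof (intro exI[of _ 1] conjI allI impI)
    fix F :: "real \<Rightarrow> ennreal" and x
    have "enorm lborel r1 (\<lambda>u. ennreal (exp (\<alpha>1 * u)) * min (F u) (F x)) \<le> F x"
      using True \<open>r1 = top\<close> by (auto simp: enorm_def intro: SUP_least)
    then have "enorm lborel r1 (\<lambda>u. ennreal (exp (\<alpha>1 * u)) * min (F u) (F x)) epowr s \<le> F x epowr s"
      using s by (intro epowr_mono)
    then show "enorm lborel r1 (\<lambda>u. ennreal (exp (\<alpha>1 * u)) * min (F u) (F x)) epowr s
    \<le> ennreal 1 * (ennreal (exp (s * \<alpha>1 * x)) * F x epowr s +
         (\<integral>\<^sup>+u. ennreal (exp (s * \<alpha>1 * u)) * F u epowr s * indicator {x..} u \<partial>lborel))"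
      using True by (simp add: add_increasing2)
  qed simp
next
  case False
  then have \<alpha>1: "0 < \<alpha>1" using r1 by simp
  obtain B where B: "0 < B" "\<And>H. (\<And>x y. x \<le> y \<Longrightarrow> H y \<le> H x) \<Longrightarrow>
   enorm lborel r1 (\<lambda>u. ennreal (exp (\<alpha>1 * u)) * H u) \<le> ennreal B * enorm lborel (ennreal s) (\<lambda>u. ennreal (exp (\<alpha>1 * u)) * H u)"
    using lorentz_embedding[OF \<alpha>1 s] by blast
  define D where "D = max 1 (1 / (s * \<alpha>1))"
  have D: "1 \<le> D" "1 / (s * \<alpha>1) \<le> D" by (simp_all add: D_def)
  show ?thesis
  proof (intro exI[of _ "B powr s * D"] conjI allI impI)
    fix F :: "real \<Rightarrow> ennreal" and x assume F: "\<forall>x y. x \<le> y \<longrightarrow> F y \<le> F x"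
    have [measurable]: "F \<in> borel_measurable borel"
      by (rule borel_measurable_antimono_ennreal) (use F in auto)
    let ?Q = "\<integral>\<^sup>+u. ennreal (exp (s * \<alpha>1 * u)) * F u epowr s * indicator {x..} u \<partial>lborel"
    have "enorm lborel r1 (\<lambda>u. ennreal (exp (\<alpha>1 * u)) * min (F u) (F x)) epowr s
      \<le> (ennreal B * enorm lborel (ennreal s) (\<lambda>u. ennreal (exp (\<alpha>1 * u)) * min (F u) (F x))) epowr s"
      by (intro epowr_mono B s) (use F in \<open>auto intro: min.coboundedI1\<close>)
    also have "\<dots> = ennreal (B powr s) * (\<integral>\<^sup>+u. (ennreal (exp (\<alpha>1 * u)) * min (F u) (F x)) epowr s \<partial>lborel)"
      using B assms(1) by (subst epowr_mult) (simp_all add: enorm_powr epowr_ennreal)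
    also have "(\<integral>\<^sup>+u. (ennreal (exp (\<alpha>1 * u)) * min (F u) (F x)) epowr s \<partial>lborel) \<le>
      (\<integral>\<^sup>+u. F x epowr s * (ennreal (exp (s * \<alpha>1 * u)) * indicator {..x} u) +
         ennreal (exp (s * \<alpha>1 * u)) * F u epowr s * indicator {x..} u \<partial>lborel)"
    proof (rule nn_integral_mono)
      fix u
      have 1: "(ennreal (exp (\<alpha>1 * u)) * min (F u) (F x)) epowr s \<le> ennreal (exp (s * \<alpha>1 * u)) * F x epowr s"
        "(ennreal (exp (\<alpha>1 * u)) * min (F u) (F x)) epowr s \<le> ennreal (exp (s * \<alpha>1 * u)) * F u epowr s"
        using s by (auto simp: epowr_mult epowr_exp mult.assoc intro!: mult_left_mono epowr_mono)
      show "(ennreal (exp (\<alpha>1 * u)) * min (F u) (F x)) epowr s \<le> F x epowr s * (ennreal (exp (s * \<alpha>1 * u)) * indicator {..x} u) +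
         ennreal (exp (s * \<alpha>1 * u)) * F u epowr s * indicator {x..} u"
      proof (cases "u \<le> x")
        case True
        then show ?thesis using 1(1) by (intro add_increasing2) (simp_all add: mult.commute)
      next
        case False
        then show ?thesis using 1(2) by simp
      qed
    qed
    also have "\<dots> = F x epowr s * ennreal (exp (s * \<alpha>1 * x) / (s * \<alpha>1)) + ?Q"
      using s \<alpha>1 by (subst nn_integral_add) (simp_all add: nn_integral_cmult nn_integral_exp_atMost)
    also have "\<dots> = ennreal (1 / (s * \<alpha>1)) * (ennreal (exp (s * \<alpha>1 * x)) * F x epowr s) + ennreal 1 * ?Q"
      using s \<alpha>1 by (subst ennreal_mult_mult) (simp_all add: mult.commute)
    also have "\<dots> \<le> ennreal D * (ennreal (exp (s * \<alpha>1 * x)) * F x epowr s) + ennreal D * ?Q"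
      using D by (intro add_mono mult_right_mono ennreal_leI) auto
    also have "\<dots> = ennreal D * (ennreal (exp (s * \<alpha>1 * x)) * F x epowr s + ?Q)"
      by (simp add: distrib_left)
    also have "ennreal (B powr s) * (ennreal D * (ennreal (exp (s * \<alpha>1 * x)) * F x epowr s + ?Q))
      = ennreal (B powr s * D) * (ennreal (exp (s * \<alpha>1 * x)) * F x epowr s + ?Q)"
      using D by (intro ennreal_mult_mult) auto
    finally show "enorm lborel r1 (\<lambda>u. ennreal (exp (\<alpha>1 * u)) * min (F u) (F x)) epowr s
      \<le> ennreal (B powr s * D) * (ennreal (exp (s * \<alpha>1 * x)) * F x epowr s + ?Q)"
      by (simp add: mult_left_mono)
  qed (use B D in auto)
qed

text \<open>Cut \<open>f\<close> at the height \<open>f\<^sup>*(exp x)\<close>. By the embeddings between Lorentz spaces both pieces may be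
  measured with a small common second exponent \<open>s\<close>: the upper part contributes the integral \<open>P\<close> over
  \<open>u \<le> x\<close>, the lower part the integral \<open>Q\<close> over \<open>u \<ge> x\<close> and the boundary term \<open>T\<close>, which is itself at most a multiple of
  \<open>P\<close> because \<open>f\<^sup>*\<close> decreases. At \<open>\<tau> = \<delta> x\<close> all of them are bounded by an exponential kernel acting on
  \<open>(exp (\<alpha> u) f\<^sup>*(exp u))\<^sup>s\<close>, and the Schur test applies. The order \<open>\<alpha>1 < \<alpha>0\<close> means that the upper part is put
  into the space with the smaller exponent \<open>p\<close>.\<close>

theorem lorentz_interpolation_upper:
  assumes \<theta>: "0 < \<theta>" "\<theta> < 1" and less: "\<alpha>1 < \<alpha>0" and \<alpha>: "\<alpha> = (1 - \<theta>) * \<alpha>0 + \<theta> * \<alpha>1" and q: "0 < q"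
    and r0: "0 < r0" and r1: "0 < r1" "0 \<le> \<alpha>1" "\<alpha>1 = 0 \<longrightarrow> r1 = top"
  shows "\<exists>C>0. \<forall>(f :: 'a \<Rightarrow> 'b::real_normed_vector) G. f \<in> borel_measurable M \<longrightarrow>
      (\<forall>l. (lnorm M \<alpha>0 r0 (upper_part l f), lnorm M \<alpha>1 r1 (lower_part l f)) \<in> G) \<longrightarrow>
    inorm G \<theta> q \<le> ennreal C * lnorm M \<alpha> q f"
proof -
  define \<delta> where "\<delta> = \<alpha>0 - \<alpha>1"
  have \<delta>: "0 < \<delta>" using less by (simp add: \<delta>_def)
  have a0: "\<alpha>0 = \<alpha> + \<theta> * \<delta>" and a1: "\<alpha>1 = \<alpha> - (1 - \<theta>) * \<delta>"
    by (simp_all add: \<alpha> \<delta>_def algebra_simps)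
  have \<alpha>0: "0 < \<alpha>0" using less r1 by simp
  define \<epsilon> where "\<epsilon> = min \<theta> (1 - \<theta>)"
  have \<epsilon>: "0 < \<epsilon>" "\<epsilon> \<le> \<theta>" "\<epsilon> \<le> 1 - \<theta>" using \<theta> by (simp_all add: \<epsilon>_def)
  obtain s where s: "0 < s" "ennreal s \<le> r0" "ennreal s \<le> r1" "ennreal s \<le> q"
    using common_exponent[OF r0 r1(1) q] by blast
  obtain A0 where A0: "0 < A0" "\<And>H. (\<And>x y. x \<le> y \<Longrightarrow> H y \<le> H x) \<Longrightarrow>
     enorm lborel r0 (\<lambda>u. ennreal (exp (\<alpha>0 * u)) * H u) \<le> ennreal A0 * enorm lborel (ennreal s) (\<lambda>u. ennreal (exp (\<alpha>0 * u)) * H u)"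
    using lorentz_embedding[OF \<alpha>0 s(1,2)] by blast
  obtain A1 where A1: "0 < A1" "\<And>F x. (\<And>x y. x \<le> y \<Longrightarrow> F y \<le> F x) \<Longrightarrow>
     enorm lborel r1 (\<lambda>u. ennreal (exp (\<alpha>1 * u)) * min (F u) (F x)) epowr s
      \<le> ennreal A1 * (ennreal (exp (s * \<alpha>1 * x)) * F x epowr s +
           (\<integral>\<^sup>+u. ennreal (exp (s * \<alpha>1 * u)) * F u epowr s * indicator {x..} u \<partial>lborel))"
    using truncated_power_weight_bound[OF s(1,3) r1(2,3)] by blast
  have W: "(\<integral>\<^sup>+x. ennreal (exp (- (\<epsilon> * s) * \<bar>t - \<delta> * x\<bar>)) \<partial>lborel) \<le> ennreal (2 / (\<epsilon> * s * \<bar>\<delta>\<bar>))" for t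
    by (rule nn_integral_exp_abs_le) (use \<epsilon> s \<delta> in auto)
  obtain A2 where A2: "0 < A2" and schur: "\<And>g. g \<in> borel_measurable borel \<Longrightarrow>
      enorm lborel q (\<lambda>t. (\<integral>\<^sup>+u. ennreal (exp (- (\<epsilon> * s) * \<bar>t - \<delta> * u\<bar>)) * g u epowr s \<partial>lborel) epowr (1 / s))
      \<le> ennreal A2 * enorm lborel q g"
    using schur_exponential[of lborel "\<lambda>u. \<delta> * u" "\<epsilon> * s" s q "2 / (\<epsilon> * s * \<bar>\<delta>\<bar>)"] W s \<epsilon> \<delta> lborel.sigma_finite_measure_axioms
    by auto
  define A3 where "A3 = 2 powr s * (A0 powr s + A1 * (s * \<alpha>0 + 1))"
  have "0 < A0 powr s + A1 * (s * \<alpha>0 + 1)"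
    using A0(1) A1(1) s \<alpha>0 by (intro add_pos_pos mult_pos_pos) auto
  then have A3: "0 < A3" by (simp add: A3_def)
  show ?thesis
  proof (intro exI[of _ "A3 powr (1 / s) * A2"] conjI allI impI)
    fix f :: "'a \<Rightarrow> 'b" and G assume [measurable]: "f \<in> borel_measurable M"
      and G: "\<forall>l. (lnorm M \<alpha>0 r0 (upper_part l f), lnorm M \<alpha>1 r1 (lower_part l f)) \<in> G"
    define F where "F x = rearrangement M f (exp x)" for x
    have F: "F y \<le> F x" if "x \<le> y" for x y unfolding F_def using that by (rule antimono_rearrangement_exp)
    have [measurable]: "F \<in> borel_measurable borel"
      by (rule borel_measurable_antimono_ennreal) (rule F)
    define g where "g u = ennreal (exp (\<alpha> * u)) * F u" for u
    have [measurable]: "g \<in> borel_measurable borel" unfolding g_def by measurable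
    define R where "R t = (\<integral>\<^sup>+u. ennreal (exp (- (\<epsilon> * s) * \<bar>t - \<delta> * u\<bar>)) * g u epowr s \<partial>lborel)" for t
    have [measurable]: "R \<in> borel_measurable borel" unfolding R_def by measurable
    have K: "(ennreal (exp (- \<theta> * (\<delta> * x))) * Kf G (\<delta> * x)) epowr s \<le> ennreal A3 * R (\<delta> * x)" for x
    proof -
      define \<tau> where "\<tau> = \<delta> * x"
      define P where "P = (\<integral>\<^sup>+u. (ennreal (exp (\<alpha>0 * u)) * F u) epowr s * indicator {..x} u \<partial>lborel)"
      define Q where "Q = (\<integral>\<^sup>+u. ennreal (exp (s * \<alpha>1 * u)) * F u epowr s * indicator {x..} u \<partial>lborel)"
      define T where "T = ennreal (exp (s * \<alpha>1 * x)) * F x epowr s"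
      let ?e0 = "ennreal (exp (- \<theta> * \<tau>))" and ?e1 = "ennreal (exp (- \<theta> * \<tau> + \<tau>))"
      let ?N0 = "lnorm M \<alpha>0 r0 (upper_part (F x) f)" and ?N1 = "lnorm M \<alpha>1 r1 (lower_part (F x) f)"
      have N0: "?N0 epowr s \<le> ennreal (A0 powr s) * P"
      proof -
        have "?N0 \<le> enorm lborel r0 (\<lambda>u. ennreal (exp (\<alpha>0 * u)) * (F u * indicator {..x} u))"
          unfolding lnorm_def
        proof (intro enorm_mono r0 mult_left_mono)
          show "rearrangement M (upper_part (F x) f) (exp u) \<le> F u * indicator {..x} u" for u
            using rearrangement_upper_part_le[of f M "exp x" "exp u"] by (auto simp: F_def split: split_indicator)
        qed simp
        also have "\<dots> \<le> ennreal A0 * enorm lborel (ennreal s) (\<lambda>u. ennreal (exp (\<alpha>0 * u)) * (F u * indicator {..x} u))"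
          by (rule A0) (auto intro: F split: split_indicator)
        finally have "?N0 epowr s \<le> (ennreal A0 * enorm lborel (ennreal s) (\<lambda>u. ennreal (exp (\<alpha>0 * u)) * (F u * indicator {..x} u))) epowr s"
          using s by (intro epowr_mono)
        also have "\<dots> = ennreal (A0 powr s) * (\<integral>\<^sup>+u. (ennreal (exp (\<alpha>0 * u)) * (F u * indicator {..x} u)) epowr s \<partial>lborel)"
          using A0(1) s by (subst epowr_mult) (simp_all add: enorm_powr epowr_ennreal)
        also have "(\<integral>\<^sup>+u. (ennreal (exp (\<alpha>0 * u)) * (F u * indicator {..x} u)) epowr s \<partial>lborel) = P"
          unfolding P_def by (intro nn_integral_cong) (auto split: split_indicator)
        finally show ?thesis .
      qed
      have N1: "?N1 epowr s \<le> ennreal A1 * (T + Q)"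
      proof -
        have "?N1 \<le> enorm lborel r1 (\<lambda>u. ennreal (exp (\<alpha>1 * u)) * min (F u) (F x))"
          unfolding lnorm_def
        proof (intro enorm_mono r1 mult_left_mono)
          show "rearrangement M (lower_part (F x) f) (exp u) \<le> min (F u) (F x)" for u
            using rearrangement_lower_part_le[of f M "F x" "exp u"] by (simp add: F_def)
        qed simp
        then have "?N1 epowr s \<le> enorm lborel r1 (\<lambda>u. ennreal (exp (\<alpha>1 * u)) * min (F u) (F x)) epowr s"
          using s by (intro epowr_mono)
        also have "\<dots> \<le> ennreal A1 * (T + Q)"
          unfolding T_def Q_def by (rule A1(2)) (rule F)
        finally show ?thesis .
      qed
      have eP: "?e0 epowr s * P \<le> R \<tau>"
      proof -
        have "?e0 epowr s * P = (\<integral>\<^sup>+u. ?e0 epowr s * ((ennreal (exp (\<alpha>0 * u)) * F u) epowr s * indicator {..x} u) \<partial>lborel)"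
          unfolding P_def by (rule nn_integral_cmult[symmetric]) measurable
        also have "\<dots> \<le> R \<tau>"
          unfolding R_def
        proof (rule nn_integral_mono)
          fix u
          have "?e0 epowr s * (ennreal (exp (\<alpha>0 * u)) * F u) epowr s \<le> ennreal (exp (- (\<epsilon> * s) * \<bar>\<tau> - \<delta> * u\<bar>)) * g u epowr s"
            if "u \<le> x"
          proof -
            have "\<bar>\<tau> - \<delta> * u\<bar> = \<delta> * (x - u)"
              using that \<delta> by (simp add: \<tau>_def right_diff_distrib mult_left_mono)
            moreover have "\<epsilon> * (s * (\<delta> * (x - u))) \<le> \<theta> * (s * (\<delta> * (x - u)))"
              using \<epsilon> s \<delta> that by (intro mult_right_mono) auto
            ultimately have "s * (- \<theta> * \<tau>) + s * (\<alpha>0 * u) \<le> - (\<epsilon> * s) * \<bar>\<tau> - \<delta> * u\<bar> + s * (\<alpha> * u)"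
              by (simp add: a0 \<tau>_def algebra_simps)
            then show ?thesis
              using s by (simp only: g_def epowr_mult epowr_exp ennreal_exp_mult) (intro mult_right_mono ennreal_leI, auto)
          qed
          then show "?e0 epowr s * ((ennreal (exp (\<alpha>0 * u)) * F u) epowr s * indicator {..x} u)
              \<le> ennreal (exp (- (\<epsilon> * s) * \<bar>\<tau> - \<delta> * u\<bar>)) * g u epowr s"
            by (cases "u \<le> x") auto
        qed
        finally show ?thesis .
      qed
      have eQ: "?e1 epowr s * Q \<le> R \<tau>"
      proof -
        have "?e1 epowr s * Q = (\<integral>\<^sup>+u. ?e1 epowr s * (ennreal (exp (s * \<alpha>1 * u)) * F u epowr s * indicator {x..} u) \<partial>lborel)"
          unfolding Q_def by (rule nn_integral_cmult[symmetric]) measurable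
        also have "\<dots> \<le> R \<tau>"
          unfolding R_def
        proof (rule nn_integral_mono)
          fix u
          have "?e1 epowr s * (ennreal (exp (s * \<alpha>1 * u)) * F u epowr s) \<le> ennreal (exp (- (\<epsilon> * s) * \<bar>\<tau> - \<delta> * u\<bar>)) * g u epowr s"
            if "x \<le> u"
          proof -
            have "\<bar>\<tau> - \<delta> * u\<bar> = \<delta> * (u - x)"
              using that \<delta> by (simp add: \<tau>_def right_diff_distrib mult_left_mono)
            moreover have "\<epsilon> * (s * (\<delta> * (u - x))) \<le> (1 - \<theta>) * (s * (\<delta> * (u - x)))"
              using \<epsilon> s \<delta> that by (intro mult_right_mono) auto
            ultimately have "s * (- \<theta> * \<tau> + \<tau>) + s * \<alpha>1 * u \<le> - (\<epsilon> * s) * \<bar>\<tau> - \<delta> * u\<bar> + s * (\<alpha> * u)"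
              by (simp add: a1 \<tau>_def algebra_simps)
            then show ?thesis
              using s by (simp only: g_def epowr_mult epowr_exp ennreal_exp_mult) (intro mult_right_mono ennreal_leI, auto)
          qed
          then show "?e1 epowr s * (ennreal (exp (s * \<alpha>1 * u)) * F u epowr s * indicator {x..} u)
              \<le> ennreal (exp (- (\<epsilon> * s) * \<bar>\<tau> - \<delta> * u\<bar>)) * g u epowr s"
            by (cases "x \<le> u") auto
        qed
        finally show ?thesis .
      qed
      have eT: "?e1 epowr s * T \<le> ennreal (s * \<alpha>0) * R \<tau>"
      proof -
        have "ennreal (exp (\<alpha>0 * x)) * F x \<le> ennreal ((s * \<alpha>0) powr (1 / s)) * P epowr (1 / s)"
          unfolding P_def by (rule weak_type_bound[OF F \<alpha>0 s(1)])
        then have "(ennreal (exp (\<alpha>0 * x)) * F x) epowr s \<le> (ennreal ((s * \<alpha>0) powr (1 / s)) * P epowr (1 / s)) epowr s"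
          using s by (intro epowr_mono) auto
        also have "\<dots> = ennreal (s * \<alpha>0) * P"
          using s \<alpha>0 by (subst epowr_mult) (simp_all add: epowr_ennreal powr_powr)
        finally have "?e0 epowr s * (ennreal (exp (\<alpha>0 * x)) * F x) epowr s \<le> ?e0 epowr s * (ennreal (s * \<alpha>0) * P)"
          by (rule mult_left_mono) simp
        also have "\<dots> = ennreal (s * \<alpha>0) * (?e0 epowr s * P)" by (simp only: ac_simps)
        also have "\<dots> \<le> ennreal (s * \<alpha>0) * R \<tau>" by (intro mult_left_mono eP) simp
        also have "?e0 epowr s * (ennreal (exp (\<alpha>0 * x)) * F x) epowr s = ?e1 epowr s * T"
        proof -
          have "s * (- \<theta> * \<tau>) + s * (\<alpha>0 * x) = s * (- \<theta> * \<tau> + \<tau>) + s * \<alpha>1 * x"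
            by (simp add: \<tau>_def \<delta>_def algebra_simps)
          then show ?thesis
            using s by (simp only: T_def epowr_mult epowr_exp ennreal_exp_mult)
        qed
        finally show ?thesis .
      qed
      have "Kf G \<tau> \<le> ?N0 + ennreal (exp \<tau>) * ?N1"
        by (rule Kf_le) (use G in simp)
      then have "?e0 * Kf G \<tau> \<le> ?e0 * ?N0 + ?e1 * ?N1"
        by (metis distrib_left ennreal_exp_mult(1) mult_left_mono zero_le)
      then have "(?e0 * Kf G \<tau>) epowr s \<le> (?e0 * ?N0 + ?e1 * ?N1) epowr s"
        using s by (intro epowr_mono)
      also have "\<dots> \<le> ennreal (2 powr s) * ((?e0 * ?N0) epowr s + (?e1 * ?N1) epowr s)"
        using s by (intro epowr_add_le)
      also have "\<dots> = ennreal (2 powr s) * (?e0 epowr s * ?N0 epowr s + ?e1 epowr s * ?N1 epowr s)"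
        using s by (simp only: epowr_mult)
      also have "\<dots> \<le> ennreal (2 powr s) * (?e0 epowr s * (ennreal (A0 powr s) * P) + ?e1 epowr s * (ennreal A1 * (T + Q)))"
        by (intro mult_left_mono add_mono N0 N1) auto
      also have "\<dots> = ennreal (2 powr s) * (ennreal (A0 powr s) * (?e0 epowr s * P) + ennreal A1 * (?e1 epowr s * T + ?e1 epowr s * Q))"
        by (simp only: distrib_left distrib_right ac_simps)
      also have "\<dots> \<le> ennreal (2 powr s) * (ennreal (A0 powr s) * R \<tau> + ennreal A1 * (ennreal (s * \<alpha>0) * R \<tau> + R \<tau>))"
        by (intro mult_left_mono add_mono eP eQ eT) auto
      also have "\<dots> = ennreal A3 * R \<tau>"
        using A0(1) A1(1) s \<alpha>0 unfolding A3_def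
        by (simp add: ennreal_mult distrib_left distrib_right mult.assoc)
      finally show ?thesis unfolding \<tau>_def .
    qed
    have K': "ennreal (exp (- \<theta> * t)) * Kf G t \<le> ennreal (A3 powr (1 / s)) * R t epowr (1 / s)" for t
    proof -
      have "(ennreal (exp (- \<theta> * t)) * Kf G t) epowr s \<le> ennreal A3 * R t"
        using K[of "t / \<delta>"] \<delta> by simp
      then have "((ennreal (exp (- \<theta> * t)) * Kf G t) epowr s) epowr (1 / s) \<le> (ennreal A3 * R t) epowr (1 / s)"
        using s by (intro epowr_mono) auto
      also have "\<dots> = ennreal (A3 powr (1 / s)) * R t epowr (1 / s)"
        using s A3 by (subst epowr_mult) (simp_all add: epowr_ennreal)
      finally show ?thesis using s by (subst (asm) epowr_inverse_cancel) simp_all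
    qed
    then have "inorm G \<theta> q \<le> enorm lborel q (\<lambda>t. ennreal (A3 powr (1 / s)) * R t epowr (1 / s))"
      unfolding inorm_def using q by (intro enorm_mono)
    also have "\<dots> = ennreal (A3 powr (1 / s)) * enorm lborel q (\<lambda>t. R t epowr (1 / s))"
      using q by (intro enorm_cmult) auto
    also have "\<dots> \<le> ennreal (A3 powr (1 / s)) * (ennreal A2 * enorm lborel q g)"
      unfolding R_def by (intro mult_left_mono schur) auto
    also have "\<dots> = ennreal (A3 powr (1 / s) * A2) * enorm lborel q g"
      using A2 by (intro ennreal_mult_mult) auto
    also have "enorm lborel q g = lnorm M \<alpha> q f"
      unfolding lnorm_def g_def F_def ..
    finally show "inorm G \<theta> q \<le> ennreal (A3 powr (1 / s) * A2) * lnorm M \<alpha> q f" .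
  qed (use A2 A3 in simp)
qed

section \<open>Lebesgue spaces as Lorentz spaces\<close>

lemma nn_integral_exp_strict_sublevel:
  assumes "0 < c"
  shows "(\<integral>\<^sup>+x. ennreal (exp (c * x)) * indicator {x. ennreal (exp x) < X} x \<partial>lborel) = ennreal (1 / c) * X epowr c"
proof -
  have "AE x in lborel. x \<noteq> ln (enn2real X)" by (rule AE_lborel_singleton)
  then have "AE x in lborel. ennreal (exp (c * x)) * indicator {x. ennreal (exp x) < X} x
      = ennreal (exp (c * x)) * indicator {x. ennreal (exp x) \<le> X} x"
  proof eventually_elim
    case (elim x)
    then have "ennreal (exp x) \<noteq> X" by auto
    then show ?case by (auto simp: indicator_def less_le)
  qed
  then have "(\<integral>\<^sup>+x. ennreal (exp (c * x)) * indicator {x. ennreal (exp x) < X} x \<partial>lborel)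
    = (\<integral>\<^sup>+x. ennreal (exp (c * x)) * indicator {x. ennreal (exp x) \<le> X} x \<partial>lborel)"
    by (rule nn_integral_cong_AE)
  then show ?thesis using nn_integral_exp_sublevel[OF assms] by simp
qed

lemma layer_cake:
  assumes N: "sigma_finite_measure N" and [measurable]: "h \<in> borel_measurable N" "w \<in> borel_measurable N" and r: "0 < r"
  shows "(\<integral>\<^sup>+x. w x * h x epowr r \<partial>N) = ennreal r *
    (\<integral>\<^sup>+l. ennreal (exp (r * l)) * (\<integral>\<^sup>+x. w x * indicator {x. ennreal (exp l) < h x} x \<partial>N) \<partial>lborel)"
proof -
  interpret N: sigma_finite_measure N by fact
  interpret P: pair_sigma_finite lborel N ..
  have "(\<integral>\<^sup>+x. w x * h x epowr r \<partial>N) = ennreal r *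
    (\<integral>\<^sup>+x. (\<integral>\<^sup>+l. w x * ennreal (exp (r * l)) * (if ennreal (exp l) < h x then 1 else 0) \<partial>lborel) \<partial>N)"
  proof (subst nn_integral_cmult[symmetric])
    show "(\<integral>\<^sup>+x. w x * h x epowr r \<partial>N) =
      (\<integral>\<^sup>+x. ennreal r * (\<integral>\<^sup>+l. w x * ennreal (exp (r * l)) * (if ennreal (exp l) < h x then 1 else 0) \<partial>lborel) \<partial>N)"
    proof (rule nn_integral_cong)
      fix x
      have "(\<integral>\<^sup>+l. w x * ennreal (exp (r * l)) * (if ennreal (exp l) < h x then 1 else 0) \<partial>lborel)
        = w x * (\<integral>\<^sup>+l. ennreal (exp (r * l)) * indicator {l. ennreal (exp l) < h x} l \<partial>lborel)"
        by (subst nn_integral_cmult[symmetric]) (auto simp: indicator_def mult.assoc intro!: nn_integral_cong)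
      also have "\<dots> = w x * (ennreal (1 / r) * h x epowr r)"
        by (subst nn_integral_exp_strict_sublevel) (use r in auto)
      finally show "w x * h x epowr r = ennreal r * (\<integral>\<^sup>+l. w x * ennreal (exp (r * l)) * (if ennreal (exp l) < h x then 1 else 0) \<partial>lborel)"
        using r by (simp add: mult.left_commute[of "w x"] ennreal_mult_mult)
    qed
  qed measurable
  also have "(\<integral>\<^sup>+x. (\<integral>\<^sup>+l. w x * ennreal (exp (r * l)) * (if ennreal (exp l) < h x then 1 else 0) \<partial>lborel) \<partial>N)
    = (\<integral>\<^sup>+l. (\<integral>\<^sup>+x. w x * ennreal (exp (r * l)) * (if ennreal (exp l) < h x then 1 else 0) \<partial>N) \<partial>lborel)"
    by (rule P.Fubini') measurable
  also have "\<dots> = (\<integral>\<^sup>+l. ennreal (exp (r * l)) * (\<integral>\<^sup>+x. w x * indicator {x. ennreal (exp l) < h x} x \<partial>N) \<partial>lborel)"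
    by (intro nn_integral_cong, subst nn_integral_cmult[symmetric], measurable) (auto simp: indicator_def ac_simps intro!: nn_integral_cong)
  finally show ?thesis .
qed

text \<open>A function and its rearrangement have the same distribution, so the layer-cake formula gives the same
  value for both. For \<open>p = \<infinity>\<close> the essential supremum is the limit of \<open>f\<^sup>*(t)\<close> as \<open>t\<close> tends to 0.\<close>

lemma Lp_norm_eq_lorentz_norm:
  fixes f :: "'a \<Rightarrow> 'b::real_normed_vector"
  assumes M: "sigma_finite_measure M" and [measurable]: "f \<in> borel_measurable M" and p: "0 < p"
  shows "Lp_norm M p f = lorentz_norm M p p f"
proof -
  have [measurable]: "(\<lambda>x. norm (f x)) \<in> borel_measurable M" by measurable
  show ?thesis
    using p
  proof (cases rule: exponent_cases)
    case 1
    define S where "S = (SUP x. rearrangement M f (exp x))"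
    have "lorentz_norm M p p f = S"
      using p unfolding lorentz_norm_eq_lnorm[OF p] lnorm_def S_def by (simp add: 1 enorm_def)
    moreover have "esssup M (\<lambda>x. ennreal (norm (f x))) = S"
    proof (rule antisym)
      have "emeasure M {x \<in> space M. S < ennreal (norm (f x))} \<le> 0 + ennreal e" if "0 < e" for e
      proof -
        have "rearrangement M f (exp (ln e)) \<le> S" unfolding S_def by (rule SUP_upper) simp
        then have "emeasure M {x \<in> space M. S < ennreal (norm (f x))} \<le>
          emeasure M {x \<in> space M. rearrangement M f e < ennreal (norm (f x))}"
          using that by (intro emeasure_mono) auto
        also have "\<dots> \<le> ennreal e" by (rule emeasure_above_rearrangement) simp
        finally show ?thesis by simp
      qed
      then have "emeasure M {x \<in> space M. S < ennreal (norm (f x))} \<le> 0"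
        by (rule ennreal_le_epsilon)
      then have "AE x in M. ennreal (norm (f x)) \<le> S"
        by (subst AE_iff_measurable[OF _ refl]) (auto simp: not_le)
      then show "esssup M (\<lambda>x. ennreal (norm (f x))) \<le> S" by (intro esssup_I) auto
      show "S \<le> esssup M (\<lambda>x. ennreal (norm (f x)))"
        unfolding S_def
      proof (rule SUP_least, rule ennreal_le_epsilon)
        fix x e :: real assume "esssup M (\<lambda>x. ennreal (norm (f x))) < top" "0 < e"
        then obtain c where c: "esssup M (\<lambda>x. ennreal (norm (f x))) = ennreal c" "0 \<le> c"
          by (cases "esssup M (\<lambda>x. ennreal (norm (f x)))") auto
        have "AE x in M. ennreal (norm (f x)) \<le> ennreal c"
          using esssup_AE[of "\<lambda>x. ennreal (norm (f x))" M] by (simp add: c)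
        then have "AE x in M. \<not> (c + e < norm (f x))"
          by eventually_elim (use c \<open>0 < e\<close> in \<open>auto simp: ennreal_le_iff\<close>)
        then have "emeasure M {x \<in> space M. c + e < norm (f x)} = 0"
          by (subst (asm) AE_iff_measurable[OF _ refl]) auto
        then show "rearrangement M f (exp x) \<le> esssup M (\<lambda>x. ennreal (norm (f x))) + ennreal e"
          using rearrangement_le[of "c + e" M f "exp x"] c \<open>0 < e\<close> by simp
      qed
    qed
    ultimately show ?thesis using 1 by (simp add: Lp_norm_def)
  next
    case (2 r)
    let ?F = "\<lambda>x. rearrangement M f (exp x)"
    have "(\<integral>\<^sup>+x. ennreal (norm (f x)) epowr r \<partial>M) = ennreal r *
      (\<integral>\<^sup>+l. ennreal (exp (r * l)) * emeasure M {x \<in> space M. exp l < norm (f x)} \<partial>lborel)"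
    proof -
      have "(\<integral>\<^sup>+x. 1 * indicator {x. ennreal (exp l) < ennreal (norm (f x))} x \<partial>M) = emeasure M {x \<in> space M. exp l < norm (f x)}" for l
      proof -
        have "(\<integral>\<^sup>+x. 1 * indicator {x. ennreal (exp l) < ennreal (norm (f x))} x \<partial>M) = (\<integral>\<^sup>+x. indicator {x \<in> space M. exp l < norm (f x)} x \<partial>M)"
          by (intro nn_integral_cong) (auto simp: indicator_def ennreal_less_iff)
        then show ?thesis by simp
      qed
      then show ?thesis
        using layer_cake[OF M, of "\<lambda>x. ennreal (norm (f x))" "\<lambda>_. 1" r] 2 by simp
    qed
    moreover have "(\<integral>\<^sup>+x. ennreal (exp x) * ?F x epowr r \<partial>lborel) = ennreal r *
      (\<integral>\<^sup>+l. ennreal (exp (r * l)) * emeasure M {x \<in> space M. exp l < norm (f x)} \<partial>lborel)"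
    proof -
      have "(\<integral>\<^sup>+x. ennreal (exp x) * indicator {x. ennreal (exp l) < ?F x} x \<partial>lborel) = emeasure M {x \<in> space M. exp l < norm (f x)}" for l
      proof -
        have "{x. ennreal (exp l) < ?F x} = {x. ennreal (exp x) < emeasure M {x \<in> space M. exp l < norm (f x)}}"
          using rearrangement_le_iff[of f M "exp l"] by (auto simp: not_le[symmetric])
        then show ?thesis
          using nn_integral_exp_strict_sublevel[of 1 "emeasure M {x \<in> space M. exp l < norm (f x)}"] by simp
      qed
      then show ?thesis
        using layer_cake[OF lborel.sigma_finite_measure_axioms, of ?F "\<lambda>x. ennreal (exp x)" r] 2 by simp
    qed
    ultimately have "(\<integral>\<^sup>+x. ennreal (norm (f x)) epowr r \<partial>M) = (\<integral>\<^sup>+x. (ennreal (exp (1 / r * x)) * ?F x) epowr r \<partial>lborel)"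
      using 2 by (simp add: epowr_mult epowr_exp)
    moreover have "enn2real (inverse p) = 1 / r" using 2 by (simp add: inverse_ennreal inverse_eq_divide)
    ultimately show ?thesis
      using 2 unfolding lorentz_norm_eq_lnorm[OF p] lnorm_def by (simp add: Lp_norm_def enorm_ennreal)
  qed
qed

section \<open>The quasi-triangle inequality\<close>

lemma lnorm_zero [simp]:
  assumes r: "0 < r"
  shows "lnorm M \<alpha> r (\<lambda>x. 0 :: 'b::real_normed_vector) = 0"
proof -
  have "rearrangement M (\<lambda>x. 0 :: 'b) t \<le> 0" for t
  proof (rule ennreal_le_epsilon)
    fix e :: real assume "0 < e"
    then show "rearrangement M (\<lambda>x. 0 :: 'b) t \<le> 0 + ennreal e" by (simp add: rearrangement_le)
  qed
  then have "rearrangement M (\<lambda>x. 0 :: 'b) t = 0" for t by (simp add: le_zero_eq)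
  then show ?thesis using r by (elim exponent_cases) (simp_all add: lnorm_def enorm_def)
qed

text \<open>Since \<open>(f + g)\<^sup>*(t) \<le> f\<^sup>*(t/2) + g\<^sup>*(t/2)\<close>, and halving \<open>t\<close> is a translation in logarithmic coordinates.\<close>

lemma lnorm_add_le:
  assumes r: "0 < r"
  shows "\<exists>C>0. \<forall>(f::'a \<Rightarrow> 'b::real_normed_vector) g h. f \<in> borel_measurable M \<longrightarrow> g \<in> borel_measurable M \<longrightarrow>
    (AE x in M. h x = f x + g x) \<longrightarrow> lnorm M \<alpha> r h \<le> ennreal C * (lnorm M \<alpha> r f + lnorm M \<alpha> r g)"
proof (intro exI[of _ "exp (\<alpha> * ln 2) * (2 powr (1 + 1 / enn2real r))"] conjI allI impI)
  fix f g h :: "'a \<Rightarrow> 'b"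
  assume f: "f \<in> borel_measurable M" "g \<in> borel_measurable M" "AE x in M. h x = f x + g x"
  let ?w = "\<lambda>f x. ennreal (exp (\<alpha> * (- ln 2 + 1 * x))) * rearrangement M f (exp (- ln 2 + 1 * x))"
  have shift: "enorm lborel r (?w f) = lnorm M \<alpha> r f" for f :: "'a \<Rightarrow> 'b"
    unfolding lnorm_def using r by (subst (2) enorm_lborel_affine[where c=1 and t="- ln 2"]) auto
  have "lnorm M \<alpha> r h \<le> enorm lborel r (\<lambda>x. ennreal (exp (\<alpha> * ln 2)) * (?w f x + ?w g x))"
    unfolding lnorm_def
  proof (rule enorm_mono[OF r])
    fix x :: real
    have "exp (- ln 2 + 1 * x) + exp (- ln 2 + 1 * x) = exp x" by (simp add: exp_diff)
    then have "rearrangement M h (exp x) \<le> rearrangement M f (exp (- ln 2 + 1 * x)) + rearrangement M g (exp (- ln 2 + 1 * x))"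
      using rearrangement_add_le[OF f, of "exp (- ln 2 + 1 * x)" "exp (- ln 2 + 1 * x)"] by simp
    then have "ennreal (exp (\<alpha> * x)) * rearrangement M h (exp x) \<le>
      ennreal (exp (\<alpha> * x)) * (rearrangement M f (exp (- ln 2 + 1 * x)) + rearrangement M g (exp (- ln 2 + 1 * x)))"
      by (rule mult_left_mono) simp
    also have "\<dots> = ennreal (exp (\<alpha> * ln 2)) * (?w f x + ?w g x)"
      unfolding distrib_left ennreal_exp_mult by (simp add: algebra_simps)
    finally show "ennreal (exp (\<alpha> * x)) * rearrangement M h (exp x) \<le> ennreal (exp (\<alpha> * ln 2)) * (?w f x + ?w g x)" .
  qed
  also have "\<dots> = ennreal (exp (\<alpha> * ln 2)) * enorm lborel r (\<lambda>x. ?w f x + ?w g x)"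
    using r by (intro enorm_cmult) auto
  also have "\<dots> \<le> ennreal (exp (\<alpha> * ln 2)) * (ennreal (2 powr (1 + 1 / enn2real r)) * (enorm lborel r (?w f) + enorm lborel r (?w g)))"
    using r by (intro mult_left_mono enorm_add_le) auto
  also have "\<dots> = ennreal (exp (\<alpha> * ln 2) * (2 powr (1 + 1 / enn2real r))) * (lnorm M \<alpha> r f + lnorm M \<alpha> r g)"
    unfolding shift by (intro ennreal_mult_mult) auto
  finally show "lnorm M \<alpha> r h \<le> ennreal (exp (\<alpha> * ln 2) * (2 powr (1 + 1 / enn2real r))) * (lnorm M \<alpha> r f + lnorm M \<alpha> r g)" .
qed simp

section \<open>Couples of function spaces\<close>

text \<open>The pairs of norms of the decompositions of \<open>f\<close>. Decompositions with infinite norms are included: they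
  do not change the K-functional, and membership in the two spaces need not be tracked.\<close>

definition couple ::
  "'a measure \<Rightarrow> (('a \<Rightarrow> 'b::real_normed_vector) \<Rightarrow> ennreal) \<Rightarrow> (('a \<Rightarrow> 'b) \<Rightarrow> ennreal) \<Rightarrow> ('a \<Rightarrow> 'b) \<Rightarrow> (ennreal \<times> ennreal) set" where
  "couple M N0 N1 f = {(N0 f0, N1 f1) | f0 f1.
     f0 \<in> borel_measurable M \<and> f1 \<in> borel_measurable M \<and> (AE x in M. f x = f0 x + f1 x)}"

text \<open>The quasi-norms of the spaces at hand are meaningful, possibly infinite, for all measurable functions, and the
  spaces consist of the functions with finite quasi-norm.\<close>

definition normed_by :: "'a measure \<Rightarrow> ('a \<Rightarrow> 'b::real_normed_vector) qn_space \<Rightarrow> (('a \<Rightarrow> 'b) \<Rightarrow> ennreal) \<Rightarrow> bool" where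
  "normed_by M X N \<longleftrightarrow> elements X = {f \<in> borel_measurable M. N f < top} \<and> (\<forall>f\<in>borel_measurable M. qnorm X f = N f)"

lemma K_functional_eq_Kf:
  assumes X0: "normed_by M X0 N0" and X1: "normed_by M X1 N1"
  shows "K_functional M X0 X1 (exp \<tau>) f = Kf (couple M N0 N1 f) \<tau>"
proof (rule antisym)
  show "K_functional M X0 X1 (exp \<tau>) f \<le> Kf (couple M N0 N1 f) \<tau>"
  proof (rule Kf_ge)
    fix x y assume "(x, y) \<in> couple M N0 N1 f"
    then obtain f0 f1 where f: "f0 \<in> borel_measurable M" "f1 \<in> borel_measurable M" "AE x in M. f x = f0 x + f1 x"
      and xy: "x = N0 f0" "y = N1 f1" by (auto simp: couple_def)
    show "K_functional M X0 X1 (exp \<tau>) f \<le> x + ennreal (exp \<tau>) * y"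
    proof (cases "x < top \<and> y < top")
      case True
      then have "(f0, f1) \<in> decompositions M X0 X1 f"
        using f X0 X1 by (auto simp: decompositions_def normed_by_def xy)
      then have "K_functional M X0 X1 (exp \<tau>) f \<le> qnorm X0 f0 + ennreal (exp \<tau>) * qnorm X1 f1"
        unfolding K_functional_def by (rule INF_lower2) auto
      then show ?thesis using f X0 X1 by (simp add: normed_by_def xy)
    next
      case False
      then have "x + ennreal (exp \<tau>) * y = top"
        by (auto simp: less_top[symmetric] ennreal_mult_top)
      then show ?thesis by (simp only: top_greatest)
    qed
  qed
  show "Kf (couple M N0 N1 f) \<tau> \<le> K_functional M X0 X1 (exp \<tau>) f"
    unfolding K_functional_def
  proof (rule INF_greatest, clarsimp)
    fix f0 f1 assume d: "(f0, f1) \<in> decompositions M X0 X1 f"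
    then have "(N0 f0, N1 f1) \<in> couple M N0 N1 f" "qnorm X0 f0 = N0 f0" "qnorm X1 f1 = N1 f1"
      using X0 X1 by (auto simp: decompositions_def normed_by_def couple_def)
    then show "Kf (couple M N0 N1 f) \<tau> \<le> qnorm X0 f0 + ennreal (exp \<tau>) * qnorm X1 f1"
      using Kf_le by metis
  qed
qed

lemma interpolation_norm_eq_inorm:
  assumes X0: "normed_by M X0 N0" and X1: "normed_by M X1 N1" and q: "0 < q"
  shows "interpolation_norm M X0 X1 \<theta> q f = inorm (couple M N0 N1 f) \<theta> q"
proof -
  have e: "exp x powr - \<theta> = exp (- \<theta> * x)" for x :: real by (simp add: powr_def)
  have [measurable]: "(\<lambda>t. K_functional M X0 X1 t f) \<in> borel_measurable borel"
    by (rule borel_measurable_mono_ennreal)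
      (unfold K_functional_def, intro INF_mono, auto intro!: bexI add_left_mono mult_right_mono ennreal_leI)
  show ?thesis
    using q
  proof (cases rule: exponent_cases)
    case 1
    have "{0<..} = range (exp :: real \<Rightarrow> real)"
      by (auto simp: image_iff) (metis exp_ln)
    then show ?thesis
      unfolding interpolation_norm_def inorm_def enorm_def using 1
      by (simp add: image_image e K_functional_eq_Kf[OF X0 X1])
  next
    case (2 s)
    have "(\<integral>\<^sup>+t\<in>{0<..}. (ennreal (t powr - \<theta>) * K_functional M X0 X1 t f) epowr s * ennreal (1 / t) \<partial>lborel)
      = (\<integral>\<^sup>+x. (ennreal (exp x powr - \<theta>) * K_functional M X0 X1 (exp x) f) epowr s \<partial>lborel)"
      by (rule nn_integral_dt_over_t) measurable
    then show ?thesis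
      unfolding interpolation_norm_def inorm_def enorm_def using 2
      by (simp add: e K_functional_eq_Kf[OF X0 X1])
  qed
qed

lemma inorm_less_top_imp_nonempty:
  assumes "0 < q" "inorm G \<theta> q < top"
  obtains x y where "(x, y) \<in> G" "x < top" "y < top"
proof -
  have "\<exists>(x, y)\<in>G. x < top \<and> y < top"
  proof (rule ccontr)
    assume no: "\<not> ?thesis"
    have "Kf G t = top" for t
    proof -
      have "top \<le> Kf G t"
        by (rule Kf_ge) (use no in \<open>fastforce simp: less_top[symmetric] ennreal_mult_top\<close>)
      then show ?thesis by (simp add: top_unique)
    qed
    then have "inorm G \<theta> q = enorm lborel q (\<lambda>t::real. top)"
      by (simp add: inorm_def ennreal_mult_top)
    also have "\<dots> = top"
      using assms(1) by (rule exponent_cases) (simp_all add: enorm_def ennreal_top_mult)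
    finally show False using assms by simp
  qed
  then show ?thesis using that by blast
qed

text \<open>Equivalence of quasi-norms on all measurable functions, infinite values included, yields equality of
  the spaces as well; a finite interpolation quasi-norm forces the existence of a decomposition with
  finite norms.\<close>

theorem real_interpolation_equivalent:
  assumes X0: "normed_by M X0 N0" and X1: "normed_by M X1 N1" and Y: "normed_by M Y N" and q: "0 < q" and C: "0 < C"
    and N: "\<And>f. f \<in> borel_measurable M \<Longrightarrow> inorm (couple M N0 N1 f) \<theta> q \<le> ennreal C * N f"
      "\<And>f. f \<in> borel_measurable M \<Longrightarrow> N f \<le> ennreal C * inorm (couple M N0 N1 f) \<theta> q"
  shows "real_interpolation M X0 X1 \<theta> q \<cong>\<^sub>q Y"
proof -
  have qn: "interpolation_norm M X0 X1 \<theta> q f = inorm (couple M N0 N1 f) \<theta> q" for f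
    by (rule interpolation_norm_eq_inorm[OF X0 X1 q])
  have fin: "inorm (couple M N0 N1 f) \<theta> q < top \<longleftrightarrow> N f < top" if "f \<in> borel_measurable M" for f
    using N[OF that] by (auto intro: le_less_trans simp: ennreal_mult_less_top)
  have "f \<in> sum_space M X0 X1" if f: "f \<in> borel_measurable M" "inorm (couple M N0 N1 f) \<theta> q < top" for f
  proof -
    obtain x y where "(x, y) \<in> couple M N0 N1 f" "x < top" "y < top"
      using inorm_less_top_imp_nonempty[OF q f(2)] .
    then show ?thesis
      using f(1) X0 X1 unfolding sum_space_def decompositions_def couple_def normed_by_def by blast
  qed
  then have el: "elements (real_interpolation M X0 X1 \<theta> q) = elements Y"
    using Y fin by (auto simp: real_interpolation_def normed_by_def qn) (auto simp: sum_space_def)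
  show ?thesis
    unfolding equivalent_spaces_def
  proof (intro conjI exI[of _ C] ballI el C)
    fix f assume "f \<in> elements (real_interpolation M X0 X1 \<theta> q)"
    then have f: "f \<in> borel_measurable M" unfolding el using Y by (auto simp: normed_by_def)
    then have "qnorm Y f = N f" using Y by (simp add: normed_by_def)
    then show "qnorm (real_interpolation M X0 X1 \<theta> q) f \<le> ennreal C * qnorm Y f"
      "qnorm Y f \<le> ennreal C * qnorm (real_interpolation M X0 X1 \<theta> q) f"
      using N[OF f] by (simp_all add: real_interpolation_def qn)
  qed
qed

section \<open>Shells\<close>

lemma sigma_finite_lebesgue_on:
  assumes "\<Omega> \<in> sets lebesgue"
  shows "sigma_finite_measure (lebesgue_on (\<Omega> :: 'n::euclidean_space set))"
proof -
  have "sigma_finite_measure (lebesgue :: 'n measure)"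
  proof
    obtain A :: "nat \<Rightarrow> 'n set" where A: "range A \<subseteq> sets lborel" "(\<Union>i. A i) = space lborel" "\<And>i. emeasure lborel (A i) \<noteq> \<infinity>"
      using lborel.sigma_finite by metis
    show "\<exists>A. countable A \<and> A \<subseteq> sets (lebesgue :: 'n measure) \<and> \<Union>A = space lebesgue \<and> (\<forall>a\<in>A. emeasure lebesgue a \<noteq> \<infinity>)"
      by (rule exI[of _ "range A"]) (use A in auto)
  qed
  then show ?thesis using assms by (intro sigma_finite_measure_restrict_space)
qed

lemma shell_subset: "shell \<Omega> k \<subseteq> \<Omega>"
  by (auto simp: shell_def)

lemma shell_sets:
  assumes "\<Omega> \<in> sets lebesgue"
  shows "shell \<Omega> k \<in> sets (lebesgue_on \<Omega>)"
proof -
  have "{x \<in> space (lebesgue_on \<Omega>). norm x < c} \<in> sets (lebesgue_on \<Omega>)"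
    "{x \<in> space (lebesgue_on \<Omega>). b \<le> norm x \<and> norm x < c} \<in> sets (lebesgue_on \<Omega>)" for b c
  proof -
    have [measurable]: "(\<lambda>x. norm x) \<in> borel_measurable (lebesgue_on \<Omega>)"
      by (rule measurable_restrict_space1) (auto intro: measurable_completion)
    show "{x \<in> space (lebesgue_on \<Omega>). norm x < c} \<in> sets (lebesgue_on \<Omega>)" by measurable
    show "{x \<in> space (lebesgue_on \<Omega>). b \<le> norm x \<and> norm x < c} \<in> sets (lebesgue_on \<Omega>)" by measurable
  qed
  note sets = this[unfolded space_lebesgue_on]
  show ?thesis
  proof (cases "k = -1")
    case True
    show ?thesis unfolding shell_def if_P[OF True] by (rule sets(1))
  next
    case False
    show ?thesis unfolding shell_def if_not_P[OF False] by (rule sets(2))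
  qed
qed

lemma shell_exists:
  assumes "\<omega> \<in> \<Omega>"
  obtains k where "-1 \<le> k" "\<omega> \<in> shell \<Omega> k"
proof (cases "norm \<omega> < 1 / 2")
  case True
  then show ?thesis using assms that[of "-1"] by (simp add: shell_def)
next
  case False
  define k where "k = \<lfloor>log 2 (norm \<omega>)\<rfloor> + 1"
  have pos: "0 < norm \<omega>" using False by linarith
  have "log 2 (1 / 2) \<le> log 2 (norm \<omega>)" using False pos by (subst log_le_cancel_iff) auto
  then have "-1 \<le> log 2 (norm \<omega>)" by (simp add: log_divide)
  then have "-1 \<le> \<lfloor>log 2 (norm \<omega>)\<rfloor>" by (simp add: le_floor_iff)
  then have k: "0 \<le> k" by (simp add: k_def)
  have "of_int k - 1 \<le> log 2 (norm \<omega>)" "log 2 (norm \<omega>) < of_int k"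
    unfolding k_def by linarith+
  then have "2 powr (of_int k - 1) \<le> norm \<omega>" "norm \<omega> < 2 powr of_int k"
    using pos by (simp_all add: le_log_iff log_less_iff)
  then show ?thesis using that[of k] k assms by (simp add: shell_def)
qed

lemma shell_disjoint_less:
  assumes "-1 \<le> j" "j < k"
  shows "shell \<Omega> j \<inter> shell \<Omega> k = {}"
proof -
  have "2 powr of_int j \<le> (2 powr (of_int k - 1) :: real)"
    using assms by (intro powr_mono) auto
  note le = this
  have lt: "norm \<omega> < 2 powr of_int j" if "\<omega> \<in> shell \<Omega> j" for \<omega>
    using that by (auto simp: shell_def powr_minus_divide split: if_splits)
  have ge: "2 powr (of_int k - 1) \<le> norm \<omega>" if "\<omega> \<in> shell \<Omega> k" for \<omega>
    using that assms by (auto simp: shell_def split: if_splits)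
  have "\<omega> \<notin> shell \<Omega> k" if "\<omega> \<in> shell \<Omega> j" for \<omega>
    using lt[OF that] ge[of \<omega>] le by linarith
  then show ?thesis by auto
qed

lemma shell_unique:
  assumes "-1 \<le> j" "-1 \<le> k" "\<omega> \<in> shell \<Omega> j" "\<omega> \<in> shell \<Omega> k"
  shows "j = k"
proof (rule ccontr)
  assume "j \<noteq> k"
  then have "shell \<Omega> j \<inter> shell \<Omega> k = {}"
    using shell_disjoint_less[OF assms(1), of k \<Omega>] shell_disjoint_less[OF assms(2), of j \<Omega>]
    by (metis Int_commute linorder_neqE)
  then show False using assms(3,4) by blast
qed

lemma cutoff_apply: "cutoff \<Omega> k f \<omega> = (if \<omega> \<in> shell \<Omega> k then f \<omega> else 0)"
  by (simp add: cutoff_def)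

lemma cutoff_measurable:
  fixes f :: "'n::euclidean_space \<Rightarrow> 'b::real_normed_vector"
  assumes "\<Omega> \<in> sets lebesgue" "f \<in> borel_measurable (lebesgue_on \<Omega>)"
  shows "cutoff \<Omega> k f \<in> borel_measurable (lebesgue_on \<Omega>)"
proof -
  have [measurable]: "shell \<Omega> k \<in> sets (lebesgue_on \<Omega>)" "f \<in> borel_measurable (lebesgue_on \<Omega>)"
    using assms shell_sets by auto
  have "(\<lambda>\<omega>. if \<omega> \<in> shell \<Omega> k then f \<omega> else 0) \<in> borel_measurable (lebesgue_on \<Omega>)"
    by measurable
  then show ?thesis by (simp add: cutoff_apply[abs_def])
qed

lemma cutoff_upper_part: "cutoff \<Omega> k (upper_part l f) = upper_part l (cutoff \<Omega> k f)"
  by (auto simp: cutoff_apply upper_part_def)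

lemma cutoff_lower_part: "cutoff \<Omega> k (lower_part l f) = lower_part l (cutoff \<Omega> k f)"
  by (auto simp: cutoff_apply lower_part_def)

lemma lebesgue_on_shell:
  assumes "\<Omega> \<in> sets lebesgue"
  shows "lebesgue_on (shell \<Omega> k) = restrict_space (lebesgue_on \<Omega>) (shell \<Omega> k)"
proof -
  have \<Omega>: "\<Omega> \<inter> space lebesgue \<in> sets lebesgue"
    using assms by (rule sets.Int[OF _ sets.top])
  have "shell \<Omega> k \<in> sets lebesgue"
    using shell_sets[OF assms, of k] unfolding sets_restrict_space_iff[OF \<Omega>] by (rule conjunct2)
  then have "shell \<Omega> k \<inter> space lebesgue \<in> sets lebesgue"
    by (rule sets.Int[OF _ sets.top])
  from restrict_restrict_space[OF \<Omega> this]
  show ?thesis by (simp only: Int_absorb1[OF shell_subset])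
qed

text \<open>The Lorentz spaces of the definition live on the individual shells and the quasi-norms on \<open>\<Omega>\<close>; they
  agree because a cut-off function has all its superlevel sets inside the shell.\<close>

lemma lnorm_cutoff_shell:
  assumes \<Omega>: "\<Omega> \<in> sets lebesgue"
  shows "lnorm (lebesgue_on (shell \<Omega> k)) \<alpha> r (cutoff \<Omega> k f) = lnorm (lebesgue_on \<Omega>) \<alpha> r (cutoff \<Omega> k f)"
proof -
  have "rearrangement (lebesgue_on (shell \<Omega> k)) (cutoff \<Omega> k f) t = rearrangement (lebesgue_on \<Omega>) (cutoff \<Omega> k f) t" for t
  proof (rule rearrangement_cong)
    fix l :: real assume "0 < l"
    have "l < norm (cutoff \<Omega> k f x) \<Longrightarrow> x \<in> shell \<Omega> k" for x
      using \<open>0 < l\<close> by (cases "x \<in> shell \<Omega> k") (simp_all add: cutoff_apply)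
    then have sub: "{x \<in> space (lebesgue_on \<Omega>). l < norm (cutoff \<Omega> k f x)} \<subseteq> shell \<Omega> k"
      and eq: "{x \<in> space (lebesgue_on (shell \<Omega> k)). l < norm (cutoff \<Omega> k f x)} = {x \<in> space (lebesgue_on \<Omega>). l < norm (cutoff \<Omega> k f x)}"
      using shell_subset[of \<Omega> k] unfolding space_lebesgue_on by blast+
    show "emeasure (lebesgue_on (shell \<Omega> k)) {x \<in> space (lebesgue_on (shell \<Omega> k)). l < norm (cutoff \<Omega> k f x)}
      = emeasure (lebesgue_on \<Omega>) {x \<in> space (lebesgue_on \<Omega>). l < norm (cutoff \<Omega> k f x)}"
      unfolding eq unfolding lebesgue_on_shell[OF \<Omega>]
      by (rule emeasure_restrict_space[OF sets.Int[OF shell_sets[OF \<Omega>] sets.top] sub])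
  qed
  then show ?thesis by (simp add: lnorm_def)
qed

lemma infsum_atLeast_int_eq_nn_integral:
  fixes f :: "int \<Rightarrow> ennreal"
  shows "(\<Sum>\<^sub>\<infinity>k\<in>{-1..}. f k) = (\<integral>\<^sup>+k. f k \<partial>count_space {-1..})"
proof -
  have S: "(\<Sum>\<^sub>\<infinity>k\<in>{-1..}. f k) = (SUP F\<in>{F. finite F \<and> F \<subseteq> {-1..}}. sum f F)"
    by (rule nonneg_infsum_complete) simp
  have bij: "bij_betw (\<lambda>n::nat. int n - 1) UNIV {-1..}"
    by (rule bij_betwI[where g="\<lambda>k. nat (k + 1)"]) auto
  show ?thesis
    unfolding S
  proof (intro antisym SUP_least)
    fix F :: "int set" assume F: "F \<in> {F. finite F \<and> F \<subseteq> {-1..}}"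
    then have "sum f F = (\<integral>\<^sup>+k. f k * indicator F k \<partial>count_space {-1..})"
      by (subst nn_integral_count_space'[of F]) (auto simp: indicator_def intro!: sum.cong)
    also have "\<dots> \<le> (\<integral>\<^sup>+k. f k \<partial>count_space {-1..})"
      by (intro nn_integral_mono) (auto split: split_indicator)
    finally show "sum f F \<le> (\<integral>\<^sup>+k. f k \<partial>count_space {-1..})" .
  next
    have "(\<integral>\<^sup>+k. f k \<partial>count_space {-1..}) = (\<integral>\<^sup>+n. f (int n - 1) \<partial>count_space UNIV)"
      by (rule nn_integral_bij_count_space[OF bij, symmetric])
    also have "\<dots> = (SUP n. \<Sum>i<n. f (int i - 1))"
      by (simp add: nn_integral_count_space_nat suminf_eq_SUP)
    also have "\<dots> \<le> (SUP F\<in>{F. finite F \<and> F \<subseteq> {-1..}}. sum f F)"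
    proof (rule SUP_least)
      fix n :: nat
      have "(\<Sum>i<n. f (int i - 1)) = sum f ((\<lambda>i. int i - 1) ` {..<n})"
        by (subst sum.reindex) (auto simp: inj_on_def)
      also have "\<dots> \<le> (SUP F\<in>{F. finite F \<and> F \<subseteq> {-1..}}. sum f F)"
        by (rule SUP_upper) auto
      finally show "(\<Sum>i<n. f (int i - 1)) \<le> (SUP F\<in>{F. finite F \<and> F \<subseteq> {-1..}}. sum f F)" .
    qed
    finally show "(\<integral>\<^sup>+k. f k \<partial>count_space {-1..}) \<le> (SUP F\<in>{F. finite F \<and> F \<subseteq> {-1..}}. sum f F)" .
  qed
qed

text \<open>The Herz--Lorentz quasi-norm with the weights \<open>2\<^sup>k\<^sup>a\<close> in exponential form and \<open>\<alpha>\<close> in place of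
  \<open>1/p\<close>. It serves the Herz spaces as well.\<close>

definition hl_norm ::
  "'n::euclidean_space set \<Rightarrow> real \<Rightarrow> real \<Rightarrow> ennreal \<Rightarrow> ennreal \<Rightarrow> ('n \<Rightarrow> 'b::real_normed_vector) \<Rightarrow> ennreal" where
  "hl_norm \<Omega> a \<alpha> r q f = enorm (count_space {-1..}) q
     (\<lambda>k. ennreal (exp (of_int k * (a * ln 2))) * lnorm (lebesgue_on \<Omega>) \<alpha> r (cutoff \<Omega> k f))"

lemma weighted_lq_norm_eq_enorm:
  assumes "0 < q"
  shows "weighted_lq_norm a q s = enorm (count_space {-1..}) q (\<lambda>k. ennreal (exp (of_int k * (a * ln 2))) * s k)"
  using assms
proof (cases rule: exponent_cases)
  case 1
  then show ?thesis by (simp add: weighted_lq_norm_def enorm_def powr_def mult.assoc)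
next
  case (2 r)
  have "ennreal (2 powr (of_int k * a * r)) * s k epowr r = (ennreal (exp (of_int k * (a * ln 2))) * s k) epowr r" for k
    using 2 by (simp add: epowr_mult epowr_exp powr_def mult_ac)
  then show ?thesis
    using 2 by (simp add: weighted_lq_norm_def enorm_def infsum_atLeast_int_eq_nn_integral)
qed

lemma herz_lorentz_norm_eq:
  assumes "0 < r" "0 < q"
  shows "herz_lorentz_norm \<Omega> a p r q f = hl_norm \<Omega> a (enn2real (inverse p)) r q f"
  unfolding herz_lorentz_norm_def hl_norm_def using assms
  by (simp add: weighted_lq_norm_eq_enorm lorentz_norm_eq_lnorm)

lemma hl_norm_finite_pieces:
  assumes "0 < q" "hl_norm \<Omega> a \<alpha> r q f < top" "-1 \<le> k"
  shows "lnorm (lebesgue_on \<Omega>) \<alpha> r (cutoff \<Omega> k f) < top"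
proof -
  have "ennreal (exp (of_int k * (a * ln 2))) * lnorm (lebesgue_on \<Omega>) \<alpha> r (cutoff \<Omega> k f) \<le> hl_norm \<Omega> a \<alpha> r q f"
    unfolding hl_norm_def using assms
    by (intro enorm_count_space_ge[where F="\<lambda>k. ennreal (exp (of_int k * (a * ln 2))) * lnorm (lebesgue_on \<Omega>) \<alpha> r (cutoff \<Omega> k f)"]) auto
  then have "ennreal (exp (of_int k * (a * ln 2))) * lnorm (lebesgue_on \<Omega>) \<alpha> r (cutoff \<Omega> k f) < top"
    using assms(2) by (rule le_less_trans)
  then show ?thesis by (auto simp: ennreal_mult_less_top)
qed

lemma cutoff_measurable_shell:
  fixes f :: "'n::euclidean_space \<Rightarrow> 'b::real_normed_vector"
  assumes "\<Omega> \<in> sets lebesgue" "f \<in> borel_measurable (lebesgue_on \<Omega>)"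
  shows "cutoff \<Omega> k f \<in> borel_measurable (lebesgue_on (shell \<Omega> k))"
  unfolding lebesgue_on_shell[OF assms(1)] by (rule measurable_restrict_space1[OF cutoff_measurable[OF assms]])

lemma normed_by_herz_lorentz:
  assumes \<Omega>: "\<Omega> \<in> sets lebesgue" and "0 < r" "0 < q"
  shows "normed_by (lebesgue_on \<Omega>) (herz_lorentz \<Omega> a p r q :: ('n::euclidean_space \<Rightarrow> 'b::real_normed_vector) qn_space)
    (hl_norm \<Omega> a (enn2real (inverse p)) r q)"
  using assms unfolding normed_by_def herz_lorentz_def
  by (auto simp: herz_lorentz_norm_eq lorentz_space_def cutoff_measurable_shell lorentz_norm_eq_lnorm
      lnorm_cutoff_shell intro: hl_norm_finite_pieces)

lemma normed_by_herz:
  assumes \<Omega>: "\<Omega> \<in> sets lebesgue" and "0 < p" "0 < q"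
  shows "normed_by (lebesgue_on \<Omega>) (herz \<Omega> a p q :: ('n::euclidean_space \<Rightarrow> 'b::real_normed_vector) qn_space)
    (hl_norm \<Omega> a (enn2real (inverse p)) p q)"
proof -
  have shell: "shell \<Omega> k \<in> sets lebesgue" for k
    using shell_sets[OF \<Omega>, of k] unfolding sets_restrict_space_iff[OF sets.Int[OF \<Omega> sets.top]] by (rule conjunct2)
  have Lp: "Lp_norm (lebesgue_on \<Omega>) p (cutoff \<Omega> k f) = lnorm (lebesgue_on \<Omega>) (enn2real (inverse p)) p (cutoff \<Omega> k f)"
    "Lp_norm (lebesgue_on (shell \<Omega> k)) p (cutoff \<Omega> k f) = lnorm (lebesgue_on \<Omega>) (enn2real (inverse p)) p (cutoff \<Omega> k f)"
    if "f \<in> borel_measurable (lebesgue_on \<Omega>)" for f :: "'n \<Rightarrow> 'b" and k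
    using Lp_norm_eq_lorentz_norm[OF sigma_finite_lebesgue_on[OF \<Omega>] cutoff_measurable[OF \<Omega> that] assms(2), of k]
      Lp_norm_eq_lorentz_norm[OF sigma_finite_lebesgue_on[OF shell] cutoff_measurable_shell[OF \<Omega> that] assms(2), of k]
      assms by (simp_all add: lorentz_norm_eq_lnorm lnorm_cutoff_shell)
  have n: "herz_norm \<Omega> a p q f = hl_norm \<Omega> a (enn2real (inverse p)) p q f" if "f \<in> borel_measurable (lebesgue_on \<Omega>)" for f :: "'n \<Rightarrow> 'b"
    unfolding herz_norm_def hl_norm_def using assms that by (simp add: weighted_lq_norm_eq_enorm Lp)
  show ?thesis
    using assms unfolding normed_by_def herz_def
    by (auto simp: n Lp Lp_space_def cutoff_measurable_shell intro: hl_norm_finite_pieces)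
qed

section \<open>Splitting into shells\<close>

definition shell_couple ::
  "'n::euclidean_space set \<Rightarrow> (('n \<Rightarrow> 'b::real_normed_vector) \<Rightarrow> ennreal) \<Rightarrow> (('n \<Rightarrow> 'b) \<Rightarrow> ennreal) \<Rightarrow> ('n \<Rightarrow> 'b) \<Rightarrow> int \<Rightarrow>
    (ennreal \<times> ennreal) set" where
  "shell_couple \<Omega> L0 L1 f k = couple (lebesgue_on \<Omega>) (\<lambda>g. L0 (cutoff \<Omega> k g)) (\<lambda>g. L1 (cutoff \<Omega> k g)) f"

text \<open>The shells are measurable, countably many, and partition \<open>\<Omega>\<close>.\<close>

lemma glue_shells:
  fixes h :: "int \<Rightarrow> 'n::euclidean_space \<Rightarrow> 'b::real_normed_vector"
  assumes \<Omega>: "\<Omega> \<in> sets lebesgue" and h: "\<And>k. -1 \<le> k \<Longrightarrow> h k \<in> borel_measurable (lebesgue_on \<Omega>)"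
  obtains H where "H \<in> borel_measurable (lebesgue_on \<Omega>)" "\<And>k \<omega>. -1 \<le> k \<Longrightarrow> \<omega> \<in> shell \<Omega> k \<Longrightarrow> H \<omega> = h k \<omega>"
proof
  define H where "H \<omega> = h (THE k. -1 \<le> k \<and> \<omega> \<in> shell \<Omega> k) \<omega>" for \<omega>
  show eq: "H \<omega> = h k \<omega>" if "-1 \<le> k" "\<omega> \<in> shell \<Omega> k" for k \<omega>
  proof -
    have "(THE k. -1 \<le> k \<and> \<omega> \<in> shell \<Omega> k) = k"
      using that shell_unique by (intro the_equality) auto
    then show ?thesis by (simp add: H_def)
  qed
  show "H \<in> borel_measurable (lebesgue_on \<Omega>)"
  proof (rule measurable_piecewise_restrict[of "shell \<Omega> ` {-1..}"])
    show "space (lebesgue_on \<Omega>) \<subseteq> \<Union> (shell \<Omega> ` {-1..})"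
      by (auto elim: shell_exists)
    fix S assume "S \<in> shell \<Omega> ` {-1..}"
    then obtain k where k: "-1 \<le> k" "S = shell \<Omega> k" by auto
    show "S \<inter> space (lebesgue_on \<Omega>) \<in> sets (lebesgue_on \<Omega>)"
      using shell_sets[OF \<Omega>, of k] k by (intro sets.Int) auto
    have "h k \<in> borel_measurable (restrict_space (lebesgue_on \<Omega>) S)"
      by (rule measurable_restrict_space1[OF h[OF k(1)]])
    moreover have "H \<omega> = h k \<omega>" if "\<omega> \<in> space (restrict_space (lebesgue_on \<Omega>) S)" for \<omega>
      using eq k that by (auto simp: space_restrict_space)
    ultimately show "H \<in> borel_measurable (restrict_space (lebesgue_on \<Omega>) S)"
      by (simp cong: measurable_cong)
  qed simp
qed

text \<open>Independent decompositions on all shells glue to one global decomposition, so the pairs of norms of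
  a function are those of the sum of its shell couples.\<close>

lemma couple_eq_lq_couple:
  fixes f :: "'n::euclidean_space \<Rightarrow> 'b::real_normed_vector"
  assumes \<Omega>: "\<Omega> \<in> sets lebesgue"
  shows "couple (lebesgue_on \<Omega>)
      (\<lambda>g. enorm (count_space {-1..}) q0 (\<lambda>k. w0 k * L0 (cutoff \<Omega> k g)))
      (\<lambda>g. enorm (count_space {-1..}) q1 (\<lambda>k. w1 k * L1 (cutoff \<Omega> k g))) f
    = lq_couple {-1..} q0 q1 (\<lambda>k. (\<lambda>(x, y). (w0 k * x, w1 k * y)) ` shell_couple \<Omega> L0 L1 f k)"
    (is "couple ?M ?N0 ?N1 f = ?R")
proof (intro equalityI subsetI)
  fix p assume "p \<in> couple ?M ?N0 ?N1 f"
  then obtain f0 f1 where f: "f0 \<in> borel_measurable ?M" "f1 \<in> borel_measurable ?M" "AE x in ?M. f x = f0 x + f1 x"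
    and p: "p = (?N0 f0, ?N1 f1)" by (auto simp: couple_def)
  show "p \<in> ?R"
    unfolding lq_couple_def
  proof (rule image_eqI)
    show "p = (enorm (count_space {-1..}) q0 (\<lambda>k. fst (w0 k * L0 (cutoff \<Omega> k f0), w1 k * L1 (cutoff \<Omega> k f1))),
       enorm (count_space {-1..}) q1 (\<lambda>k. snd (w0 k * L0 (cutoff \<Omega> k f0), w1 k * L1 (cutoff \<Omega> k f1))))"
      by (simp add: p)
    have "(L0 (cutoff \<Omega> k f0), L1 (cutoff \<Omega> k f1)) \<in> shell_couple \<Omega> L0 L1 f k" for k
      unfolding shell_couple_def couple_def using f by blast
    then show "(\<lambda>k. (w0 k * L0 (cutoff \<Omega> k f0), w1 k * L1 (cutoff \<Omega> k f1))) \<in>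
      {g. \<forall>k\<in>{-1..}. g k \<in> (\<lambda>(x, y). (w0 k * x, w1 k * y)) ` shell_couple \<Omega> L0 L1 f k}"
      by force
  qed
next
  fix p assume "p \<in> ?R"
  then obtain g where g: "\<And>k. -1 \<le> k \<Longrightarrow> g k \<in> (\<lambda>(x, y). (w0 k * x, w1 k * y)) ` shell_couple \<Omega> L0 L1 f k"
    and p: "p = (enorm (count_space {-1..}) q0 (\<lambda>k. fst (g k)), enorm (count_space {-1..}) q1 (\<lambda>k. snd (g k)))"
    by (auto simp: lq_couple_def)
  define P where "P k f0 f1 \<longleftrightarrow> f0 \<in> borel_measurable ?M \<and> f1 \<in> borel_measurable ?M \<and> (AE x in ?M. f x = f0 x + f1 x) \<and>
      g k = (w0 k * L0 (cutoff \<Omega> k f0), w1 k * L1 (cutoff \<Omega> k f1))" for k f0 f1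
  have "\<exists>f0 f1. P k f0 f1" if "-1 \<le> k" for k
    using g[OF that] unfolding shell_couple_def couple_def P_def by auto
  then obtain h0 h1 where "\<And>k. -1 \<le> k \<Longrightarrow> P k (h0 k) (h1 k)"
    by metis
  then have h: "\<And>k. -1 \<le> k \<Longrightarrow> h0 k \<in> borel_measurable ?M" "\<And>k. -1 \<le> k \<Longrightarrow> h1 k \<in> borel_measurable ?M"
      "\<And>k. -1 \<le> k \<Longrightarrow> AE x in ?M. f x = h0 k x + h1 k x"
      "\<And>k. -1 \<le> k \<Longrightarrow> g k = (w0 k * L0 (cutoff \<Omega> k (h0 k)), w1 k * L1 (cutoff \<Omega> k (h1 k)))"
    by (auto simp only: P_def)
  obtain H0 where H0: "H0 \<in> borel_measurable ?M" "\<And>k \<omega>. -1 \<le> k \<Longrightarrow> \<omega> \<in> shell \<Omega> k \<Longrightarrow> H0 \<omega> = h0 k \<omega>"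
    by (rule glue_shells[OF \<Omega>, of h0]) (simp_all add: h(1))
  obtain H1 where H1: "H1 \<in> borel_measurable ?M" "\<And>k \<omega>. -1 \<le> k \<Longrightarrow> \<omega> \<in> shell \<Omega> k \<Longrightarrow> H1 \<omega> = h1 k \<omega>"
    by (rule glue_shells[OF \<Omega>, of h1]) (simp_all add: h(2))
  have "AE x in ?M. \<forall>k\<in>{-1..}. f x = h0 k x + h1 k x"
    by (rule AE_ball_countable') (use h(3) in auto)
  then have "AE x in ?M. f x = H0 x + H1 x"
    using AE_space
  proof eventually_elim
    case (elim x)
    then obtain k where "-1 \<le> k" "x \<in> shell \<Omega> k" using shell_exists[of x \<Omega>] by auto
    then show ?case using elim H0 H1 by auto
  qed
  moreover have cut: "cutoff \<Omega> k H0 = cutoff \<Omega> k (h0 k)" "cutoff \<Omega> k H1 = cutoff \<Omega> k (h1 k)" if "-1 \<le> k" for k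
    using that H0(2) H1(2) by (auto simp: cutoff_apply)
  have "p = (?N0 H0, ?N1 H1)"
    unfolding p by (auto intro!: enorm_cong simp: cut h(4))
  ultimately show "p \<in> couple ?M ?N0 ?N1 f"
    using H0 H1 unfolding couple_def by blast
qed

section \<open>Interpolation of Herz--Lorentz spaces\<close>

lemma couple_hl_norm:
  fixes f :: "'n::euclidean_space \<Rightarrow> 'b::real_normed_vector"
  assumes "\<Omega> \<in> sets lebesgue"
  shows "couple (lebesgue_on \<Omega>) (hl_norm \<Omega> a0 \<alpha>0 r0 q0) (hl_norm \<Omega> a1 \<alpha>1 r1 q1) f
    = lq_couple {-1..} q0 q1 (\<lambda>k. (\<lambda>(x, y). (ennreal (exp (k * (a0 * ln 2))) * x, ennreal (exp (k * (a1 * ln 2))) * y)) `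
        shell_couple \<Omega> (lnorm (lebesgue_on \<Omega>) \<alpha>0 r0) (lnorm (lebesgue_on \<Omega>) \<alpha>1 r1) f k)"
  unfolding hl_norm_def[abs_def]
  by (rule couple_eq_lq_couple[OF assms])

lemma cutoff_zero: "cutoff \<Omega> k (\<lambda>x. 0) = (\<lambda>x. 0)"
  by (auto simp: cutoff_apply)

lemma AE_cutoff_add:
  "AE x in M. f x = f0 x + f1 x \<Longrightarrow> AE x in M. cutoff \<Omega> k f x = cutoff \<Omega> k f0 x + cutoff \<Omega> k f1 x"
  by (elim eventually_mono) (simp add: cutoff_apply)

lemma shell_couple_same:
  assumes \<Omega>: "\<Omega> \<in> sets lebesgue" and r: "0 < r"
  shows "\<exists>C>0. \<forall>(f :: 'n::euclidean_space \<Rightarrow> 'b::{real_normed_vector, second_countable_topology}) k.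
    f \<in> borel_measurable (lebesgue_on \<Omega>) \<longrightarrow>
    (let L = lnorm (lebesgue_on \<Omega>) \<alpha> r; b = L (cutoff \<Omega> k f); G = shell_couple \<Omega> L L f k
     in (b, 0) \<in> G \<and> (0, b) \<in> G \<and> (\<forall>(x, y)\<in>G. b \<le> ennreal C * (x + y)))"
proof -
  let ?M = "lebesgue_on \<Omega>"
  obtain C where C: "0 < C" "\<And>(f :: 'n \<Rightarrow> 'b) g h. f \<in> borel_measurable ?M \<Longrightarrow> g \<in> borel_measurable ?M \<Longrightarrow>
    (AE x in ?M. h x = f x + g x) \<Longrightarrow> lnorm ?M \<alpha> r h \<le> ennreal C * (lnorm ?M \<alpha> r f + lnorm ?M \<alpha> r g)"
    using lnorm_add_le[OF r, of ?M \<alpha>] by blast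
  show ?thesis
    unfolding Let_def
  proof (intro exI[of _ C] conjI allI impI C(1))
    fix f :: "'n \<Rightarrow> 'b" and k assume f: "f \<in> borel_measurable ?M"
    let ?b = "lnorm ?M \<alpha> r (cutoff \<Omega> k f)"
    let ?G = "shell_couple \<Omega> (lnorm ?M \<alpha> r) (lnorm ?M \<alpha> r) f k"
    have z: "lnorm ?M \<alpha> r (cutoff \<Omega> k (\<lambda>x. 0 :: 'b)) = 0"
      using r by (simp add: cutoff_zero)
    have "\<exists>f0 f1. (?b, 0) = (lnorm ?M \<alpha> r (cutoff \<Omega> k f0), lnorm ?M \<alpha> r (cutoff \<Omega> k f1)) \<and>
        f0 \<in> borel_measurable ?M \<and> f1 \<in> borel_measurable ?M \<and> (AE x in ?M. f x = f0 x + f1 x)"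
      by (rule exI[of _ f], rule exI[of _ "\<lambda>x. 0"]) (simp add: z f)
    then show "(?b, 0) \<in> ?G" unfolding shell_couple_def couple_def by blast
    have "\<exists>f0 f1. (0, ?b) = (lnorm ?M \<alpha> r (cutoff \<Omega> k f0), lnorm ?M \<alpha> r (cutoff \<Omega> k f1)) \<and>
        f0 \<in> borel_measurable ?M \<and> f1 \<in> borel_measurable ?M \<and> (AE x in ?M. f x = f0 x + f1 x)"
      by (rule exI[of _ "\<lambda>x. 0"], rule exI[of _ f]) (simp add: z f)
    then show "(0, ?b) \<in> ?G" unfolding shell_couple_def couple_def by blast
    show "\<forall>(x, y)\<in>?G. ?b \<le> ennreal C * (x + y)"
      unfolding shell_couple_def couple_def
      by (auto intro!: C(2) cutoff_measurable[OF \<Omega>] AE_cutoff_add)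
  qed
qed

text \<open>Each shell contributes the couple of one Lorentz space with itself, and the shells carry the
  geometric weights \<open>2\<^sup>k\<^sup>a\<^sup>0\<close> and \<open>2\<^sup>k\<^sup>a\<^sup>1\<close>.\<close>

theorem hl_interpolation_weights:
  fixes \<Omega> :: "'n::euclidean_space set"
  assumes \<Omega>: "\<Omega> \<in> sets lebesgue" and \<theta>: "0 < \<theta>" "\<theta> < 1" and r: "0 < r" and q: "0 < q0" "0 < q1" "0 < q"
    and ne: "a0 \<noteq> a1" and a: "a = (1 - \<theta>) * a0 + \<theta> * a1"
  shows "\<exists>C>0. \<forall>f \<in> borel_measurable (lebesgue_on \<Omega>). let N = hl_norm \<Omega> a \<alpha> r q (f :: 'n \<Rightarrow> 'b::{real_normed_vector, second_countable_topology});
      J = inorm (couple (lebesgue_on \<Omega>) (hl_norm \<Omega> a0 \<alpha> r q0) (hl_norm \<Omega> a1 \<alpha> r q1) f) \<theta> q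
    in J \<le> ennreal C * N \<and> N \<le> ennreal C * J"
proof -
  let ?L = "lnorm (lebesgue_on \<Omega>) \<alpha> r :: ('n \<Rightarrow> 'b) \<Rightarrow> ennreal"
  obtain c where c: "0 < c" and same: "\<And>(f :: 'n \<Rightarrow> 'b) k. f \<in> borel_measurable (lebesgue_on \<Omega>) \<Longrightarrow>
      (?L (cutoff \<Omega> k f), 0) \<in> shell_couple \<Omega> ?L ?L f k \<and> (0, ?L (cutoff \<Omega> k f)) \<in> shell_couple \<Omega> ?L ?L f k \<and>
       (\<forall>(x, y)\<in>shell_couple \<Omega> ?L ?L f k. ?L (cutoff \<Omega> k f) \<le> ennreal c * (x + y))"
    using shell_couple_same[OF \<Omega> r, of \<alpha>] unfolding Let_def by blast
  have ne': "a0 * ln 2 \<noteq> a1 * ln (2::real)" using ne by simp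
  have a': "a * ln 2 = (1 - \<theta>) * (a0 * ln 2) + \<theta> * (a1 * ln 2)" by (simp add: a algebra_simps)
  have "-1 \<in> {-1::int..}" by simp
  then have I: "{-1::int..} \<noteq> {}" by blast
  obtain C where C: "0 < C" and main: "\<forall>(G :: int \<Rightarrow> (ennreal \<times> ennreal) set) (b :: int \<Rightarrow> ennreal).
    (\<forall>k\<in>{-1..}. (ennreal (exp (k * (a0 * ln 2))) * b k, 0) \<in> G k \<and> (0, ennreal (exp (k * (a1 * ln 2))) * b k) \<in> G k \<and>
       (\<forall>(x, y)\<in>G k. b k \<le> ennreal c * (ennreal (exp (- (k * (a0 * ln 2)))) * x + ennreal (exp (- (k * (a1 * ln 2)))) * y))) \<longrightarrow>
     inorm (lq_couple {-1..} q0 q1 G) \<theta> q \<le> ennreal C * enorm (count_space {-1..}) q (\<lambda>k. ennreal (exp (k * (a * ln 2))) * b k) \<and>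
     enorm (count_space {-1..}) q (\<lambda>k. ennreal (exp (k * (a * ln 2))) * b k) \<le> ennreal C * inorm (lq_couple {-1..} q0 q1 G) \<theta> q"
    using lq_couple_geometric_weights[OF \<theta> q c I ne' a'] by (elim exE conjE) (rule that)
  show ?thesis
    unfolding Let_def
  proof (intro exI[of _ C] conjI C ballI)
    fix f :: "'n \<Rightarrow> 'b" assume f: "f \<in> borel_measurable (lebesgue_on \<Omega>)"
    let ?G = "\<lambda>k::int. (\<lambda>(x, y). (ennreal (exp (k * (a0 * ln 2))) * x, ennreal (exp (k * (a1 * ln 2))) * y)) ` shell_couple \<Omega> ?L ?L f k"
    have b12: "(ennreal (exp (k * (a0 * ln 2))) * ?L (cutoff \<Omega> k f), 0) \<in> ?G k"
      "(0, ennreal (exp (k * (a1 * ln 2))) * ?L (cutoff \<Omega> k f)) \<in> ?G k" for k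
      using same[OF f, of k] by force+
    have b3: "\<forall>(x, y)\<in>?G k. ?L (cutoff \<Omega> k f) \<le>
      ennreal c * (ennreal (exp (- (k * (a0 * ln 2)))) * x + ennreal (exp (- (k * (a1 * ln 2)))) * y)" for k
      using same[OF f, of k] by (auto simp: ennreal_exp_mult)
    have "\<forall>k\<in>{-1..}. (ennreal (exp (k * (a0 * ln 2))) * ?L (cutoff \<Omega> k f), 0) \<in> ?G k \<and>
        (0, ennreal (exp (k * (a1 * ln 2))) * ?L (cutoff \<Omega> k f)) \<in> ?G k \<and>
        (\<forall>(x, y)\<in>?G k. ?L (cutoff \<Omega> k f) \<le>
          ennreal c * (ennreal (exp (- (k * (a0 * ln 2)))) * x + ennreal (exp (- (k * (a1 * ln 2)))) * y))"
      by (rule ballI) (intro conjI b12 b3)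
    from main[THEN spec, THEN spec, THEN mp, OF this]
    show "inorm (couple (lebesgue_on \<Omega>) (hl_norm \<Omega> a0 \<alpha> r q0) (hl_norm \<Omega> a1 \<alpha> r q1) f) \<theta> q \<le> ennreal C * hl_norm \<Omega> a \<alpha> r q f"
      "hl_norm \<Omega> a \<alpha> r q f \<le> ennreal C * inorm (couple (lebesgue_on \<Omega>) (hl_norm \<Omega> a0 \<alpha> r q0) (hl_norm \<Omega> a1 \<alpha> r q1) f) \<theta> q"
      unfolding couple_hl_norm[OF \<Omega>] hl_norm_def[of \<Omega> a] by (rule conjunct1, rule conjunct2)
  qed
qed

text \<open>Reduction to one shell: uniform equivalence on the shells transfers to the whole space, the
  weights being absorbed by \<open>inorm_scale\<close>.\<close>

lemma hl_interpolation_shells: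
  fixes \<Omega> :: "'n::euclidean_space set" and \<theta> r A a0 a1 :: real and q0 q1 :: ennreal
    and L0 L1 L :: "('n \<Rightarrow> 'b::real_normed_vector) \<Rightarrow> ennreal"
  assumes \<Omega>: "\<Omega> \<in> sets lebesgue" and \<theta>: "0 < \<theta>" "\<theta> < 1" and q: "0 < q0" "0 < q1" "0 < r"
    and e: "inverse (ennreal r) = ennreal (1 - \<theta>) * inverse q0 + ennreal \<theta> * inverse q1"
    and a: "a = (1 - \<theta>) * a0 + \<theta> * a1" and A: "0 < A"
    and shells: "\<And>(f :: 'n \<Rightarrow> 'b) k. f \<in> borel_measurable (lebesgue_on \<Omega>) \<Longrightarrow>
      inorm (shell_couple \<Omega> (lnorm (lebesgue_on \<Omega>) \<alpha>0 r0) (lnorm (lebesgue_on \<Omega>) \<alpha>1 r1) f k) \<theta> (ennreal r)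
        \<le> ennreal A * lnorm (lebesgue_on \<Omega>) \<alpha> s (cutoff \<Omega> k f) \<and>
      lnorm (lebesgue_on \<Omega>) \<alpha> s (cutoff \<Omega> k f) \<le> ennreal A *
        inorm (shell_couple \<Omega> (lnorm (lebesgue_on \<Omega>) \<alpha>0 r0) (lnorm (lebesgue_on \<Omega>) \<alpha>1 r1) f k) \<theta> (ennreal r)"
  shows "\<exists>C>0. \<forall>f \<in> borel_measurable (lebesgue_on \<Omega>). let N = hl_norm \<Omega> a \<alpha> s (ennreal r) (f :: 'n \<Rightarrow> 'b);
      J = inorm (couple (lebesgue_on \<Omega>) (hl_norm \<Omega> a0 \<alpha>0 r0 q0) (hl_norm \<Omega> a1 \<alpha>1 r1 q1) f) \<theta> (ennreal r)
    in J \<le> ennreal C * N \<and> N \<le> ennreal C * J"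
proof -
  let ?I = "{-1::int..}"
  obtain B where B: "0 < B" and main: "\<And>G. inorm (lq_couple ?I q0 q1 G) \<theta> (ennreal r)
        \<le> ennreal B * enorm (count_space ?I) (ennreal r) (\<lambda>k. inorm (G k) \<theta> (ennreal r)) \<and>
      enorm (count_space ?I) (ennreal r) (\<lambda>k. inorm (G k) \<theta> (ennreal r))
        \<le> ennreal B * inorm (lq_couple ?I q0 q1 G) \<theta> (ennreal r)"
    using lq_couple_inorm[OF _ \<theta> q e, of ?I] by auto
  have r: "0 < ennreal r" using q by simp
  show ?thesis
    unfolding Let_def
  proof (intro exI[of _ "B * A"] conjI ballI)
    fix f :: "'n \<Rightarrow> 'b" assume f: "f \<in> borel_measurable (lebesgue_on \<Omega>)"
    define S where "S k = shell_couple \<Omega> (lnorm (lebesgue_on \<Omega>) \<alpha>0 r0) (lnorm (lebesgue_on \<Omega>) \<alpha>1 r1) f k" for k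
    define G where "G k = (\<lambda>(x, y). (ennreal (exp (k * (a0 * ln 2))) * x, ennreal (exp (k * (a1 * ln 2))) * y)) ` S k" for k :: int
    let ?J = "inorm (couple (lebesgue_on \<Omega>) (hl_norm \<Omega> a0 \<alpha>0 r0 q0) (hl_norm \<Omega> a1 \<alpha>1 r1 q1) f) \<theta> (ennreal r)"
    let ?N = "hl_norm \<Omega> a \<alpha> s (ennreal r) f"
    let ?b = "\<lambda>k::int. ennreal (exp (k * (a * ln 2))) * lnorm (lebesgue_on \<Omega>) \<alpha> s (cutoff \<Omega> k f)"
    have J: "?J = inorm (lq_couple ?I q0 q1 G) \<theta> (ennreal r)"
      unfolding couple_hl_norm[OF \<Omega>] G_def S_def ..
    have Gk: "inorm (G k) \<theta> (ennreal r) = ennreal (exp (k * (a * ln 2))) * inorm (S k) \<theta> (ennreal r)" for k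
      unfolding G_def inorm_scale[OF r] by (simp add: a algebra_simps)
    have "enorm (count_space ?I) (ennreal r) (\<lambda>k. inorm (G k) \<theta> (ennreal r)) \<le> enorm (count_space ?I) (ennreal r) (\<lambda>k. ennreal A * ?b k)"
    proof (rule enorm_mono[OF r])
      fix k
      have "ennreal (exp (k * (a * ln 2))) * inorm (S k) \<theta> (ennreal r)
        \<le> ennreal (exp (k * (a * ln 2))) * (ennreal A * lnorm (lebesgue_on \<Omega>) \<alpha> s (cutoff \<Omega> k f))"
        using shells[OF f, of k] by (intro mult_left_mono) (auto simp: S_def)
      then show "inorm (G k) \<theta> (ennreal r) \<le> ennreal A * ?b k" by (simp add: Gk mult.left_commute)
    qed
    also have "\<dots> = ennreal A * ?N"
      unfolding hl_norm_def using r by (intro enorm_cmult) auto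
    finally have "ennreal B * enorm (count_space ?I) (ennreal r) (\<lambda>k. inorm (G k) \<theta> (ennreal r)) \<le> ennreal B * (ennreal A * ?N)"
      by (rule mult_left_mono) simp
    then show "?J \<le> ennreal (B * A) * ?N"
      using main[of G] A B unfolding J by (subst (asm) ennreal_mult_mult) auto
    have "?N \<le> enorm (count_space ?I) (ennreal r) (\<lambda>k. ennreal A * inorm (G k) \<theta> (ennreal r))"
      unfolding hl_norm_def
    proof (rule enorm_mono[OF r])
      fix k
      have "?b k \<le> ennreal (exp (k * (a * ln 2))) * (ennreal A * inorm (S k) \<theta> (ennreal r))"
        using shells[OF f, of k] by (intro mult_left_mono) (auto simp: S_def)
      then show "?b k \<le> ennreal A * inorm (G k) \<theta> (ennreal r)" by (simp add: Gk mult.left_commute)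
    qed
    also have "\<dots> = ennreal A * enorm (count_space ?I) (ennreal r) (\<lambda>k. inorm (G k) \<theta> (ennreal r))"
      using r by (intro enorm_cmult) auto
    also have "\<dots> \<le> ennreal A * (ennreal B * ?J)"
      unfolding J using main[of G] by (intro mult_left_mono) auto
    also have "\<dots> = ennreal (B * A) * ?J"
      using A B by (subst ennreal_mult_mult) (auto simp: mult.commute)
    finally show "?N \<le> ennreal (B * A) * ?J" .
  qed (use A B in simp)
qed

theorem hl_interpolation_exponents:
  fixes \<Omega> :: "'n::euclidean_space set"
  assumes \<Omega>: "\<Omega> \<in> sets lebesgue" and \<theta>: "0 < \<theta>" "\<theta> < 1" and r: "0 < r" and q: "0 < q0" "0 < q1" "0 < q"
    and e: "inverse q = ennreal (1 - \<theta>) * inverse q0 + ennreal \<theta> * inverse q1"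
  shows "\<exists>C>0. \<forall>f \<in> borel_measurable (lebesgue_on \<Omega>). let N = hl_norm \<Omega> a \<alpha> r q (f :: 'n \<Rightarrow> 'b::{real_normed_vector, second_countable_topology});
      J = inorm (couple (lebesgue_on \<Omega>) (hl_norm \<Omega> a \<alpha> r q0) (hl_norm \<Omega> a \<alpha> r q1) f) \<theta> q
    in J \<le> ennreal C * N \<and> N \<le> ennreal C * J"
proof -
  let ?L = "lnorm (lebesgue_on \<Omega>) \<alpha> r :: ('n \<Rightarrow> 'b) \<Rightarrow> ennreal"
  obtain c where c: "0 < c" and same: "\<And>(f :: 'n \<Rightarrow> 'b) k. f \<in> borel_measurable (lebesgue_on \<Omega>) \<Longrightarrow>
      (?L (cutoff \<Omega> k f), 0) \<in> shell_couple \<Omega> ?L ?L f k \<and> (0, ?L (cutoff \<Omega> k f)) \<in> shell_couple \<Omega> ?L ?L f k \<and>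
       (\<forall>(x, y)\<in>shell_couple \<Omega> ?L ?L f k. ?L (cutoff \<Omega> k f) \<le> ennreal c * (x + y))"
    using shell_couple_same[OF \<Omega> r, of \<alpha>] unfolding Let_def by blast
  obtain A where A: "0 < A" and diag: "\<And>G b. (b, 0) \<in> G \<Longrightarrow> (0, b) \<in> G \<Longrightarrow> (\<forall>(x, y)\<in>G. b \<le> ennreal c * (x + y)) \<Longrightarrow>
     inorm G \<theta> q \<le> ennreal A * b \<and> b \<le> ennreal A * inorm G \<theta> q"
    using inorm_diagonal[OF \<theta> q(3) c] by blast
  show ?thesis
    using q(3)
  proof (cases rule: exponent_cases)
    case (2 s)
    show ?thesis
      unfolding 2(2)
    proof (rule hl_interpolation_shells[OF \<Omega> \<theta> q(1,2) 2(1) e[unfolded 2(2)] _ A])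
      show "a = (1 - \<theta>) * a + \<theta> * a" by (simp add: algebra_simps)
      show "inorm (shell_couple \<Omega> ?L ?L f k) \<theta> (ennreal s) \<le> ennreal A * ?L (cutoff \<Omega> k f) \<and>
         ?L (cutoff \<Omega> k f) \<le> ennreal A * inorm (shell_couple \<Omega> ?L ?L f k) \<theta> (ennreal s)"
        if "f \<in> borel_measurable (lebesgue_on \<Omega>)" for f :: "'n \<Rightarrow> 'b" and k
      proof -
        note S = same[OF that, of k]
        show ?thesis
          by (rule diag[unfolded 2(2), OF conjunct1[OF S] conjunct1[OF conjunct2[OF S]] conjunct2[OF conjunct2[OF S]]])
      qed
    qed
  next
    case 1
    \<comment> \<open>Now \<open>q\<^sub>0 = q\<^sub>1 = \<infinity>\<close>, and the couple consists of one space taken twice.\<close>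
    have "ennreal (1 - \<theta>) * inverse q0 + ennreal \<theta> * inverse q1 = 0"
      using e unfolding 1 by simp
    then have "ennreal (1 - \<theta>) * inverse q0 = 0" "ennreal \<theta> * inverse q1 = 0"
      by (simp_all only: add_eq_0_iff_both_eq_0 zero_le)
    then have "q0 = top" "q1 = top"
      using \<theta> by (simp_all add: ennreal_eq_0_iff)
    show ?thesis
      unfolding Let_def
    proof (intro exI[of _ A] conjI A ballI)
      fix f :: "'n \<Rightarrow> 'b" assume f: "f \<in> borel_measurable (lebesgue_on \<Omega>)"
      define N where "N = hl_norm \<Omega> a \<alpha> r top f"
      define w where "w k = ennreal (exp (real_of_int k * (a * ln 2)))" for k :: int
      define G where "G k = (\<lambda>(x, y). (w k * x, w k * y)) ` shell_couple \<Omega> ?L ?L f k" for k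
      have cp: "couple (lebesgue_on \<Omega>) (hl_norm \<Omega> a \<alpha> r q0) (hl_norm \<Omega> a \<alpha> r q1) f = lq_couple {-1..} top top G"
        unfolding couple_hl_norm[OF \<Omega>] G_def w_def \<open>q0 = top\<close> \<open>q1 = top\<close> ..
      have N: "N = enorm (count_space {-1..}) top (\<lambda>k. w k * ?L (cutoff \<Omega> k f))"
        unfolding N_def hl_norm_def w_def ..
      have z: "enorm (count_space {-1::int..}) top (\<lambda>k. 0) = 0"
        by (simp add: enorm_def)
      have b: "(w k * ?L (cutoff \<Omega> k f), 0) \<in> G k" "(0, w k * ?L (cutoff \<Omega> k f)) \<in> G k" for k
        using same[OF f, of k] unfolding G_def by force+
      have "(N, 0) \<in> lq_couple {-1..} top top G"
        unfolding lq_couple_def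
        by (rule image_eqI[of _ _ "\<lambda>k. (w k * ?L (cutoff \<Omega> k f), 0)"]) (use b in \<open>auto simp: N z\<close>)
      moreover have "(0, N) \<in> lq_couple {-1..} top top G"
        unfolding lq_couple_def
        by (rule image_eqI[of _ _ "\<lambda>k. (0, w k * ?L (cutoff \<Omega> k f))"]) (use b in \<open>auto simp: N z\<close>)
      moreover have "\<forall>(x, y)\<in>lq_couple {-1..} top top G. N \<le> ennreal c * (x + y)"
      proof clarify
        fix x y assume "(x, y) \<in> lq_couple {-1..} top top G"
        then obtain g where g: "\<And>k. -1 \<le> k \<Longrightarrow> g k \<in> G k"
          and xy: "x = enorm (count_space {-1..}) top (\<lambda>k. fst (g k))" "y = enorm (count_space {-1..}) top (\<lambda>k. snd (g k))"
          by (auto simp: lq_couple_def)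
        have "w k * ?L (cutoff \<Omega> k f) \<le> ennreal c * (x + y)" if k: "-1 \<le> k" for k
        proof -
          obtain u v where uv: "(u, v) \<in> shell_couple \<Omega> ?L ?L f k" "g k = (w k * u, w k * v)"
            using g[OF k] by (auto simp: G_def)
          have "?L (cutoff \<Omega> k f) \<le> ennreal c * (u + v)" using same[OF f, of k] uv(1) by auto
          then have "w k * ?L (cutoff \<Omega> k f) \<le> w k * (ennreal c * (u + v))" by (rule mult_left_mono) simp
          also have "\<dots> = ennreal c * (fst (g k) + snd (g k))" by (simp add: uv distrib_left ac_simps)
          also have "\<dots> \<le> ennreal c * (x + y)"
            unfolding xy using enorm_count_space_ge[of top k "{-1..}" "\<lambda>k. fst (g k)"]
              enorm_count_space_ge[of top k "{-1..}" "\<lambda>k. snd (g k)"] k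
            by (intro mult_left_mono add_mono) auto
          finally show ?thesis .
        qed
        then show "N \<le> ennreal c * (x + y)" unfolding N enorm_def by (auto intro: SUP_least)
      qed
      ultimately have "inorm (lq_couple {-1..} top top G) \<theta> q \<le> ennreal A * N \<and> N \<le> ennreal A * inorm (lq_couple {-1..} top top G) \<theta> q"
        by (rule diag)
      then show "inorm (couple (lebesgue_on \<Omega>) (hl_norm \<Omega> a \<alpha> r q0) (hl_norm \<Omega> a \<alpha> r q1) f) \<theta> q \<le> ennreal A * hl_norm \<Omega> a \<alpha> r q f"
        "hl_norm \<Omega> a \<alpha> r q f \<le> ennreal A * inorm (couple (lebesgue_on \<Omega>) (hl_norm \<Omega> a \<alpha> r q0) (hl_norm \<Omega> a \<alpha> r q1) f) \<theta> q"
        unfolding cp by (auto simp: N_def 1)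
    qed
  qed
qed

lemma shell_couple_truncations:
  fixes f :: "'n::euclidean_space \<Rightarrow> 'b::real_normed_vector"
  assumes [measurable]: "f \<in> borel_measurable (lebesgue_on \<Omega>)" and \<Omega>: "\<Omega> \<in> sets lebesgue"
  shows "(L0 (upper_part l (cutoff \<Omega> k f)), L1 (lower_part l (cutoff \<Omega> k f))) \<in> shell_couple \<Omega> L0 L1 f k"
    "(L0 (lower_part l (cutoff \<Omega> k f)), L1 (upper_part l (cutoff \<Omega> k f))) \<in> shell_couple \<Omega> L0 L1 f k"
proof -
  have m: "upper_part l f \<in> borel_measurable (lebesgue_on \<Omega>)" "lower_part l f \<in> borel_measurable (lebesgue_on \<Omega>)"
    unfolding upper_part_def[abs_def] lower_part_def[abs_def] by measurable
  have 1: "AE x in lebesgue_on \<Omega>. f x = upper_part l f x + lower_part l f x"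
    "AE x in lebesgue_on \<Omega>. f x = lower_part l f x + upper_part l f x"
    by (simp_all add: upper_part_def lower_part_def)
  have "\<exists>f0 f1. (L0 (upper_part l (cutoff \<Omega> k f)), L1 (lower_part l (cutoff \<Omega> k f))) = (L0 (cutoff \<Omega> k f0), L1 (cutoff \<Omega> k f1)) \<and>
      f0 \<in> borel_measurable (lebesgue_on \<Omega>) \<and> f1 \<in> borel_measurable (lebesgue_on \<Omega>) \<and> (AE x in lebesgue_on \<Omega>. f x = f0 x + f1 x)"
    by (rule exI[of _ "upper_part l f"], rule exI[of _ "lower_part l f"]) (use m 1(1) in \<open>simp add: cutoff_upper_part cutoff_lower_part\<close>)
  then show "(L0 (upper_part l (cutoff \<Omega> k f)), L1 (lower_part l (cutoff \<Omega> k f))) \<in> shell_couple \<Omega> L0 L1 f k"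
    unfolding shell_couple_def couple_def by (rule CollectI)
  have "\<exists>f0 f1. (L0 (lower_part l (cutoff \<Omega> k f)), L1 (upper_part l (cutoff \<Omega> k f))) = (L0 (cutoff \<Omega> k f0), L1 (cutoff \<Omega> k f1)) \<and>
      f0 \<in> borel_measurable (lebesgue_on \<Omega>) \<and> f1 \<in> borel_measurable (lebesgue_on \<Omega>) \<and> (AE x in lebesgue_on \<Omega>. f x = f0 x + f1 x)"
    by (rule exI[of _ "lower_part l f"], rule exI[of _ "upper_part l f"]) (use m 1(2) in \<open>simp add: cutoff_upper_part cutoff_lower_part\<close>)
  then show "(L0 (lower_part l (cutoff \<Omega> k f)), L1 (upper_part l (cutoff \<Omega> k f))) \<in> shell_couple \<Omega> L0 L1 f k"
    unfolding shell_couple_def couple_def by (rule CollectI)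
qed

theorem hl_interpolation_lorentz:
  fixes \<Omega> :: "'n::euclidean_space set"
  assumes \<Omega>: "\<Omega> \<in> sets lebesgue" and \<theta>: "0 < \<theta>" "\<theta> < 1" and q: "0 < q0" "0 < q1" "0 < q" "q < top"
    and e: "inverse q = ennreal (1 - \<theta>) * inverse q0 + ennreal \<theta> * inverse q1"
    and a: "a = (1 - \<theta>) * a0 + \<theta> * a1"
    and \<alpha>: "\<alpha>0 \<noteq> \<alpha>1" "\<alpha> = (1 - \<theta>) * \<alpha>0 + \<theta> * \<alpha>1"
    and r0: "0 < r0" "0 \<le> \<alpha>0" "\<alpha>0 = 0 \<longrightarrow> r0 = top" and r1: "0 < r1" "0 \<le> \<alpha>1" "\<alpha>1 = 0 \<longrightarrow> r1 = top"
  shows "\<exists>C>0. \<forall>f \<in> borel_measurable (lebesgue_on \<Omega>). let N = hl_norm \<Omega> a \<alpha> q q (f :: 'n \<Rightarrow> 'b::{real_normed_vector, second_countable_topology});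
      J = inorm (couple (lebesgue_on \<Omega>) (hl_norm \<Omega> a0 \<alpha>0 r0 q0) (hl_norm \<Omega> a1 \<alpha>1 r1 q1) f) \<theta> q
    in J \<le> ennreal C * N \<and> N \<le> ennreal C * J"
proof -
  let ?M = "lebesgue_on \<Omega>"
  let ?S = "\<lambda>(f :: 'n \<Rightarrow> 'b) k. shell_couple \<Omega> (lnorm ?M \<alpha>0 r0) (lnorm ?M \<alpha>1 r1) f k"
  obtain s where s: "0 < s" "q = ennreal s" using q by (cases q) auto
  obtain B where B: "0 < B" and lower: "\<And>(f :: 'n \<Rightarrow> 'b) G. (\<forall>(u, v)\<in>G. \<exists>f0\<in>borel_measurable ?M. \<exists>f1\<in>borel_measurable ?M.
      (AE x in ?M. f x = f0 x + f1 x) \<and> u = lnorm ?M \<alpha>0 r0 f0 \<and> v = lnorm ?M \<alpha>1 r1 f1) \<Longrightarrow>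
    lnorm ?M \<alpha> q f \<le> ennreal B * inorm G \<theta> q"
    using lorentz_interpolation_lower[OF \<alpha> q(3) r0 r1, of ?M] by (elim exE conjE) (rule that, assumption, elim allE, erule mp)
  have low: "lnorm ?M \<alpha> q (cutoff \<Omega> k f) \<le> ennreal B * inorm (?S f k) \<theta> q" for f :: "'n \<Rightarrow> 'b" and k
  proof (rule lower, intro ballI, unfold case_prod_beta)
    fix p assume "p \<in> ?S f k"
    then obtain f0 f1 where f: "f0 \<in> borel_measurable ?M" "f1 \<in> borel_measurable ?M" "AE x in ?M. f x = f0 x + f1 x"
      and uv: "fst p = lnorm ?M \<alpha>0 r0 (cutoff \<Omega> k f0)" "snd p = lnorm ?M \<alpha>1 r1 (cutoff \<Omega> k f1)"
      by (auto simp: shell_couple_def couple_def)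
    show "\<exists>f0\<in>borel_measurable ?M. \<exists>f1\<in>borel_measurable ?M.
      (AE x in ?M. cutoff \<Omega> k f x = f0 x + f1 x) \<and> fst p = lnorm ?M \<alpha>0 r0 f0 \<and> snd p = lnorm ?M \<alpha>1 r1 f1"
      using cutoff_measurable[OF \<Omega> f(1), of k] cutoff_measurable[OF \<Omega> f(2), of k] AE_cutoff_add[OF f(3), of \<Omega> k] uv by blast
  qed
  have "\<exists>A>0. \<forall>(f :: 'n \<Rightarrow> 'b) k. f \<in> borel_measurable ?M \<longrightarrow> inorm (?S f k) \<theta> q \<le> ennreal A * lnorm ?M \<alpha> q (cutoff \<Omega> k f)"
  proof (cases "\<alpha>1 < \<alpha>0")
    case True
    obtain A where A: "0 < A" and upper: "\<And>(f :: 'n \<Rightarrow> 'b) G. f \<in> borel_measurable ?M \<Longrightarrow>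
        (\<forall>l. (lnorm ?M \<alpha>0 r0 (upper_part l f), lnorm ?M \<alpha>1 r1 (lower_part l f)) \<in> G) \<Longrightarrow>
      inorm G \<theta> q \<le> ennreal A * lnorm ?M \<alpha> q f"
      using lorentz_interpolation_upper[OF \<theta> True \<alpha>(2) q(3) r0(1) r1, of ?M] by blast
    show ?thesis
      by (intro exI[of _ A] conjI A allI impI upper cutoff_measurable[OF \<Omega>] shell_couple_truncations[OF _ \<Omega>])
  next
    case False
    then have less: "\<alpha>0 < \<alpha>1" using \<alpha> by simp
    \<comment> \<open>The two spaces exchange their roles, and \<open>\<theta>\<close> becomes \<open>1 - \<theta>\<close>.\<close>
    have \<theta>': "0 < 1 - \<theta>" "1 - \<theta> < 1" using \<theta> by auto
    have \<alpha>': "\<alpha> = (1 - (1 - \<theta>)) * \<alpha>1 + (1 - \<theta>) * \<alpha>0" by (simp add: \<alpha>)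
    obtain A where A: "0 < A" and upper: "\<And>(f :: 'n \<Rightarrow> 'b) G. f \<in> borel_measurable ?M \<Longrightarrow>
        (\<forall>l. (lnorm ?M \<alpha>1 r1 (upper_part l f), lnorm ?M \<alpha>0 r0 (lower_part l f)) \<in> G) \<Longrightarrow>
      inorm G (1 - \<theta>) q \<le> ennreal A * lnorm ?M \<alpha> q f"
      using lorentz_interpolation_upper[OF \<theta>' less \<alpha>' q(3) r1(1) r0, of ?M] by blast
    have "inorm (prod.swap ` ?S f k) (1 - \<theta>) q \<le> ennreal A * lnorm ?M \<alpha> q (cutoff \<Omega> k f)"
      if f: "f \<in> borel_measurable ?M" for f :: "'n \<Rightarrow> 'b" and k
    proof (intro upper cutoff_measurable[OF \<Omega> f] allI)
      fix l
      show "(lnorm ?M \<alpha>1 r1 (upper_part l (cutoff \<Omega> k f)), lnorm ?M \<alpha>0 r0 (lower_part l (cutoff \<Omega> k f))) \<in> prod.swap ` ?S f k"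
        by (rule image_eqI[OF _ shell_couple_truncations(2)[OF f \<Omega>]]) simp
    qed
    then show ?thesis using A by (intro exI[of _ A]) (simp add: inorm_swap[OF q(3)])
  qed
  then obtain A where A: "0 < A" and up: "\<And>(f :: 'n \<Rightarrow> 'b) k. f \<in> borel_measurable ?M \<Longrightarrow> inorm (?S f k) \<theta> q \<le> ennreal A * lnorm ?M \<alpha> q (cutoff \<Omega> k f)"
    by blast
  have AB: "0 < max A B" using A by simp
  show ?thesis
    unfolding s(2)
  proof (rule hl_interpolation_shells[OF \<Omega> \<theta> q(1,2) s(1) e[unfolded s(2)] a AB])
    fix f :: "'n \<Rightarrow> 'b" and k assume f: "f \<in> borel_measurable ?M"
    have "x \<le> ennreal (max A B) * y" if "x \<le> ennreal A * y \<or> x \<le> ennreal B * y" for x y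
    proof -
      have "ennreal A * y \<le> ennreal (max A B) * y" "ennreal B * y \<le> ennreal (max A B) * y"
        by (intro mult_right_mono ennreal_leI; simp)+
      then show ?thesis using that by (auto intro: order_trans)
    qed
    then show "inorm (?S f k) \<theta> (ennreal s) \<le> ennreal (max A B) * lnorm ?M \<alpha> (ennreal s) (cutoff \<Omega> k f) \<and>
      lnorm ?M \<alpha> (ennreal s) (cutoff \<Omega> k f) \<le> ennreal (max A B) * inorm (?S f k) \<theta> (ennreal s)"
      using up[OF f, of k] low[of k f] unfolding s(2) by blast
  qed
qed

section \<open>The interpolation theorem\<close>

lemma real_interpolation_equivalentI:
  assumes "normed_by M X0 N0" "normed_by M X1 N1" "normed_by M Y N" "0 < q"
    and "\<exists>C>0. \<forall>f\<in>borel_measurable M. let n = N f; J = inorm (couple M N0 N1 f) \<theta> q in J \<le> ennreal C * n \<and> n \<le> ennreal C * J"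
  shows "real_interpolation M X0 X1 \<theta> q \<cong>\<^sub>q Y"
proof -
  obtain C where C: "0 < C" "\<forall>f\<in>borel_measurable M. inorm (couple M N0 N1 f) \<theta> q \<le> ennreal C * N f \<and> N f \<le> ennreal C * inorm (couple M N0 N1 f) \<theta> q"
    using assms(5) unfolding Let_def by (elim exE conjE) (rule that)
  show ?thesis
    by (rule real_interpolation_equivalent[OF assms(1-4) C(1)]) (use C(2) in auto)
qed

lemma inverse_exponent:
  fixes p :: ennreal
  assumes "1 \<le> p"
  shows "inverse p = ennreal (enn2real (inverse p))" "enn2real (inverse p) = 0 \<longleftrightarrow> p = top"
proof -
  have "p \<noteq> 0" using assms by auto
  then show "inverse p = ennreal (enn2real (inverse p))"
    by (simp add: less_top[symmetric])
  show "enn2real (inverse p) = 0 \<longleftrightarrow> p = top"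
    using \<open>p \<noteq> 0\<close> by (auto simp: enn2real_eq_0_iff)
qed

lemma inverse_exponent_inj:
  fixes p0 p1 :: ennreal
  assumes "1 \<le> p0" "1 \<le> p1" "p0 \<noteq> p1"
  shows "enn2real (inverse p0) \<noteq> enn2real (inverse p1)"
proof
  assume "enn2real (inverse p0) = enn2real (inverse p1)"
  then have e: "inverse p0 = inverse p1"
    using inverse_exponent(1)[OF assms(1)] inverse_exponent(1)[OF assms(2)] by simp
  have p: "p0 \<noteq> 0" "p1 \<noteq> 0" using assms by auto
  show False
    using e p assms(3) by (cases p0; cases p1) (auto simp: inverse_ennreal ennreal_inj)
qed

lemma inverse_exponent_convex:
  fixes p p0 p1 :: ennreal and \<theta> :: real
  assumes "1 \<le> p0" "1 \<le> p1" "0 < \<theta>" "\<theta> < 1" "inverse p = ennreal (1 - \<theta>) * inverse p0 + ennreal \<theta> * inverse p1"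
  shows "enn2real (inverse p) = (1 - \<theta>) * enn2real (inverse p0) + \<theta> * enn2real (inverse p1)"
proof -
  have "inverse p = ennreal (1 - \<theta>) * ennreal (enn2real (inverse p0)) + ennreal \<theta> * ennreal (enn2real (inverse p1))"
    using assms(5) inverse_exponent(1)[OF assms(1)] inverse_exponent(1)[OF assms(2)] by simp
  also have "\<dots> = ennreal ((1 - \<theta>) * enn2real (inverse p0) + \<theta> * enn2real (inverse p1))"
    using assms(3,4) by (simp add: ennreal_mult)
  finally have "inverse p = \<dots>" .
  moreover have "0 \<le> (1 - \<theta>) * enn2real (inverse p0) + \<theta> * enn2real (inverse p1)"
    using assms(3,4) by simp
  ultimately show ?thesis by (simp only: enn2real_ennreal)
qed

text \<open>The common form of the results with \<open>p\<^sub>0 \<noteq> p\<^sub>1\<close>: \<open>r\<^sub>i = \<infinity>\<close> is required when \<open>p\<^sub>i = \<infinity>\<close>, and the spaces are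
  given only through their quasi-norms, so that Herz spaces are covered by \<open>r\<^sub>i = p\<^sub>i\<close>.\<close>

lemma herz_lorentz_interpolation:
  fixes \<Omega> :: "'n::euclidean_space set" and X0 X1 Y :: "('n \<Rightarrow> 'b::{real_normed_vector, second_countable_topology}) qn_space"
  assumes \<Omega>: "\<Omega> \<in> sets lebesgue" and \<theta>: "0 < \<theta>" "\<theta> < 1" and q: "0 < q0" "0 < q1" "0 < q" "q < top"
    and e: "inverse q = ennreal (1 - \<theta>) * inverse q0 + ennreal \<theta> * inverse q1"
    and a: "a = (1 - \<theta>) * a0 + \<theta> * a1"
    and p: "1 \<le> p0" "1 \<le> p1" "p0 \<noteq> p1" "inverse p = ennreal (1 - \<theta>) * inverse p0 + ennreal \<theta> * inverse p1"
    and r: "0 < r0" "p0 = top \<Longrightarrow> r0 = top" "0 < r1" "p1 = top \<Longrightarrow> r1 = top"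
    and X0: "normed_by (lebesgue_on \<Omega>) X0 (hl_norm \<Omega> a0 (enn2real (inverse p0)) r0 q0)"
    and X1: "normed_by (lebesgue_on \<Omega>) X1 (hl_norm \<Omega> a1 (enn2real (inverse p1)) r1 q1)"
    and Y: "normed_by (lebesgue_on \<Omega>) Y (hl_norm \<Omega> a (enn2real (inverse p)) q q)"
  shows "real_interpolation (lebesgue_on \<Omega>) X0 X1 \<theta> q \<cong>\<^sub>q Y"
  by (rule real_interpolation_equivalentI[OF X0 X1 Y q(3) hl_interpolation_lorentz[OF \<Omega> \<theta> q e a
        inverse_exponent_inj[OF p(1-3)] inverse_exponent_convex[OF p(1,2) \<theta> p(4)]]])
    (use r inverse_exponent(2) p in auto)

theorem theorem3p1p1p7:
  fixes \<Omega> :: "(real ^ 'n) set" and \<theta> a0 a1 a :: real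
    and HL :: "real \<Rightarrow> ennreal \<Rightarrow> ennreal \<Rightarrow> ennreal \<Rightarrow>
      (real ^ 'n \<Rightarrow> 'k::{real_normed_field, second_countable_topology}) qn_space"
    and K :: "real \<Rightarrow> ennreal \<Rightarrow> ennreal \<Rightarrow> (real ^ 'n \<Rightarrow> 'k) qn_space"
    and interp :: "(real ^ 'n \<Rightarrow> 'k) qn_space \<Rightarrow> (real ^ 'n \<Rightarrow> 'k) qn_space \<Rightarrow> ennreal \<Rightarrow>
      (real ^ 'n \<Rightarrow> 'k) qn_space"
  assumes "\<Omega> \<in> sets lebesgue" and "0 < \<theta>" and "\<theta> < 1"
  defines "HL \<equiv> herz_lorentz \<Omega>" and "K \<equiv> herz \<Omega>"
    and "interp \<equiv> \<lambda>Z0 Z1 q. real_interpolation (lebesgue_on \<Omega>) Z0 Z1 \<theta> q"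
  shows
    "(\<forall>p r q0 q1 q :: ennreal.
        1 \<le> r \<and> r \<le> p \<and> p < top \<and> 0 < q0 \<and> 0 < q1 \<and> 0 < q \<longrightarrow>
          (a0 \<noteq> a1 \<and> a = (1 - \<theta>) * a0 + \<theta> * a1 \<longrightarrow>
             interp (HL a0 p r q0) (HL a1 p r q1) q \<cong>\<^sub>q HL a p r q) \<and>
          (inverse q = ennreal (1 - \<theta>) * inverse q0 + ennreal \<theta> * inverse q1 \<longrightarrow>
             interp (HL a p r q0) (HL a p r q1) q \<cong>\<^sub>q HL a p r q)) \<and>
     (\<forall>p0 p1 p r0 r1 q0 q1 q :: ennreal.
        0 < q0 \<and> q0 < top \<and> 0 < q1 \<and> q1 < top \<and> 0 < q \<and> q < top \<and>
        1 \<le> p0 \<and> 1 \<le> p1 \<and> p0 \<noteq> p1 \<and> 1 \<le> r0 \<and> r0 \<le> p0 \<and> p0 < top \<and> 1 \<le> r1 \<and> r1 \<le> p1 \<and> p1 < top \<and>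
        a = (1 - \<theta>) * a0 + \<theta> * a1 \<and>
        inverse p = ennreal (1 - \<theta>) * inverse p0 + ennreal \<theta> * inverse p1 \<and>
        inverse q = ennreal (1 - \<theta>) * inverse q0 + ennreal \<theta> * inverse q1 \<longrightarrow>
          interp (HL a0 p0 r0 q0) (HL a1 p1 r1 q1) q \<cong>\<^sub>q HL a p q q \<and>
          (p = q \<longrightarrow> interp (HL a0 p0 r0 q0) (HL a1 p1 r1 q1) q \<cong>\<^sub>q K a p p)) \<and>
     (\<forall>p0 p1 p q0 q1 q :: ennreal.
        0 < q0 \<and> q0 < top \<and> 0 < q1 \<and> q1 < top \<and>
        a = (1 - \<theta>) * a0 + \<theta> * a1 \<and>
        inverse q = ennreal (1 - \<theta>) * inverse q0 + ennreal \<theta> * inverse q1 \<and>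
        1 \<le> p0 \<and> 1 \<le> p1 \<and> p0 \<noteq> p1 \<and>
        inverse p = ennreal (1 - \<theta>) * inverse p0 + ennreal \<theta> * inverse p1 \<longrightarrow>
          interp (K a0 p0 q0) (K a1 p1 q1) q \<cong>\<^sub>q HL a p q q)"
proof -
  note \<Omega> = assms(1) and \<theta> = assms(2,3)
  have pos: "0 < x" if "1 \<le> x" for x :: ennreal
    using that by (rule less_le_trans[rotated]) simp
  show ?thesis
    unfolding HL_def K_def interp_def
  proof (intro conjI allI impI; elim conjE)
    fix p r q0 q1 q :: ennreal
    assume r: "1 \<le> r" and q: "0 < q0" "0 < q1" "0 < q" and a: "a0 \<noteq> a1" "a = (1 - \<theta>) * a0 + \<theta> * a1"
    show "real_interpolation (lebesgue_on \<Omega>) (herz_lorentz \<Omega> a0 p r q0 :: (real ^ 'n \<Rightarrow> 'k) qn_space)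
        (herz_lorentz \<Omega> a1 p r q1) \<theta> q \<cong>\<^sub>q herz_lorentz \<Omega> a p r q"
      by (rule real_interpolation_equivalentI[OF normed_by_herz_lorentz[OF \<Omega> pos[OF r] q(1)]
            normed_by_herz_lorentz[OF \<Omega> pos[OF r] q(2)] normed_by_herz_lorentz[OF \<Omega> pos[OF r] q(3)] q(3)
            hl_interpolation_weights[OF \<Omega> \<theta> pos[OF r] q a]])
  next
    fix p r q0 q1 q :: ennreal
    assume r: "1 \<le> r" and q: "0 < q0" "0 < q1" "0 < q"
      and e: "inverse q = ennreal (1 - \<theta>) * inverse q0 + ennreal \<theta> * inverse q1"
    show "real_interpolation (lebesgue_on \<Omega>) (herz_lorentz \<Omega> a p r q0 :: (real ^ 'n \<Rightarrow> 'k) qn_space)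
        (herz_lorentz \<Omega> a p r q1) \<theta> q \<cong>\<^sub>q herz_lorentz \<Omega> a p r q"
      by (rule real_interpolation_equivalentI[OF normed_by_herz_lorentz[OF \<Omega> pos[OF r] q(1)]
            normed_by_herz_lorentz[OF \<Omega> pos[OF r] q(2)] normed_by_herz_lorentz[OF \<Omega> pos[OF r] q(3)] q(3)
            hl_interpolation_exponents[OF \<Omega> \<theta> pos[OF r] q e]])
  next
    fix p0 p1 p r0 r1 q0 q1 q :: ennreal
    assume q: "0 < q0" "0 < q1" "0 < q" "q < top" and p: "1 \<le> p0" "1 \<le> p1" "p0 \<noteq> p1" "p0 < top" "p1 < top"
      and r: "1 \<le> r0" "1 \<le> r1" and a: "a = (1 - \<theta>) * a0 + \<theta> * a1"
      and ep: "inverse p = ennreal (1 - \<theta>) * inverse p0 + ennreal \<theta> * inverse p1"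
      and e: "inverse q = ennreal (1 - \<theta>) * inverse q0 + ennreal \<theta> * inverse q1"
    have *: "real_interpolation (lebesgue_on \<Omega>) (herz_lorentz \<Omega> a0 p0 r0 q0 :: (real ^ 'n \<Rightarrow> 'k) qn_space)
        (herz_lorentz \<Omega> a1 p1 r1 q1) \<theta> q \<cong>\<^sub>q Y"
      if "normed_by (lebesgue_on \<Omega>) Y (hl_norm \<Omega> a (enn2real (inverse p)) q q)" for Y
      by (rule herz_lorentz_interpolation[OF \<Omega> \<theta> q e a p(1-3) ep pos[OF r(1)] _ pos[OF r(2)] _
            normed_by_herz_lorentz[OF \<Omega> pos[OF r(1)] q(1)] normed_by_herz_lorentz[OF \<Omega> pos[OF r(2)] q(2)] that])
        (use p in auto)
    show "real_interpolation (lebesgue_on \<Omega>) (herz_lorentz \<Omega> a0 p0 r0 q0 :: (real ^ 'n \<Rightarrow> 'k) qn_space)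
        (herz_lorentz \<Omega> a1 p1 r1 q1) \<theta> q \<cong>\<^sub>q herz_lorentz \<Omega> a p q q"
      by (rule *) (rule normed_by_herz_lorentz[OF \<Omega> q(3) q(3)])
    show "real_interpolation (lebesgue_on \<Omega>) (herz_lorentz \<Omega> a0 p0 r0 q0 :: (real ^ 'n \<Rightarrow> 'k) qn_space)
        (herz_lorentz \<Omega> a1 p1 r1 q1) \<theta> q \<cong>\<^sub>q herz \<Omega> a p p" if "p = q"
      using normed_by_herz[OF \<Omega> q(3) q(3), of a] unfolding that by (intro *) (simp add: that)
  next
    fix p0 p1 p q0 q1 q :: ennreal
    assume q: "0 < q0" "q0 < top" "0 < q1" "q1 < top" and p: "1 \<le> p0" "1 \<le> p1" "p0 \<noteq> p1"
      and a: "a = (1 - \<theta>) * a0 + \<theta> * a1"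
      and ep: "inverse p = ennreal (1 - \<theta>) * inverse p0 + ennreal \<theta> * inverse p1"
      and e: "inverse q = ennreal (1 - \<theta>) * inverse q0 + ennreal \<theta> * inverse q1"
    have "inverse q \<noteq> 0" "inverse q \<noteq> top"
      using q \<theta> unfolding e by (auto simp: ennreal_mult_eq_top_iff ennreal_eq_0_iff)
    then have q': "0 < q" "q < top" by (auto simp: zero_less_iff_neq_zero less_top[symmetric])
    show "real_interpolation (lebesgue_on \<Omega>) (herz \<Omega> a0 p0 q0 :: (real ^ 'n \<Rightarrow> 'k) qn_space)
        (herz \<Omega> a1 p1 q1) \<theta> q \<cong>\<^sub>q herz_lorentz \<Omega> a p q q"
      by (rule herz_lorentz_interpolation[OF \<Omega> \<theta> q(1,3) q' e a p ep pos[OF p(1)] _ pos[OF p(2)] _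
            normed_by_herz[OF \<Omega> pos[OF p(1)] q(1)] normed_by_herz[OF \<Omega> pos[OF p(2)] q(3)]
            normed_by_herz_lorentz[OF \<Omega> q'(1) q'(1)]])
  qed
qed

end
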